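(* Let $\Gamma\subset\mathbb{R}$ be a separated set and let $\mathcal{G}$ be a non-trivial (not a.e. zero) generator satisfying $|\hat{\mathcal{G}}|^2\in W$. Then the $\Gamma$-shifts of $\mathcal{G}$ are $l^2$-stable if and only if there is a number $r>0$ such that $\Gamma$ is an interpolation set for $PW_{\{|\hat{\mathcal{G}}|>r\}}$, where $\{|\hat{\mathcal{G}}|>r\}:=\{t\in\mathbb{R}: |\hat{\mathcal{G}}(t)|>r\}$ (a set defined up to a null set).
   Context: Fourier transform: $\hat f(x)=\int_{\mathbb{R}} e^{-2\pi i xt}f(t)\,dt$, extended to $L^2(\mathbb{R})$ as usual. The Wiener amalgam space $W$ consists of measurable $f:\mathbb{R}\to\mathbb{C}$ with $\|f\|_W:=\sum_{k\in\mathbb{Z}}\|f\|_{L^\infty(k,k+1)}<\infty$. The condition $|\hat{\mathcal{G}}|^2\in W$ implies $\hat{\mathcal{G}}\in L^2(\mathbb{R})$, so $\mathcal{G}:\mathbb{R}\to\mathbb{C}$ is a function in $L^2(\mathbb{R})$. A set $\Gamma\subset\mathbb{R}$ is separated if $\Delta(\Gamma):=\inf_{\gamma,\gamma'\in\Gamma,\gamma\ne\gamma'}|\gamma-\gamma'|>0$. The $\Gamma$-shifts of $\mathcal{G}$ are $l^2$-stable if there exist positive constants $C_1,C_2$ with $C_1\|\mathbf{c}\|_2\le\|\sum_{\gamma\in\Gamma}c_\gamma\mathcal{G}(\cdot-\gamma)\|_{2}\le C_2\|\mathbf{c}\|_2$ for every $\mathbf{c}=\{c_\gamma\}\in l^2(\Gamma)$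 (the series being understood as converging in $L^2(\mathbb{R})$). For a set $S\subset\mathbb{R}$ of finite positive measure, $PW_S$ is the space of all $f\in L^2(\mathbb{R})$ whose inverse Fourier transform vanishes a.e. outside $S$ (each such $f$ is identified with its continuous representative). A separated set $\Gamma$ is an interpolation set for $PW_S$ if for every $\{c_\gamma\}\in l^2(\Gamma)$ there exists $f\in PW_S$ with $f(\gamma)=c_\gamma$ for all $\gamma\in\Gamma$. *)

theory Defs
  imports "HOL-Analysis.Analysis" "HOL-Probability.Essential_Supremum"
begin

text \<open>Elements of the Lebesgue spaces are represented by functions, not by equivalence classes
  modulo null sets.\<close>

definition L1 :: "(real \<Rightarrow> complex) set" where
  "L1 = {f. integrable lebesgue f}"

definition L2 :: "(real \<Rightarrow> complex) set" where
  "L2 = {f. f \<in> borel_measurable lebesgue \<and> integrable lebesgue (\<lambda>x. (cmod (f x))\<^sup>2)}"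

text \<open>Meaningful only on \<^const>\<open>L2\<close>: the Bochner integral of a non-integrable function is 0.\<close>

definition L2_norm :: "(real \<Rightarrow> complex) \<Rightarrow> real" where
  "L2_norm f = sqrt (LINT x|lebesgue. (cmod (f x))\<^sup>2)"

definition L2_tendsto ::
  "('i \<Rightarrow> real \<Rightarrow> complex) \<Rightarrow> (real \<Rightarrow> complex) \<Rightarrow> 'i filter \<Rightarrow> bool" where
  "L2_tendsto h f F \<longleftrightarrow> f \<in> L2 \<and> (\<forall>\<^sub>F i in F. h i \<in> L2) \<and>
     ((\<lambda>i. L2_norm (\<lambda>x. h i x - f x)) \<longlongrightarrow> 0) F"

definition fourier_L1 :: "(real \<Rightarrow> complex) \<Rightarrow> real \<Rightarrow> complex" where
  "fourier_L1 f x = (LINT t|lebesgue. exp (- 2 * pi * \<i> * x * t) * f t)"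

text \<open>The extension by continuity from the dense subspace \<open>L1 \<inter> L2\<close>. The transform of an
  \<^const>\<open>L2\<close> function is determined only up to a null set, so it is given as a relation:
  \<open>g\<close> is a representative of the Fourier transform of \<open>f\<close>.\<close>

definition has_fourier_L2 :: "(real \<Rightarrow> complex) \<Rightarrow> (real \<Rightarrow> complex) \<Rightarrow> bool" where
  "has_fourier_L2 f g \<longleftrightarrow>
     (\<exists>h :: nat \<Rightarrow> real \<Rightarrow> complex. (\<forall>n. h n \<in> L1 \<inter> L2) \<and>
        L2_tendsto h f sequentially \<and> L2_tendsto (\<lambda>n. fourier_L1 (h n)) g sequentially)"

text \<open>The inverse of the unitary operator defined by \<^const>\<open>has_fourier_L2\<close>.\<close>

definition has_inverse_fourier_L2 :: "(real \<Rightarrow> complex) \<Rightarrow> (real \<Rightarrow> complex) \<Rightarrow> bool" where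
  "has_inverse_fourier_L2 f g \<longleftrightarrow> has_fourier_L2 g f"

definition amalgam_norm :: "(real \<Rightarrow> complex) \<Rightarrow> ennreal" where
  "amalgam_norm f = (\<Sum>\<^sub>\<infinity>k::int\<in>UNIV.
     esssup (restrict_space lebesgue {of_int k<..<of_int k + 1}) (\<lambda>x. ennreal (cmod (f x))))"

definition wiener_amalgam :: "(real \<Rightarrow> complex) set" where
  "wiener_amalgam = {f. f \<in> borel_measurable lebesgue \<and> amalgam_norm f < \<infinity>}"

text \<open>Extended real valued, so that the infimum is \<open>\<infinity>\<close> for sets with at most one point.\<close>

definition separation :: "real set \<Rightarrow> ereal" where
  "separation \<Gamma> = (INF (\<gamma>, \<gamma>') \<in> {(\<gamma>, \<gamma>'). \<gamma> \<in> \<Gamma> \<and> \<gamma>' \<in> \<Gamma> \<and> \<gamma> \<noteq> \<gamma>'}. ereal \<bar>\<gamma> - \<gamma>'\<bar>)"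

definition separated :: "real set \<Rightarrow> bool" where
  "separated \<Gamma> \<longleftrightarrow> separation \<Gamma> > 0"

text \<open>The values of \<open>c\<close> outside \<open>\<Gamma>\<close> are irrelevant.\<close>

definition l2_on :: "real set \<Rightarrow> (real \<Rightarrow> complex) set" where
  "l2_on \<Gamma> = {c. (\<lambda>\<gamma>. (cmod (c \<gamma>))\<^sup>2) summable_on \<Gamma>}"

definition l2_norm_on :: "real set \<Rightarrow> (real \<Rightarrow> complex) \<Rightarrow> real" where
  "l2_norm_on \<Gamma> c = sqrt (\<Sum>\<^sub>\<infinity>\<gamma>\<in>\<Gamma>. (cmod (c \<gamma>))\<^sup>2)"

text \<open>\<open>s\<close> is the sum of the series of the \<open>c \<gamma> * G (\<cdot> - \<gamma>)\<close>, the finite partial sums converging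
  in the norm of \<^const>\<open>L2\<close>.\<close>

definition shifts_has_sum ::
  "real set \<Rightarrow> (real \<Rightarrow> complex) \<Rightarrow> (real \<Rightarrow> complex) \<Rightarrow> (real \<Rightarrow> complex) \<Rightarrow> bool" where
  "shifts_has_sum \<Gamma> G c s \<longleftrightarrow>
     L2_tendsto (\<lambda>A x. \<Sum>\<gamma>\<in>A. c \<gamma> * G (x - \<gamma>)) s (finite_subsets_at_top \<Gamma>)"

definition l2_stable_shifts :: "real set \<Rightarrow> (real \<Rightarrow> complex) \<Rightarrow> bool" where
  "l2_stable_shifts \<Gamma> G \<longleftrightarrow>
     (\<exists>C1>0. \<exists>C2>0. \<forall>c\<in>l2_on \<Gamma>. \<exists>s. shifts_has_sum \<Gamma> G c s \<and>
        C1 * l2_norm_on \<Gamma> c \<le> L2_norm s \<and> L2_norm s \<le> C2 * l2_norm_on \<Gamma> c)"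

text \<open>For \<open>S\<close> of finite measure every element of the Paley-Wiener space has a unique continuous
  representative; the space is taken to consist of these representatives, so that point values
  are meaningful.\<close>

definition paley_wiener :: "real set \<Rightarrow> (real \<Rightarrow> complex) set" where
  "paley_wiener S = {f. continuous_on UNIV f \<and> f \<in> L2 \<and>
     (\<exists>g. has_inverse_fourier_L2 f g \<and> (AE t in lebesgue. t \<notin> S \<longrightarrow> g t = 0))}"

definition interpolation_set :: "real set \<Rightarrow> real set \<Rightarrow> bool" where
  "interpolation_set \<Gamma> S \<longleftrightarrow> separated \<Gamma> \<and>
     (\<forall>c\<in>l2_on \<Gamma>. \<exists>f\<in>paley_wiener S. \<forall>\<gamma>\<in>\<Gamma>. f \<gamma> = c \<gamma>)"

end

theory Submission
  imports Defs "HOL-Probability.Probability" "HOL-Library.Nat_Bijection"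
begin

text \<open>For coefficients \<open>c\<close> supported on a finite part of \<open>\<Gamma>\<close> put
  \<open>E\<^sub>c(t) = \<Sum>\<gamma>. c\<^sub>\<gamma> e\<^sup>-\<^sup>2\<^sup>\<pi>\<^sup>i\<^sup>\<gamma>\<^sup>t\<close>. A translation by \<open>\<gamma>\<close> multiplies the Fourier transform by
  \<open>e\<^sup>-\<^sup>2\<^sup>\<pi>\<^sup>i\<^sup>\<gamma>\<^sup>t\<close>, so Plancherel's identity turns the norm of \<open>\<Sum>\<gamma>. c\<^sub>\<gamma> G(\<cdot> - \<gamma>)\<close> into that of
  \<open>E\<^sub>c Ghat\<close> (lemma \<open>L2_norm_shifts\<close>). Stability of the shifts therefore compares the weighted
  integrals \<open>\<integral>|E\<^sub>c|\<^sup>2 |Ghat|\<^sup>2\<close> with \<open>\<parallel>c\<parallel>\<^sup>2\<close>. For \<open>S\<close> of finite measure, interpolation is a condition of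
  the same kind: \<open>g \<mapsto> (\<integral>\<^sub>S g(t) e\<^sup>-\<^sup>2\<^sup>\<pi>\<^sup>i\<^sup>\<gamma>\<^sup>t dt)\<^sub>\<gamma>\<close> is the transpose of the map \<open>c \<mapsto> E\<^sub>c\<close> into \<open>L\<^sup>2(S)\<close>,
  and the transpose is onto \<open>l\<^sup>2(\<Gamma>)\<close> exactly when \<open>\<integral>\<^sub>S |E\<^sub>c|\<^sup>2 \<ge> K\<^sup>2 \<parallel>c\<parallel>\<^sup>2\<close> for some \<open>K > 0\<close>
  (lemma \<open>interpolation_set_iff_lower_bound\<close>). So two lower bounds have to be compared, one with the
  weight \<open>|Ghat|\<^sup>2\<close> and one with the indicator of \<open>S = {|Ghat| > r}\<close>.

  Since \<open>r\<^sup>2 1\<^sub>S \<le> |Ghat|\<^sup>2\<close>, the bound on \<open>S\<close> implies the weighted one. For the converse, the part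
  of the weighted integral outside \<open>S\<close> must be small. As \<open>\<Gamma>\<close> is separated, the integral of
  \<open>|E\<^sub>c|\<^sup>2\<close> over any unit interval is at most \<open>B \<parallel>c\<parallel>\<^sup>2\<close>, with \<open>B\<close> the same for all intervals, and hence
  \<open>\<integral>|E\<^sub>c|\<^sup>2 v \<le> B \<parallel>c\<parallel>\<^sup>2 (\<Sum>k. ess sup v on (k, k+1))\<close> for every weight \<open>v\<close>
  (lemma \<open>Bessel_weighted\<close>). This is where the amalgam condition enters. For \<open>v = |Ghat|\<^sup>2\<close> it
  gives the upper stability bound. For the part of \<open>|Ghat|\<^sup>2\<close> where
  \<open>|Ghat| \<le> r\<close>, the suprema are at most \<open>min a\<^sub>k r\<^sup>2\<close> with a summable sequence \<open>a\<close>, so their sum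
  tends to \<open>0\<close> with \<open>r\<close>: for small \<open>r\<close> at least half of the lower
  stability bound comes from \<open>S\<close>, where \<open>|Ghat|\<^sup>2\<close> is bounded.

  The analytic tools are built along the way. Plancherel's identity comes from Gaussian summation: the
  function \<open>|h^|\<^sup>2\<close> is the Fourier transform of the autocorrelation of \<open>h\<close>, and its Gaussian
  means are averages of the autocorrelation near \<open>0\<close>. The Bessel inequality is Plancherel's
  identity for step functions with disjoint steps. Both halves of the duality argument rest on explicit
  constructions in \<open>L\<^sup>2\<close> and \<open>l\<^sup>2\<close>: a minimising sequence, and a series of almost
  annihilated unit vectors whose signs are chosen one after the other.\<close>

section \<open>The space of square integrable functions\<close>

lemma L2_measurable [measurable_dest]: "f \<in> L2 \<Longrightarrow> f \<in> borel_measurable lebesgue"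
  by (simp add: L2_def)

lemma L2_norm_nonneg [simp]: "L2_norm f \<ge> 0"
  by (simp add: L2_norm_def)

lemma L2_norm_sq: "(L2_norm f)\<^sup>2 = (LINT x|lebesgue. (cmod (f x))\<^sup>2)"
  by (simp add: L2_norm_def)

lemma L2_norm_cong_AE:
  assumes "f \<in> borel_measurable lebesgue" "g \<in> borel_measurable lebesgue"
    and "AE x in lebesgue. f x = g x"
  shows "L2_norm f = L2_norm g"
proof -
  have "(LINT x|lebesgue. (cmod (f x))\<^sup>2) = (LINT x|lebesgue. (cmod (g x))\<^sup>2)"
    using assms by (intro integral_cong_AE) auto
  then show ?thesis by (simp add: L2_norm_def)
qed

lemma L2_cong_AE:
  assumes "f \<in> L2" "g \<in> borel_measurable lebesgue"
    and "AE x in lebesgue. f x = g x"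
  shows "g \<in> L2"
proof -
  have "integrable lebesgue (\<lambda>x. (cmod (f x))\<^sup>2) \<longleftrightarrow> integrable lebesgue (\<lambda>x. (cmod (g x))\<^sup>2)"
    using assms by (intro integrable_cong_AE) (auto simp: L2_def)
  then show ?thesis using assms by (simp add: L2_def)
qed

lemma L2_mono:
  assumes "f \<in> L2" "g \<in> borel_measurable lebesgue" "AE x in lebesgue. cmod (g x) \<le> C * cmod (f x)"
    "C \<ge> 0"
  shows "g \<in> L2" "L2_norm g \<le> C * L2_norm f"
proof -
  have i: "integrable lebesgue (\<lambda>x. C\<^sup>2 * (cmod (f x))\<^sup>2)"
    using assms(1) by (simp add: L2_def)
  have le: "AE x in lebesgue. (cmod (g x))\<^sup>2 \<le> C\<^sup>2 * (cmod (f x))\<^sup>2"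
    using assms(3) by eventually_elim (metis norm_ge_zero power_mono power_mult_distrib)
  have "integrable lebesgue (\<lambda>x. (cmod (g x))\<^sup>2)"
    by (rule Bochner_Integration.integrable_bound[OF i]) (use assms le in auto)
  then show "g \<in> L2" using assms by (simp add: L2_def)
  have "(LINT x|lebesgue. (cmod (g x))\<^sup>2) \<le> (LINT x|lebesgue. C\<^sup>2 * (cmod (f x))\<^sup>2)"
    by (rule integral_mono_AE) (use i le \<open>g \<in> L2\<close> in \<open>auto simp: L2_def\<close>)
  then have "(L2_norm g)\<^sup>2 \<le> (C * L2_norm f)\<^sup>2"
    by (simp add: L2_norm_sq power_mult_distrib)
  then show "L2_norm g \<le> C * L2_norm f"
    by (rule power2_le_imp_le) (simp add: assms(4))
qed

lemma L2_cmult: "f \<in> L2 \<Longrightarrow> (\<lambda>x. c * f x) \<in> L2"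
  by (rule L2_mono(1)[where C = "cmod c" and f = f]) (auto simp: norm_mult L2_def)

lemma L2_norm_cmult: "L2_norm (\<lambda>x. c * f x) = cmod c * L2_norm f"
  by (simp add: L2_norm_def norm_mult power_mult_distrib real_sqrt_mult)

lemma L2_zero [simp]: "(\<lambda>x. 0) \<in> L2" "L2_norm (\<lambda>x. 0) = 0"
  by (auto simp: L2_def L2_norm_def)

lemma L2_norm_minus_commute: "L2_norm (\<lambda>x. f x - g x) = L2_norm (\<lambda>x. g x - f x)"
  by (simp add: L2_norm_def norm_minus_commute)

lemma L2_mult_integrable:
  assumes "f \<in> L2" "g \<in> L2" shows "integrable lebesgue (\<lambda>x. f x * g x)"
proof (rule Bochner_Integration.integrable_bound)
  show "integrable lebesgue (\<lambda>x. (cmod (f x))\<^sup>2 + (cmod (g x))\<^sup>2)"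
    using assms by (simp add: L2_def)
  have "cmod (f x) * cmod (g x) \<le> (cmod (f x))\<^sup>2 + (cmod (g x))\<^sup>2" for x
    using sum_squares_bound[of "cmod (f x)" "cmod (g x)"]
      mult_nonneg_nonneg[OF norm_ge_zero[of "f x"] norm_ge_zero[of "g x"]] by linarith
  then show "AE x in lebesgue. norm (f x * g x) \<le> norm ((cmod (f x))\<^sup>2 + (cmod (g x))\<^sup>2)"
    by (simp add: norm_mult)
qed (use assms in \<open>auto simp: L2_def\<close>)

lemma L2_add:
  assumes "f \<in> L2" "g \<in> L2" shows "(\<lambda>x. f x + g x) \<in> L2"
proof -
  have "integrable lebesgue (\<lambda>x. (cmod (f x + g x))\<^sup>2)"
  proof (rule Bochner_Integration.integrable_bound)
    show "integrable lebesgue (\<lambda>x. 2 * (cmod (f x))\<^sup>2 + 2 * (cmod (g x))\<^sup>2)"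
      using assms by (simp add: L2_def)
    have "(cmod (f x + g x))\<^sup>2 \<le> 2 * (cmod (f x))\<^sup>2 + 2 * (cmod (g x))\<^sup>2" for x
    proof -
      have "(cmod (f x + g x))\<^sup>2 \<le> (cmod (f x) + cmod (g x))\<^sup>2"
        by (intro power_mono norm_triangle_ineq) auto
      also have "\<dots> \<le> 2 * (cmod (f x))\<^sup>2 + 2 * (cmod (g x))\<^sup>2"
        using sum_squares_bound[of "cmod (f x)" "cmod (g x)"] by (simp add: power2_sum)
      finally show ?thesis .
    qed
    then show "AE x in lebesgue. norm ((cmod (f x + g x))\<^sup>2) \<le> norm (2 * (cmod (f x))\<^sup>2 + 2 * (cmod (g x))\<^sup>2)"
      by simp
  qed (use assms in \<open>auto simp: L2_def\<close>)
  then show ?thesis using assms by (auto simp: L2_def intro: borel_measurable_add)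
qed

lemma L2_diff:
  assumes "f \<in> L2" "g \<in> L2" shows "(\<lambda>x. f x - g x) \<in> L2"
  using L2_add[OF assms(1) L2_cmult[OF assms(2), of "-1"]] by simp

lemma L2_sum: "(\<And>i. i \<in> A \<Longrightarrow> f i \<in> L2) \<Longrightarrow> (\<lambda>x. \<Sum>i\<in>A. f i x) \<in> L2"
  by (induction A rule: infinite_finite_induct) (auto intro: L2_add)

lemma L2_Cauchy_Schwarz_norm:
  assumes f: "f \<in> L2" and g: "g \<in> L2"
  shows "(LINT x|lebesgue. cmod (f x) * cmod (g x)) \<le> L2_norm f * L2_norm g"
proof -
  have [measurable]: "f \<in> borel_measurable lebesgue" "g \<in> borel_measurable lebesgue"
    using f g by (auto simp: L2_def)
  define P where "P = (LINT x|lebesgue. cmod (f x) * cmod (g x))"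
  have "integrable lebesgue (\<lambda>x. norm (f x * g x))"
    using L2_mult_integrable[OF f g] by (rule integrable_norm)
  then have i: "integrable lebesgue (\<lambda>x. cmod (f x) * cmod (g x))"
    by (simp add: norm_mult)
  have "P \<ge> 0" unfolding P_def by (rule integral_nonneg_AE) auto
  have nn: "(\<integral>\<^sup>+x. ennreal ((cmod (h x))\<^sup>2) \<partial>lebesgue) = ennreal ((L2_norm h)\<^sup>2)"
    if "h \<in> L2" for h
    unfolding L2_norm_sq by (rule nn_integral_eq_integral) (use that in \<open>auto simp: L2_def\<close>)
  have "ennreal (P\<^sup>2) = (\<integral>\<^sup>+x. ennreal (cmod (f x)) * ennreal (cmod (g x)) \<partial>lebesgue)\<^sup>2"
    using nn_integral_eq_integral[OF i] \<open>P \<ge> 0\<close>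
    by (simp add: P_def ennreal_mult'' ennreal_power)
  also have "\<dots> \<le> (\<integral>\<^sup>+x. (ennreal (cmod (f x)))\<^sup>2 \<partial>lebesgue) * (\<integral>\<^sup>+x. (ennreal (cmod (g x)))\<^sup>2 \<partial>lebesgue)"
    by (rule Cauchy_Schwarz_nn_integral) auto
  also have "\<dots> = ennreal ((L2_norm f)\<^sup>2 * (L2_norm g)\<^sup>2)"
    using nn[OF f] nn[OF g] by (simp add: ennreal_power ennreal_mult)
  finally have "P\<^sup>2 \<le> (L2_norm f * L2_norm g)\<^sup>2"
    by (simp add: power_mult_distrib)
  then show ?thesis unfolding P_def[symmetric]
    by (rule power2_le_imp_le) auto
qed

lemma L2_Cauchy_Schwarz:
  assumes "f \<in> L2" "g \<in> L2"
  shows "cmod (LINT x|lebesgue. f x * g x) \<le> L2_norm f * L2_norm g"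
proof -
  have "cmod (LINT x|lebesgue. f x * g x) \<le> (LINT x|lebesgue. cmod (f x * g x))"
    by (rule integral_norm_bound)
  also have "\<dots> \<le> L2_norm f * L2_norm g"
    using L2_Cauchy_Schwarz_norm[OF assms] by (simp add: norm_mult)
  finally show ?thesis .
qed

lemma L2_norm_triangle:
  assumes f: "f \<in> L2" and g: "g \<in> L2"
  shows "L2_norm (\<lambda>x. f x + g x) \<le> L2_norm f + L2_norm g"
proof -
  have i: "integrable lebesgue (\<lambda>x. (cmod (f x))\<^sup>2)" "integrable lebesgue (\<lambda>x. (cmod (g x))\<^sup>2)"
    "integrable lebesgue (\<lambda>x. cmod (f x) * cmod (g x))"
    using f g integrable_norm[OF L2_mult_integrable[OF f g]] by (auto simp: L2_def norm_mult)
  have "(L2_norm (\<lambda>x. f x + g x))\<^sup>2 \<le> (LINT x|lebesgue. (cmod (f x))\<^sup>2 + 2 * (cmod (f x) * cmod (g x)) + (cmod (g x))\<^sup>2)"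
    unfolding L2_norm_sq
  proof (rule integral_mono)
    show "(cmod (f x + g x))\<^sup>2 \<le> (cmod (f x))\<^sup>2 + 2 * (cmod (f x) * cmod (g x)) + (cmod (g x))\<^sup>2" for x
      using power_mono[OF norm_triangle_ineq[of "f x" "g x"], of 2] by (simp add: power2_sum)
  qed (use i L2_add[OF f g] in \<open>auto simp: L2_def\<close>)
  also have "\<dots> = (L2_norm f)\<^sup>2 + 2 * (LINT x|lebesgue. cmod (f x) * cmod (g x)) + (L2_norm g)\<^sup>2"
    using i by (simp add: L2_norm_sq)
  also have "\<dots> \<le> (L2_norm f + L2_norm g)\<^sup>2"
    using L2_Cauchy_Schwarz_norm[OF f g] by (simp add: power2_sum)
  finally show ?thesis by (rule power2_le_imp_le) auto
qed

lemma L2_norm_triangle_diff: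
  assumes "f \<in> L2" "g \<in> L2" "h \<in> L2"
  shows "L2_norm (\<lambda>x. f x - h x) \<le> L2_norm (\<lambda>x. f x - g x) + L2_norm (\<lambda>x. g x - h x)"
  using L2_norm_triangle[OF L2_diff[OF assms(1,2)] L2_diff[OF assms(2,3)]] by simp

lemma L2_norm_diff_abs:
  assumes "f \<in> L2" "g \<in> L2"
  shows "\<bar>L2_norm f - L2_norm g\<bar> \<le> L2_norm (\<lambda>x. f x - g x)"
  using L2_norm_triangle[OF L2_diff[OF assms] assms(2)] L2_norm_triangle[OF L2_diff[OF assms(2,1)] assms(1)]
    L2_norm_minus_commute[of f g] by (simp add: abs_le_iff)

lemma L2_norm_eq_0_imp_AE:
  assumes "f \<in> L2" "L2_norm f = 0" shows "AE x in lebesgue. f x = 0"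
proof -
  have "(LINT x|lebesgue. (cmod (f x))\<^sup>2) = 0" using assms(2) L2_norm_sq[of f] by simp
  then show ?thesis using assms(1)
    by (subst (asm) integral_nonneg_eq_0_iff_AE) (auto simp: L2_def)
qed

lemma L2_tendsto_norm:
  assumes "L2_tendsto h f F"
  shows "((\<lambda>i. L2_norm (h i)) \<longlongrightarrow> L2_norm f) F"
proof -
  have "((\<lambda>i. L2_norm (h i) - L2_norm f) \<longlongrightarrow> 0) F"
  proof (rule tendsto_rabs_zero_cancel, rule tendsto_sandwich[OF _ _ tendsto_const])
    show "\<forall>\<^sub>F i in F. \<bar>L2_norm (h i) - L2_norm f\<bar> \<le> L2_norm (\<lambda>x. h i x - f x)"
      using assms unfolding L2_tendsto_def by (auto elim!: eventually_mono intro: L2_norm_diff_abs)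
  qed (use assms in \<open>auto simp: L2_tendsto_def\<close>)
  then show ?thesis by (simp add: LIM_zero_iff)
qed

lemma L2_tendsto_add:
  assumes "L2_tendsto h f F" "L2_tendsto k g F"
  shows "L2_tendsto (\<lambda>i x. h i x + k i x) (\<lambda>x. f x + g x) F"
  unfolding L2_tendsto_def
proof (intro conjI)
  have e: "\<forall>\<^sub>F i in F. h i \<in> L2 \<and> k i \<in> L2"
    using assms by (auto simp: L2_tendsto_def eventually_conj_iff)
  have fg: "f \<in> L2" "g \<in> L2" using assms by (auto simp: L2_tendsto_def)
  then show "(\<lambda>x. f x + g x) \<in> L2" by (rule L2_add)
  show "\<forall>\<^sub>F i in F. (\<lambda>x. h i x + k i x) \<in> L2" using e by (auto elim!: eventually_mono intro: L2_add)
  have lim: "((\<lambda>i. L2_norm (\<lambda>x. h i x - f x) + L2_norm (\<lambda>x. k i x - g x)) \<longlongrightarrow> 0) F"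
    using tendsto_add[of "\<lambda>i. L2_norm (\<lambda>x. h i x - f x)" 0 F "\<lambda>i. L2_norm (\<lambda>x. k i x - g x)" 0] assms
    by (simp add: L2_tendsto_def)
  have "\<forall>\<^sub>F i in F. L2_norm (\<lambda>x. h i x + k i x - (f x + g x))
      \<le> L2_norm (\<lambda>x. h i x - f x) + L2_norm (\<lambda>x. k i x - g x)"
    using e
  proof eventually_elim
    case (elim i)
    then show ?case
      using L2_norm_triangle[OF L2_diff[of "h i" f] L2_diff[of "k i" g]] fg by (simp add: algebra_simps)
  qed
  then show "((\<lambda>i. L2_norm (\<lambda>x. h i x + k i x - (f x + g x))) \<longlongrightarrow> 0) F"
    by (rule tendsto_sandwich[OF _ _ tendsto_const lim, rotated]) auto
qed

lemma L2_mult_bounded: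
  assumes g: "g \<in> L2" and u: "u \<in> borel_measurable lebesgue" "\<And>x. cmod (u x) \<le> C"
  shows "(\<lambda>x. u x * g x) \<in> L2" "L2_norm (\<lambda>x. u x * g x) \<le> C * L2_norm g"
proof -
  have C: "C \<ge> 0" using u(2)[of 0] norm_ge_zero order_trans by blast
  have m: "(\<lambda>x. u x * g x) \<in> borel_measurable lebesgue"
    using g u by (auto simp: L2_def intro: borel_measurable_times)
  have le: "AE x in lebesgue. cmod (u x * g x) \<le> C * cmod (g x)"
    by (intro AE_I2) (simp add: norm_mult u mult_right_mono)
  show "(\<lambda>x. u x * g x) \<in> L2" "L2_norm (\<lambda>x. u x * g x) \<le> C * L2_norm g"
    using L2_mono[OF g m le C] by auto
qed

lemma L2_tendsto_mult_bounded:
  assumes "L2_tendsto h f F" and [measurable]: "u \<in> borel_measurable lebesgue"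
    and u: "\<And>x. cmod (u x) \<le> C"
  shows "L2_tendsto (\<lambda>i x. u x * h i x) (\<lambda>x. u x * f x) F"
  unfolding L2_tendsto_def
proof (intro conjI)
  have C: "C \<ge> 0" using u[of 0] norm_ge_zero order_trans by blast
  have m: "(\<lambda>x. u x * g x) \<in> L2" "L2_norm (\<lambda>x. u x * g x) \<le> C * L2_norm g" if "g \<in> L2" for g
    using L2_mult_bounded[OF that assms(2) u] by auto
  have e: "\<forall>\<^sub>F i in F. h i \<in> L2" and f: "f \<in> L2"
    using assms by (auto simp: L2_tendsto_def)
  show "(\<lambda>x. u x * f x) \<in> L2" using f m by blast
  show "\<forall>\<^sub>F i in F. (\<lambda>x. u x * h i x) \<in> L2" using e by (auto elim!: eventually_mono intro: m)
  have lim: "((\<lambda>i. C * L2_norm (\<lambda>x. h i x - f x)) \<longlongrightarrow> 0) F"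
    using tendsto_mult_left[of "\<lambda>i. L2_norm (\<lambda>x. h i x - f x)" 0 F C] assms
    by (simp add: L2_tendsto_def)
  have "\<forall>\<^sub>F i in F. L2_norm (\<lambda>x. u x * h i x - u x * f x) \<le> C * L2_norm (\<lambda>x. h i x - f x)"
    using e
  proof eventually_elim
    case (elim i)
    then show ?case
      using m(2)[OF L2_diff[of "h i" f]] f by (simp add: algebra_simps)
  qed
  then show "((\<lambda>i. L2_norm (\<lambda>x. u x * h i x - u x * f x)) \<longlongrightarrow> 0) F"
    by (rule tendsto_sandwich[OF _ _ tendsto_const lim, rotated]) auto
qed

lemma L2_tendsto_integral:
  assumes h: "L2_tendsto h f F" and g: "g \<in> L2"
  shows "((\<lambda>i. LINT x|lebesgue. h i x * g x) \<longlongrightarrow> (LINT x|lebesgue. f x * g x)) F"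
proof -
  have e: "\<forall>\<^sub>F i in F. h i \<in> L2" and f: "f \<in> L2"
    using h by (auto simp: L2_tendsto_def)
  have lim: "((\<lambda>i. L2_norm (\<lambda>x. h i x - f x) * L2_norm g) \<longlongrightarrow> 0) F"
    using tendsto_mult_right[of "\<lambda>i. L2_norm (\<lambda>x. h i x - f x)" 0 F "L2_norm g"] h
    by (simp add: L2_tendsto_def)
  have "\<forall>\<^sub>F i in F. cmod ((LINT x|lebesgue. h i x * g x) - (LINT x|lebesgue. f x * g x))
      \<le> L2_norm (\<lambda>x. h i x - f x) * L2_norm g"
    using e
  proof eventually_elim
    case (elim i)
    have "(LINT x|lebesgue. h i x * g x) - (LINT x|lebesgue. f x * g x)
      = (LINT x|lebesgue. (h i x - f x) * g x)"
      using L2_mult_integrable[OF elim g] L2_mult_integrable[OF f g] by (simp add: algebra_simps)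
    then show ?case using L2_Cauchy_Schwarz[OF L2_diff[OF elim f] g] by simp
  qed
  then have "((\<lambda>i. cmod ((LINT x|lebesgue. h i x * g x) - (LINT x|lebesgue. f x * g x))) \<longlongrightarrow> 0) F"
    by (rule tendsto_sandwich[OF _ _ tendsto_const lim, rotated]) auto
  then show ?thesis by (rule LIM_zero_cancel[OF tendsto_norm_zero_cancel])
qed

section \<open>Completeness\<close>

text \<open>Along a rapidly converging sequence the increments \<open>d\<^sub>n\<close> are so small that
  \<open>W = \<Sum>n. 2\<^sup>n |d\<^sub>n|\<^sup>2\<close> is integrable. Where \<open>W\<close> is finite the sequence converges, and by the
  Cauchy-Schwarz inequality its squared distance to the limit is at most \<open>2 (1/2)\<^sup>n W\<close>.\<close>

lemma L2_fast_Cauchy_converges: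
  fixes f :: "nat \<Rightarrow> real \<Rightarrow> complex"
  assumes f: "\<And>n. f n \<in> L2" and fast: "\<And>n. L2_norm (\<lambda>x. f (Suc n) x - f n x) \<le> (1/2) ^ n"
  shows "\<exists>g. L2_tendsto f g sequentially"
proof -
  define d where "d n x = f (Suc n) x - f n x" for n x
  define W where "W x = (\<Sum>n. ennreal (2 ^ n * (cmod (d n x))\<^sup>2))" for x
  have fm [measurable]: "f n \<in> borel_measurable lebesgue" for n
    using f by (auto simp: L2_def)
  have d: "d n \<in> L2" for n unfolding d_def by (intro L2_diff f)
  then have dm [measurable]: "d n \<in> borel_measurable lebesgue" for n by (auto simp: L2_def)
  have Wm [measurable]: "W \<in> borel_measurable lebesgue" unfolding W_def by measurable
  have term_le: "(\<integral>\<^sup>+x. ennreal (2 ^ n * (cmod (d n x))\<^sup>2) \<partial>lebesgue) \<le> ennreal ((1/2) ^ n)" for n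
  proof -
    have "(\<integral>\<^sup>+x. ennreal (2 ^ n * (cmod (d n x))\<^sup>2) \<partial>lebesgue)
        = ennreal (LINT x|lebesgue. 2 ^ n * (cmod (d n x))\<^sup>2)"
      by (rule nn_integral_eq_integral) (use d in \<open>auto simp: L2_def\<close>)
    also have "(LINT x|lebesgue. 2 ^ n * (cmod (d n x))\<^sup>2) = 2 ^ n * (L2_norm (d n))\<^sup>2"
      by (simp add: L2_norm_sq)
    also have "\<dots> \<le> 2 ^ n * ((1/2) ^ n)\<^sup>2"
      using fast[of n] by (intro mult_left_mono power_mono) (auto simp: d_def[abs_def])
    also have "\<dots> = (1/2) ^ n" by (simp add: power2_eq_square power_one_over)
    finally show ?thesis by (simp add: ennreal_leI)
  qed
  have W2: "(\<integral>\<^sup>+x. W x \<partial>lebesgue) \<le> 2"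
  proof -
    have "(\<integral>\<^sup>+x. W x \<partial>lebesgue) = (\<Sum>n. \<integral>\<^sup>+x. ennreal (2 ^ n * (cmod (d n x))\<^sup>2) \<partial>lebesgue)"
      unfolding W_def by (rule nn_integral_suminf) measurable
    also have "\<dots> \<le> (\<Sum>n. ennreal ((1/2) ^ n))"
      by (intro suminf_le summableI term_le)
    also have "\<dots> = ennreal (\<Sum>n. (1/2) ^ n)"
      by (intro suminf_ennreal2) auto
    also have "\<dots> = 2" by (subst suminf_geometric) auto
    finally show ?thesis .
  qed
  then have "(\<integral>\<^sup>+x. W x \<partial>lebesgue) \<noteq> \<infinity>" by (auto simp: top_unique)
  then have fin: "AE x in lebesgue. W x \<noteq> \<infinity>" by (intro nn_integral_PInf_AE) auto
  have tele: "f m x - f n x = (\<Sum>i\<in>{n..<m}. d i x)" if "n \<le> m" for n m x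
    unfolding d_def using that by (subst sum_Suc_diff') auto
  have conv: "convergent (\<lambda>n. f n x)" if "W x \<noteq> \<infinity>" for x
  proof -
    have s: "summable (\<lambda>n. 2 ^ n * (cmod (d n x))\<^sup>2)"
      using that unfolding W_def by (intro summable_suminf_not_top) auto
    have "summable (\<lambda>n. (1/2) ^ n + 2 ^ n * (cmod (d n x))\<^sup>2)"
      by (intro summable_add s) auto
    then have "summable (\<lambda>n. d n x)"
    proof (rule summable_comparison_test'[where N = 0])
      fix n
      have "2 * (sqrt ((1/2) ^ n)) * (sqrt (2 ^ n) * cmod (d n x)) \<le> (1/2) ^ n + 2 ^ n * (cmod (d n x))\<^sup>2"
        using sum_squares_bound[of "sqrt ((1/2) ^ n)" "sqrt (2 ^ n) * cmod (d n x)"]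
        by (simp add: power_mult_distrib)
      moreover have "sqrt ((1/2) ^ n) * sqrt (2 ^ n) = 1"
        by (simp add: real_sqrt_mult[symmetric] power_mult_distrib[symmetric])
      ultimately have "2 * cmod (d n x) \<le> (1/2) ^ n + 2 ^ n * (cmod (d n x))\<^sup>2"
        by (metis mult.assoc mult.left_neutral)
      then show "norm (d n x) \<le> (1/2) ^ n + 2 ^ n * (cmod (d n x))\<^sup>2"
        using norm_ge_zero[of "d n x"] by linarith
    qed
    then have "(\<lambda>n. f 0 x + (\<Sum>i<n. d i x)) \<longlonglongrightarrow> f 0 x + (\<Sum>i. d i x)"
      by (intro tendsto_intros summable_LIMSEQ)
    moreover have "f 0 x + (\<Sum>i<n. d i x) = f n x" for n
      using tele[of 0 n x] by (simp add: atLeast0LessThan algebra_simps)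
    ultimately show ?thesis by (auto simp: convergent_def)
  qed
  define g where "g x = lim (\<lambda>n. f n x)" for x
  have gm [measurable]: "g \<in> borel_measurable lebesgue"
    unfolding g_def by (rule borel_measurable_lim_metric) measurable
  have ptw: "ennreal ((cmod (f n x - g x))\<^sup>2) \<le> ennreal (2 * (1/2) ^ n) * W x" if "W x \<noteq> \<infinity>" for n x
  proof -
    have s: "summable (\<lambda>n. 2 ^ n * (cmod (d n x))\<^sup>2)"
      using that unfolding W_def by (intro summable_suminf_not_top) auto
    define w where "w = (\<Sum>n. 2 ^ n * (cmod (d n x))\<^sup>2)"
    have Ww: "W x = ennreal w" unfolding W_def w_def using s by (intro suminf_ennreal2) auto
    have "w \<ge> 0" unfolding w_def by (rule suminf_nonneg[OF s]) auto
    have lim: "(\<lambda>n. f n x) \<longlonglongrightarrow> g x"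
      unfolding g_def using conv[OF that] by (simp add: convergent_LIMSEQ_iff)
    have "(cmod (f n x - f m x))\<^sup>2 \<le> 2 * (1/2) ^ n * w" if "m \<ge> n" for m
    proof -
      have "cmod (f n x - f m x) \<le> (\<Sum>i\<in>{n..<m}. cmod (d i x))"
        using tele[OF that, of x] norm_sum[of "\<lambda>i. d i x" "{n..<m}"] by (simp add: norm_minus_commute)
      also have "\<dots> = (\<Sum>i\<in>{n..<m}. sqrt ((1/2) ^ i) * (sqrt (2 ^ i) * cmod (d i x)))"
      proof (rule sum.cong)
        fix i have "sqrt ((1/2) ^ i) * sqrt (2 ^ i) = 1"
          by (simp add: real_sqrt_mult[symmetric] power_mult_distrib[symmetric])
        then show "cmod (d i x) = sqrt ((1/2) ^ i) * (sqrt (2 ^ i) * cmod (d i x))"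
          by (metis mult.assoc mult.left_neutral)
      qed auto
      finally have "(cmod (f n x - f m x))\<^sup>2 \<le> (\<Sum>i\<in>{n..<m}. sqrt ((1/2) ^ i) * (sqrt (2 ^ i) * cmod (d i x)))\<^sup>2"
        by (intro power_mono) auto
      also have "\<dots> \<le> (\<Sum>i\<in>{n..<m}. (sqrt ((1/2) ^ i))\<^sup>2) * (\<Sum>i\<in>{n..<m}. (sqrt (2 ^ i) * cmod (d i x))\<^sup>2)"
        by (rule Cauchy_Schwarz_ineq_sum)
      also have "\<dots> = (\<Sum>i\<in>{n..<m}. (1/2) ^ i) * (\<Sum>i\<in>{n..<m}. 2 ^ i * (cmod (d i x))\<^sup>2)"
        by (simp add: power_mult_distrib)
      also have "\<dots> \<le> (2 * (1/2) ^ n) * w"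
      proof (intro mult_mono)
        have "(\<Sum>i\<in>{n..<m}. (1/2) ^ i) = (2 * (1/2) ^ n - 2 * (1/2 :: real) ^ m)"
          using that by (induction m rule: dec_induct) auto
        then show "(\<Sum>i\<in>{n..<m}. (1/2) ^ i) \<le> 2 * (1/2 :: real) ^ n" by simp
        show "(\<Sum>i\<in>{n..<m}. 2 ^ i * (cmod (d i x))\<^sup>2) \<le> w"
          unfolding w_def by (intro sum_le_suminf s) auto
      qed (auto intro: sum_nonneg)
      finally show ?thesis .
    qed
    then have "(cmod (f n x - g x))\<^sup>2 \<le> 2 * (1/2) ^ n * w"
      by (intro LIMSEQ_le_const2[where X = "\<lambda>m. (cmod (f n x - f m x))\<^sup>2"] tendsto_intros lim) auto
    then show ?thesis using \<open>w \<ge> 0\<close> by (simp add: Ww ennreal_mult[symmetric] ennreal_leI)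
  qed
  have nn: "(\<integral>\<^sup>+x. ennreal ((cmod (f n x - g x))\<^sup>2) \<partial>lebesgue) \<le> ennreal (4 * (1/2) ^ n)" for n
  proof -
    have "(\<integral>\<^sup>+x. ennreal ((cmod (f n x - g x))\<^sup>2) \<partial>lebesgue) \<le> (\<integral>\<^sup>+x. ennreal (2 * (1/2) ^ n) * W x \<partial>lebesgue)"
      by (rule nn_integral_mono_AE) (use fin ptw in \<open>auto elim!: eventually_mono\<close>)
    also have "\<dots> = ennreal (2 * (1/2) ^ n) * (\<integral>\<^sup>+x. W x \<partial>lebesgue)"
      by (rule nn_integral_cmult) measurable
    also have "\<dots> \<le> ennreal (2 * (1/2) ^ n) * ennreal 2"
      using W2 by (intro mult_left_mono) auto
    also have "\<dots> = ennreal (4 * (1/2) ^ n)" by (subst ennreal_mult[symmetric]) auto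
    finally show ?thesis .
  qed
  have diff: "(\<lambda>x. f n x - g x) \<in> L2" for n
    using nn[of n] order_le_less_trans[OF nn[of n] ennreal_less_top]
    by (auto simp: L2_def integrable_iff_bounded)
  have gL2: "g \<in> L2" using L2_diff[OF f diff, of 0 0] by simp
  have "L2_norm (\<lambda>x. f n x - g x) \<le> sqrt (4 * (1/2) ^ n)" for n
  proof -
    have "ennreal ((L2_norm (\<lambda>x. f n x - g x))\<^sup>2) = (\<integral>\<^sup>+x. ennreal ((cmod (f n x - g x))\<^sup>2) \<partial>lebesgue)"
      unfolding L2_norm_sq using diff by (intro nn_integral_eq_integral[symmetric]) (auto simp: L2_def)
    then have "ennreal ((L2_norm (\<lambda>x. f n x - g x))\<^sup>2) \<le> ennreal (4 * (1/2) ^ n)"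
      using nn[of n] by (simp only:)
    then have "(L2_norm (\<lambda>x. f n x - g x))\<^sup>2 \<le> 4 * (1/2) ^ n"
      by (subst (asm) ennreal_le_iff) auto
    then show ?thesis by (rule real_le_rsqrt)
  qed
  then have bound: "\<forall>\<^sub>F n in sequentially. norm (L2_norm (\<lambda>x. f n x - g x)) \<le> sqrt (4 * (1/2) ^ n)"
    by simp
  have "(\<lambda>n. sqrt (4 * (1/2) ^ n)) \<longlonglongrightarrow> sqrt (4 * 0)"
    by (intro tendsto_intros) simp_all
  then have "(\<lambda>n. sqrt (4 * (1/2) ^ n)) \<longlonglongrightarrow> 0" by simp
  then have "(\<lambda>n. L2_norm (\<lambda>x. f n x - g x)) \<longlonglongrightarrow> 0"
    by (rule Lim_null_comparison[OF bound])
  then show ?thesis using gL2 f unfolding L2_tendsto_def by auto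
qed

text \<open>The completeness of \<open>L\<^sup>2\<close> (Riesz and Fischer), with the modulus of the Cauchy sequence given
  explicitly.\<close>

lemma L2_Cauchy_converges:
  fixes f :: "nat \<Rightarrow> real \<Rightarrow> complex"
  assumes f: "\<And>n. f n \<in> L2" and e: "e \<longlonglongrightarrow> 0"
    and Cauchy: "\<And>m n. n \<le> m \<Longrightarrow> L2_norm (\<lambda>x. f m x - f n x) \<le> e n"
  shows "\<exists>g. L2_tendsto f g sequentially"
proof -
  have "\<exists>N. \<forall>n\<ge>N. e n < (1/2) ^ k" for k
    using order_tendstoD(2)[OF e, of "(1/2) ^ k"] by (auto simp: eventually_sequentially)
  then obtain N where N: "\<And>k n. n \<ge> N k \<Longrightarrow> e n < (1/2) ^ k" by metis
  (* Summing all the N i makes r monotone, and the summand k makes it go to infinity. *)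
  define r where "r k = k + (\<Sum>i\<le>k. N i)" for k
  have r: "r k \<ge> N k" "r k \<ge> k" "r k \<le> r (Suc k)" for k
    using member_le_sum[of k "{..k}" N] by (auto simp: r_def)
  have "L2_norm (\<lambda>x. f (r (Suc k)) x - f (r k) x) \<le> (1/2) ^ k" for k
    using Cauchy[OF r(3)[of k]] N[OF r(1)[of k]] by linarith
  then obtain g where g: "L2_tendsto (\<lambda>k. f (r k)) g sequentially"
    using L2_fast_Cauchy_converges[of "\<lambda>k. f (r k)"] f by blast
  have gL2: "g \<in> L2" using g by (simp add: L2_tendsto_def)
  have "L2_norm (\<lambda>x. f n x - g x) \<le> e n + L2_norm (\<lambda>x. f (r n) x - g x)" for n
    using L2_norm_triangle_diff[OF f[of n] f[of "r n"] gL2] Cauchy[OF r(2)[of n]]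
    by (simp add: L2_norm_minus_commute[of "f n" "f (r n)"])
  then have bound: "\<forall>\<^sub>F n in sequentially. norm (L2_norm (\<lambda>x. f n x - g x))
      \<le> e n + L2_norm (\<lambda>x. f (r n) x - g x)"
    by simp
  have "(\<lambda>n. e n + L2_norm (\<lambda>x. f (r n) x - g x)) \<longlonglongrightarrow> 0"
    using g by (intro tendsto_add_zero e) (simp add: L2_tendsto_def)
  then have "(\<lambda>n. L2_norm (\<lambda>x. f n x - g x)) \<longlonglongrightarrow> 0"
    by (rule Lim_null_comparison[OF bound])
  then show ?thesis using gL2 f unfolding L2_tendsto_def by auto
qed

section \<open>Continuity of translation\<close>

lemma lborel_integrable_shift:
  fixes f :: "real \<Rightarrow> 'a::{banach, second_countable_topology}"
  shows "integrable lborel f \<Longrightarrow> integrable lborel (\<lambda>x. f (x + u))"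
  using lborel_integrable_real_affine[of f 1 u] by (simp add: add.commute)

lemma lborel_integral_shift:
  fixes f :: "real \<Rightarrow> 'a::{banach, second_countable_topology}"
  shows "(LINT x|lborel. f (x + u)) = (LINT x|lborel. f x)"
  using lborel_integral_real_affine[of 1 f u] by (simp add: add.commute)

text \<open>Continuity of translation in \<open>L\<^sup>1\<close> passes from a dense class of functions to its closure, because the
  translation modulus of \<open>f\<close> exceeds that of \<open>g\<close> by at most twice the distance of \<open>f\<close> and \<open>g\<close>.\<close>

lemma L1_translation_approx:
  fixes f g :: "real \<Rightarrow> 'a::{banach, second_countable_topology}"
  assumes f: "integrable lborel f" and g: "integrable lborel g"
  shows "(LINT x|lborel. norm (f (x + u) - f x))
    \<le> (LINT x|lborel. norm (g (x + u) - g x)) + 2 * (LINT x|lborel. norm (f x - g x))"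
proof -
  note i = f g lborel_integrable_shift[OF f, of u] lborel_integrable_shift[OF g, of u]
  have fg: "integrable lborel (\<lambda>x. norm (f x - g x))" using f g by auto
  have "(LINT x|lborel. norm (f (x + u) - f x))
      \<le> (LINT x|lborel. norm (g (x + u) - g x) + (norm (f (x + u) - g (x + u)) + norm (f x - g x)))"
  proof (rule integral_mono)
    fix x
    have "f (x + u) - f x = (g (x + u) - g x) + ((f (x + u) - g (x + u)) + (g x - f x))" by simp
    then show "norm (f (x + u) - f x) \<le> norm (g (x + u) - g x) + (norm (f (x + u) - g (x + u)) + norm (f x - g x))"
      by (metis (no_types, lifting) norm_triangle_mono norm_triangle_ineq norm_minus_commute order_refl)
  qed (use i in auto)
  also have "\<dots> = (LINT x|lborel. norm (g (x + u) - g x)) + ((LINT x|lborel. norm (f (x + u) - g (x + u))) + (LINT x|lborel. norm (f x - g x)))"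
    using i by simp
  also have "(LINT x|lborel. norm (f (x + u) - g (x + u))) = (LINT x|lborel. norm (f x - g x))"
    by (rule lborel_integral_shift)
  finally show ?thesis by simp
qed

lemma L1_translation_dense:
  fixes f :: "real \<Rightarrow> 'a::{banach, second_countable_topology}"
  assumes f: "integrable lborel f"
    and approx: "\<And>e. e > 0 \<Longrightarrow> \<exists>g. integrable lborel g \<and> (LINT x|lborel. norm (f x - g x)) < e \<and>
        (\<lambda>n. LINT x|lborel. norm (g (x + u n) - g x)) \<longlonglongrightarrow> 0"
  shows "(\<lambda>n. LINT x|lborel. norm (f (x + u n) - f x)) \<longlonglongrightarrow> 0"
proof (rule LIMSEQ_I)
  fix r :: real assume "r > 0"
  then obtain g where g: "integrable lborel g" "(LINT x|lborel. norm (f x - g x)) < r/4"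
    "(\<lambda>n. LINT x|lborel. norm (g (x + u n) - g x)) \<longlonglongrightarrow> 0"
    using approx[of "r/4"] by auto
  obtain N where N: "\<And>n. n \<ge> N \<Longrightarrow> norm (LINT x|lborel. norm (g (x + u n) - g x)) < r/2"
    using LIMSEQ_D[OF g(3), of "r/2"] \<open>r > 0\<close> by auto
  have "norm ((LINT x|lborel. norm (f (x + u n) - f x)) - 0) < r" if "n \<ge> N" for n
  proof -
    have "(LINT x|lborel. norm (f (x + u n) - f x)) \<ge> 0"
      "(LINT x|lborel. norm (g (x + u n) - g x)) \<ge> 0"
      by (auto intro: integral_nonneg_AE)
    then show ?thesis
      using L1_translation_approx[OF f g(1), of "u n"] N[OF that] g(2) by simp
  qed
  then show "\<exists>N. \<forall>n\<ge>N. norm ((LINT x|lborel. norm (f (x + u n) - f x)) - 0) < r" by blast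
qed

text \<open>For an open set \<open>U\<close>, a point of \<open>U\<close> stays in \<open>U\<close> under small translations; hence
  \<open>1\<^sub>U(x + u) 1\<^sub>U(x)\<close> tends to \<open>1\<^sub>U(x)\<close> everywhere, dominated by \<open>1\<^sub>U\<close>.\<close>

lemma indicator_open_translation:
  fixes U :: "real set" and c :: "'a::{banach, second_countable_topology}"
  assumes U: "open U" "emeasure lborel U < \<infinity>" and u: "u \<longlonglongrightarrow> 0"
  shows "(\<lambda>n. LINT x|lborel. norm (indicator U (x + u n) *\<^sub>R c - indicator U x *\<^sub>R c)) \<longlonglongrightarrow> 0"
proof -
  have [measurable]: "U \<in> sets borel" using U by auto
  have i: "integrable lborel (indicat_real U)" using U by simp
  have ish: "integrable lborel (\<lambda>x. indicat_real U (x + u n))" for n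
    using lborel_integrable_shift[OF i] .
  have im: "integrable lborel (\<lambda>x. indicat_real U (x + u n) * indicat_real U x)" for n
    by (rule Bochner_Integration.integrable_bound[OF i]) (auto simp: indicator_def)
  have ptw: "(\<lambda>n. indicat_real U (x + u n) * indicat_real U x) \<longlonglongrightarrow> indicat_real U x" for x
  proof (cases "x \<in> U")
    case True
    have "(\<lambda>n. x + u n) \<longlonglongrightarrow> x + 0" by (intro tendsto_intros u)
    then have "\<forall>\<^sub>F n in sequentially. x + u n \<in> U"
      using topological_tendstoD[of "\<lambda>n. x + u n" "x + 0" sequentially U] U True by simp
    then have "\<forall>\<^sub>F n in sequentially. indicat_real U (x + u n) * indicat_real U x = indicat_real U x"
      by (auto elim!: eventually_mono simp: True)
    then show ?thesis by (rule tendsto_eventually)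
  qed auto
  have "(\<lambda>n. LINT x|lborel. indicat_real U (x + u n) * indicat_real U x) \<longlonglongrightarrow> (LINT x|lborel. indicat_real U x)"
    by (rule integral_dominated_convergence[where w = "indicat_real U"])
      (use i ptw in \<open>auto simp: indicator_def\<close>)
  then have "(\<lambda>n. norm c * (2 * (LINT x|lborel. indicat_real U x) - 2 * (LINT x|lborel. indicat_real U (x + u n) * indicat_real U x)))
     \<longlonglongrightarrow> norm c * (2 * (LINT x|lborel. indicat_real U x) - 2 * (LINT x|lborel. indicat_real U x))"
    by (intro tendsto_intros)
  moreover have "(LINT x|lborel. norm (indicator U (x + u n) *\<^sub>R c - indicator U x *\<^sub>R c))
     = norm c * (2 * (LINT x|lborel. indicat_real U x) - 2 * (LINT x|lborel. indicat_real U (x + u n) * indicat_real U x))" for n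
  proof -
    have "norm (indicator U (x + u n) *\<^sub>R c - indicator U x *\<^sub>R c)
       = norm c * (indicat_real U (x + u n) + indicat_real U x - 2 * (indicat_real U (x + u n) * indicat_real U x))" for x
      by (auto simp: indicator_def)
    then have "(LINT x|lborel. norm (indicator U (x + u n) *\<^sub>R c - indicator U x *\<^sub>R c))
     = (LINT x|lborel. norm c * (indicat_real U (x + u n) + indicat_real U x - 2 * (indicat_real U (x + u n) * indicat_real U x)))"
      by simp
    also have "\<dots> = norm c * ((LINT x|lborel. indicat_real U (x + u n)) + (LINT x|lborel. indicat_real U x)
        - 2 * (LINT x|lborel. indicat_real U (x + u n) * indicat_real U x))"
      using i ish im by simp
    finally show ?thesis using lborel_integral_shift[of "indicat_real U" "u n"] by simp
  qed
  ultimately show ?thesis by simp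
qed

text \<open>By outer regularity the indicator of a set of finite measure is approximated by indicators of open
  sets.\<close>

lemma L1_translation:
  fixes f :: "real \<Rightarrow> 'a::{banach, second_countable_topology}"
  assumes "integrable lborel f" and u: "u \<longlonglongrightarrow> (0::real)"
  shows "(\<lambda>n. LINT x|lborel. norm (f (x + u n) - f x)) \<longlonglongrightarrow> 0"
  using assms(1)
proof (induction rule: integrable_induct)
  case (base A c)
  have [measurable]: "A \<in> sets borel" using base by simp
  show ?case
  proof (rule L1_translation_dense)
    show "integrable lborel (\<lambda>x. indicator A x *\<^sub>R c)" using base by auto
    fix e :: real assume "e > 0"
    define d where "d = e / (norm c + 1)"
    have d: "d > 0" using \<open>e > 0\<close> by (auto simp: d_def add_nonneg_pos)
    obtain U where U: "open U" "A \<subseteq> U" "emeasure lborel (U - A) < d"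
      using outer_regular_lborel[of A d] d by auto
    have [measurable]: "U \<in> sets borel" using U by auto
    have "emeasure lborel U \<le> emeasure lborel A + emeasure lborel (U - A)"
      using U by (subst plus_emeasure) (auto intro!: emeasure_mono)
    also have "\<dots> < \<infinity>" using base U(3) less_trans[OF U(3) ennreal_less_top] by simp
    finally have Uf: "emeasure lborel U < \<infinity>" .
    have "(LINT x|lborel. norm (indicator A x *\<^sub>R c - indicator U x *\<^sub>R c)) = (LINT x|lborel. norm c * indicat_real (U - A) x)"
      using U by (intro Bochner_Integration.integral_cong) (auto simp: indicator_def)
    also have "\<dots> = norm c * measure lborel (U - A)" by simp
    also have "\<dots> \<le> norm c * d"
      using U(3) d by (intro mult_left_mono) (auto simp: measure_def intro!: enn2real_leI)
    also have "\<dots> < (norm c + 1) * d" using d by simp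
    also have "\<dots> = e"
    proof -
      have "norm c + 1 \<noteq> 0" using norm_ge_zero[of c] by linarith
      then show ?thesis by (simp add: d_def)
    qed
    finally show "\<exists>g. integrable lborel g \<and> (LINT x|lborel. norm (indicator A x *\<^sub>R c - g x)) < e \<and>
        (\<lambda>n. LINT x|lborel. norm (g (x + u n) - g x)) \<longlonglongrightarrow> 0"
      using Uf indicator_open_translation[OF U(1) Uf u, of c]
      by (intro exI[of _ "\<lambda>x. indicator U x *\<^sub>R c"]) auto
  qed
next
  case (add f g)
  have "(LINT x|lborel. norm (f (x + u n) + g (x + u n) - (f x + g x)))
     \<le> (LINT x|lborel. norm (f (x + u n) - f x)) + (LINT x|lborel. norm (g (x + u n) - g x))" for n
  proof -
    note i = add.hyps lborel_integrable_shift[OF add.hyps(1), of "u n"] lborel_integrable_shift[OF add.hyps(2), of "u n"]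
    have "(LINT x|lborel. norm (f (x + u n) + g (x + u n) - (f x + g x)))
       \<le> (LINT x|lborel. norm (f (x + u n) - f x) + norm (g (x + u n) - g x))"
      using i by (intro integral_mono) (auto simp: norm_diff_triangle_ineq)
    also have "\<dots> = (LINT x|lborel. norm (f (x + u n) - f x)) + (LINT x|lborel. norm (g (x + u n) - g x))"
      using i by simp
    finally show ?thesis .
  qed
  then have "\<forall>\<^sub>F n in sequentially. norm (LINT x|lborel. norm (f (x + u n) + g (x + u n) - (f x + g x)))
     \<le> (LINT x|lborel. norm (f (x + u n) - f x)) + (LINT x|lborel. norm (g (x + u n) - g x))"
    by (simp add: integral_nonneg_AE)
  then show ?case
    by (rule Lim_null_comparison) (intro tendsto_add_zero add.IH)
next
  case (lim f s)
  note [measurable] = borel_measurable_integrable[OF lim.hyps(1)] borel_measurable_integrable[OF lim.hyps(4)]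
  have "(\<lambda>i. LINT x|lborel. norm (f x - s i x)) \<longlonglongrightarrow> (LINT x|(lborel :: real measure). 0)"
  proof (rule integral_dominated_convergence[where w = "\<lambda>x. 3 * norm (f x)"])
    show "AE x in lborel. (\<lambda>i. norm (f x - s i x)) \<longlonglongrightarrow> 0"
    proof (rule AE_I2)
      fix x assume "x \<in> space (lborel :: real measure)"
      then have "(\<lambda>i. norm (f x - s i x)) \<longlonglongrightarrow> norm (f x - f x)"
        by (intro tendsto_intros lim.hyps(2))
      then show "(\<lambda>i. norm (f x - s i x)) \<longlonglongrightarrow> 0" by simp
    qed
    show "AE x in lborel. norm (norm (f x - s i x)) \<le> 3 * norm (f x)" for i
    proof (rule AE_I2)
      fix x assume "x \<in> space (lborel :: real measure)"
      then show "norm (norm (f x - s i x)) \<le> 3 * norm (f x)"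
        using norm_triangle_ineq4[of "f x" "s i x"] lim.hyps(3)[of x i] by simp
    qed
  qed (use lim.hyps(4) in auto)
  then have z: "(\<lambda>i. LINT x|lborel. norm (f x - s i x)) \<longlonglongrightarrow> 0" by simp
  show ?case
  proof (rule L1_translation_dense[OF lim.hyps(4)])
    fix e :: real assume "e > 0"
    then obtain i where "(LINT x|lborel. norm (f x - s i x)) < e"
      using order_tendstoD(2)[OF z, of e] by (auto simp: eventually_sequentially)
    then show "\<exists>g. integrable lborel g \<and> (LINT x|lborel. norm (f x - g x)) < e \<and>
        (\<lambda>n. LINT x|lborel. norm (g (x + u n) - g x)) \<longlonglongrightarrow> 0"
      using lim.hyps(1) lim.IH by blast
  qed
qed

section \<open>Plancherel's identity\<close>

lemma borel_measurable_cnj [measurable]: "cnj \<in> borel_measurable borel"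
  by (intro borel_measurable_continuous_onI continuous_intros)

lemma borel_measurable_cis [measurable]: "cis \<in> borel_measurable borel"
  unfolding cis_conv_exp[abs_def] by (intro borel_measurable_continuous_onI continuous_intros)

text \<open>The map \<open>a \<mapsto> |a| a\<close> is a homeomorphism with 1/2-Hoelder inverse. It carries \<open>L\<^sup>2\<close> functions to
  \<open>L\<^sup>1\<close> functions and commutes with translations, so that the continuity of
  translation in \<open>L\<^sup>2\<close> is inherited from \<open>L\<^sup>1\<close>.\<close>

lemma norm_diff_square_le:
  fixes a b :: "'a::real_inner"
  shows "(norm (a - b))\<^sup>2 \<le> 2 * norm (norm a *\<^sub>R a - norm b *\<^sub>R b)"
proof (cases "a = b")
  case False
  define n where "n = norm a + norm b"
  (* Half of (norm a + norm b) (norm (a - b))^2 is a lower bound of the inner product of the two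
     differences, and the norm of a - b cancels against Cauchy-Schwarz. *)
  have sq: "(norm (a - b))\<^sup>2 = (norm a)\<^sup>2 + (norm b)\<^sup>2 - 2 * inner a b"
    by (simp add: power2_norm_eq_inner inner_diff_left inner_diff_right inner_commute[of b a])
  have "inner (norm a *\<^sub>R a - norm b *\<^sub>R b) (a - b)
      = norm a * ((norm a)\<^sup>2 - inner a b) - norm b * (inner a b - (norm b)\<^sup>2)"
    by (simp add: power2_norm_eq_inner inner_diff_left inner_diff_right inner_commute[of b a] algebra_simps)
  then have "inner (norm a *\<^sub>R a - norm b *\<^sub>R b) (a - b) - n / 2 * (norm (a - b))\<^sup>2
      = n / 2 * (norm a - norm b)\<^sup>2"
    unfolding sq n_def by (simp add: field_simps power2_eq_square)
  moreover have "n / 2 * (norm a - norm b)\<^sup>2 \<ge> 0" by (simp add: n_def)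
  moreover have "inner (norm a *\<^sub>R a - norm b *\<^sub>R b) (a - b) \<le> norm (norm a *\<^sub>R a - norm b *\<^sub>R b) * norm (a - b)"
    by (rule norm_cauchy_schwarz)
  ultimately have "n / 2 * norm (a - b) * norm (a - b) \<le> norm (norm a *\<^sub>R a - norm b *\<^sub>R b) * norm (a - b)"
    by (simp add: power2_eq_square)
  then have 1: "n / 2 * norm (a - b) \<le> norm (norm a *\<^sub>R a - norm b *\<^sub>R b)"
    using False by simp
  have "norm (a - b) * norm (a - b) \<le> n * norm (a - b)"
    using norm_triangle_ineq4[of a b] by (intro mult_right_mono) (auto simp: n_def)
  then show ?thesis using 1 by (simp add: power2_eq_square)
qed simp

lemma L2_translation:
  fixes h :: "real \<Rightarrow> complex"
  assumes [measurable]: "h \<in> borel_measurable borel" and h: "integrable lborel (\<lambda>x. (cmod (h x))\<^sup>2)"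
    and u: "u \<longlonglongrightarrow> 0"
  shows "(\<lambda>n. LINT x|lborel. (cmod (h (x + u n) - h x))\<^sup>2) \<longlonglongrightarrow> 0"
proof -
  define H where "H x = cmod (h x) *\<^sub>R h x" for x
  have H: "integrable lborel H"
    unfolding H_def by (rule Bochner_Integration.integrable_bound[OF h]) (auto simp: power2_eq_square)
  have "(LINT x|lborel. (cmod (h (x + u n) - h x))\<^sup>2) \<le> 2 * (LINT x|lborel. cmod (H (x + u n) - H x))" for n
  proof -
    have i: "integrable lborel (\<lambda>x. 2 * cmod (H (x + u n) - H x))"
      using H lborel_integrable_shift[OF H, of "u n"] by auto
    have "(LINT x|lborel. (cmod (h (x + u n) - h x))\<^sup>2) \<le> (LINT x|lborel. 2 * cmod (H (x + u n) - H x))"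
    proof (rule integral_mono)
      show le: "(cmod (h (x + u n) - h x))\<^sup>2 \<le> 2 * cmod (H (x + u n) - H x)" for x
        using norm_diff_square_le[of "h (x + u n)" "h x"] by (simp add: H_def)
      show "integrable lborel (\<lambda>x. (cmod (h (x + u n) - h x))\<^sup>2)"
        by (rule Bochner_Integration.integrable_bound[OF i]) (use le in auto)
    qed (use i in auto)
    then show ?thesis by simp
  qed
  then have "\<forall>\<^sub>F n in sequentially. norm (LINT x|lborel. (cmod (h (x + u n) - h x))\<^sup>2)
     \<le> 2 * (LINT x|lborel. cmod (H (x + u n) - H x))"
    by (simp add: integral_nonneg_AE)
  moreover have "(\<lambda>n. 2 * (LINT x|lborel. cmod (H (x + u n) - H x))) \<longlonglongrightarrow> 0"
    using tendsto_mult_right_zero[OF L1_translation[OF H u], of 2] by simp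
  ultimately show ?thesis by (rule Lim_null_comparison)
qed

lemma L2_borel:
  assumes "f \<in> borel_measurable borel"
  shows "f \<in> L2 \<longleftrightarrow> integrable lborel (\<lambda>x. (cmod (f x))\<^sup>2)"
    "L2_norm f = sqrt (LINT x|lborel. (cmod (f x))\<^sup>2)"
proof -
  have "(\<lambda>x. (cmod (f x))\<^sup>2) \<in> borel_measurable lborel" "f \<in> borel_measurable lebesgue"
    using assms by (auto intro: measurable_completion)
  then show "f \<in> L2 \<longleftrightarrow> integrable lborel (\<lambda>x. (cmod (f x))\<^sup>2)"
    "L2_norm f = sqrt (LINT x|lborel. (cmod (f x))\<^sup>2)"
    by (simp_all add: L2_def L2_norm_def integrable_completion integral_completion)
qed

definition autocorrelation :: "(real \<Rightarrow> complex) \<Rightarrow> real \<Rightarrow> complex" where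
  "autocorrelation h u = (LINT x|lborel. h (x + u) * cnj (h x))"

lemma autocorrelation_continuous_0:
  assumes [measurable]: "h \<in> borel_measurable borel" and h: "integrable lborel (\<lambda>x. (cmod (h x))\<^sup>2)"
    and u: "u \<longlonglongrightarrow> 0"
  shows "(\<lambda>n. autocorrelation h (u n)) \<longlonglongrightarrow> of_real (LINT x|lborel. (cmod (h x))\<^sup>2)"
proof -
  have hL2: "h \<in> L2" "(\<lambda>x. cnj (h x)) \<in> L2" using h by (auto simp: L2_borel)
  have shL2: "(\<lambda>x. h (x + u n)) \<in> L2" for n
    using lborel_integrable_shift[OF h, of "u n"] by (auto simp: L2_borel)
  have "L2_norm (\<lambda>x. h (x + u n) - h x) = sqrt (LINT x|lborel. (cmod (h (x + u n) - h x))\<^sup>2)" for n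
    by (rule L2_borel) measurable
  moreover have "(\<lambda>n. sqrt (LINT x|lborel. (cmod (h (x + u n) - h x))\<^sup>2)) \<longlonglongrightarrow> sqrt 0"
    by (intro tendsto_intros L2_translation assms)
  ultimately have "L2_tendsto (\<lambda>n x. h (x + u n)) h sequentially"
    using hL2 shL2 by (auto simp: L2_tendsto_def)
  from L2_tendsto_integral[OF this hL2(2)]
  have "(\<lambda>n. LINT x|lebesgue. h (x + u n) * cnj (h x)) \<longlonglongrightarrow> (LINT x|lebesgue. h x * cnj (h x))" .
  moreover have "(LINT x|lebesgue. h (x + u n) * cnj (h x)) = autocorrelation h (u n)" for n
    unfolding autocorrelation_def by (rule integral_completion) measurable
  moreover have "(LINT x|lebesgue. h x * cnj (h x)) = of_real (LINT x|lborel. (cmod (h x))\<^sup>2)"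
    by (subst integral_completion) (simp_all add: complex_norm_square[symmetric] del: of_real_power)
  ultimately show ?thesis by simp
qed

lemma autocorrelation_bound:
  assumes [measurable]: "h \<in> borel_measurable borel" and h: "integrable lborel (\<lambda>x. (cmod (h x))\<^sup>2)"
  shows "cmod (autocorrelation h u) \<le> (LINT x|lborel. (cmod (h x))\<^sup>2)"
proof -
  have hL2: "h \<in> L2" "(\<lambda>x. cnj (h x)) \<in> L2" "(\<lambda>x. h (x + u)) \<in> L2"
    using h lborel_integrable_shift[OF h, of u] by (auto simp: L2_borel)
  have "autocorrelation h u = (LINT x|lebesgue. h (x + u) * cnj (h x))"
    unfolding autocorrelation_def by (rule integral_completion[symmetric]) measurable
  also have "cmod \<dots> \<le> L2_norm (\<lambda>x. h (x + u)) * L2_norm (\<lambda>x. cnj (h x))"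
    by (rule L2_Cauchy_Schwarz) (use hL2 in auto)
  also have "\<dots> = (LINT x|lborel. (cmod (h x))\<^sup>2)"
    using lborel_integral_shift[of "\<lambda>x. (cmod (h x))\<^sup>2" u]
    by (simp add: L2_borel(2) real_sqrt_mult[symmetric] del: real_sqrt_mult_self)
  finally show ?thesis .
qed

text \<open>Fubini's theorem for \<open>h(x + u) cnj (h x) e\<^sup>-\<^sup>2\<^sup>\<pi>\<^sup>i\<^sup>t\<^sup>u\<close>: integrating over \<open>u\<close> first separates the two
  factors.\<close>

lemma fourier_autocorrelation:
  assumes [measurable]: "h \<in> borel_measurable borel" and h: "integrable lborel h"
  defines "F \<equiv> \<lambda>t. LINT x|lborel. cis (- 2 * pi * t * x) * h x"
  shows "integrable lborel (autocorrelation h)"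
    and "(LINT u|lborel. cis (- 2 * pi * t * u) * autocorrelation h u) = of_real ((cmod (F t))\<^sup>2)"
proof -
  have i: "integrable (lborel \<Otimes>\<^sub>M lborel) (\<lambda>(x, u). cis (- 2 * pi * t * u) * (h (x + u) * cnj (h x)))" for t
  proof (rule lborel_pair.Fubini_integrable)
    show "integrable lborel (\<lambda>x. LINT u|lborel. norm (case (x, u) of (x, u) \<Rightarrow> cis (- 2 * pi * t * u) * (h (x + u) * cnj (h x))))"
    proof -
      have "(LINT u|lborel. norm (case (x, u) of (x, u) \<Rightarrow> cis (- 2 * pi * t * u) * (h (x + u) * cnj (h x))))
          = (LINT u|lborel. cmod (h u)) * cmod (h x)" for x
        using lborel_integral_shift[of "\<lambda>u. cmod (h u)" x] by (simp add: norm_mult add.commute)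
      then show ?thesis using h by simp
    qed
    show "AE x in lborel. integrable lborel (\<lambda>u. case (x, u) of (x, u) \<Rightarrow> cis (- 2 * pi * t * u) * (h (x + u) * cnj (h x)))"
    proof (rule AE_I2)
      fix x
      have "integrable lborel (\<lambda>u. h (x + u) * cnj (h x))"
        using lborel_integrable_shift[OF h, of x] by (simp add: add.commute)
      then have "integrable lborel (\<lambda>u. cis (- 2 * pi * t * u) * (h (x + u) * cnj (h x)))"
        by (rule Bochner_Integration.integrable_bound) (auto simp: norm_mult)
      then show "integrable lborel (\<lambda>u. case (x, u) of (x, u) \<Rightarrow> cis (- 2 * pi * t * u) * (h (x + u) * cnj (h x)))"
        by simp
    qed
  qed measurable
  show "integrable lborel (autocorrelation h)"
    using lborel_pair.integrable_snd[OF i[of 0]] by (simp add: autocorrelation_def[abs_def])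
  have "(LINT u|lborel. cis (- 2 * pi * t * u) * autocorrelation h u)
      = (LINT u|lborel. LINT x|lborel. cis (- 2 * pi * t * u) * (h (x + u) * cnj (h x)))"
    by (simp add: autocorrelation_def)
  also have "\<dots> = (LINT x|lborel. LINT u|lborel. cis (- 2 * pi * t * u) * (h (x + u) * cnj (h x)))"
    by (rule lborel_pair.Fubini_integral[OF i])
  also have "\<dots> = (LINT x|lborel. F t * cnj (cis (- 2 * pi * t * x) * h x))"
  proof (rule Bochner_Integration.integral_cong[OF refl])
    fix x
    have "(LINT u|lborel. cis (- 2 * pi * t * u) * (h (x + u) * cnj (h x)))
       = (LINT u|lborel. (cis (- 2 * pi * t * (u + x)) * h (u + x)) * (cis (2 * pi * t * x) * cnj (h x)))"
      by (rule Bochner_Integration.integral_cong[OF refl]) (simp add: algebra_simps cis_mult[symmetric] cis_mult)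
    also have "\<dots> = (LINT u|lborel. cis (- 2 * pi * t * (u + x)) * h (u + x)) * (cis (2 * pi * t * x) * cnj (h x))"
      by simp
    also have "(LINT u|lborel. cis (- 2 * pi * t * (u + x)) * h (u + x)) = F t"
      unfolding F_def by (rule lborel_integral_shift[of "\<lambda>u. cis (- 2 * pi * t * u) * h u" x])
    finally show "(LINT u|lborel. cis (- 2 * pi * t * u) * (h (x + u) * cnj (h x))) = F t * cnj (cis (- 2 * pi * t * x) * h x)"
      by (simp add: cis_cnj)
  qed
  also have "\<dots> = F t * (LINT x|lborel. cnj (cis (- 2 * pi * t * x) * h x))"
    by (rule integral_mult_right_zero)
  also have "(LINT x|lborel. cnj (cis (- 2 * pi * t * x) * h x)) = cnj (F t)"
    unfolding F_def by (rule Bochner_Integration.integral_cnj)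
  also have "F t * cnj (F t) = of_real ((cmod (F t))\<^sup>2)" by (rule complex_norm_square[symmetric])
  finally show "(LINT u|lborel. cis (- 2 * pi * t * u) * autocorrelation h u) = of_real ((cmod (F t))\<^sup>2)" .
qed

lemma fourier_gaussian:
  assumes "s > 0"
  shows "(LINT t|lborel. complex_of_real (exp (- (s * t)\<^sup>2 / 2)) * cis (- 2 * pi * u * t)) = of_real (2 * pi / s * std_normal_density (2 * pi * u / s))"
proof -
  have "(LINT t|lborel. of_real (exp (- (s * t)\<^sup>2 / 2)) * cis (- 2 * pi * u * t))
    = (1 / s) *\<^sub>R (LINT y|lborel. of_real (exp (- (s * (0 + (1 / s) * y))\<^sup>2 / 2)) * cis (- 2 * pi * u * (0 + (1/s) * y)))"
    using lborel_integral_real_affine[of "1 / s" "\<lambda>t. of_real (exp (- (s * t)\<^sup>2 / 2)) * cis (- 2 * pi * u * t)" 0] assms by simp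
  also have "(LINT y|lborel. of_real (exp (- (s * (0 + (1 / s) * y))\<^sup>2 / 2)) * cis (- 2 * pi * u * (0 + (1/s) * y)))
     = (LINT y|lborel. sqrt (2 * pi) *\<^sub>R (std_normal_density y *\<^sub>R iexp ((- 2 * pi * u / s) * y)))"
    using assms by (intro Bochner_Integration.integral_cong[OF refl])
      (simp add: std_normal_density_def cis_conv_exp scaleR_conv_of_real mult_ac)
  also have "\<dots> = sqrt (2 * pi) *\<^sub>R (LINT y|lborel. std_normal_density y *\<^sub>R iexp ((- 2 * pi * u / s) * y))"
    by (rule integral_scaleR_right)
  also have "(LINT y|lborel. std_normal_density y *\<^sub>R iexp ((- 2 * pi * u / s) * y)) = char std_normal_distribution (- 2 * pi * u / s)"
    unfolding char_def by (subst integral_density) auto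
  also have "\<dots> = of_real (exp (- (- 2 * pi * u / s)\<^sup>2 / 2))"
    by (simp add: char_std_normal_distribution)
  finally have *: "(LINT t|lborel. of_real (exp (- (s * t)\<^sup>2 / 2)) * cis (- 2 * pi * u * t)) =
      (1 / s) *\<^sub>R (sqrt (2 * pi) *\<^sub>R complex_of_real (exp (- (- 2 * pi * u / s)\<^sup>2 / 2)))" .
  have "2 * pi / s * std_normal_density (2 * pi * u / s) = (1 / s) * (2 * pi / sqrt (2 * pi)) * exp (- (- 2 * pi * u / s)\<^sup>2 / 2)"
    by (simp add: std_normal_density_def)
  also have "2 * pi / sqrt (2 * pi) = sqrt (2 * pi)" by (rule real_div_sqrt) simp
  finally have "2 * pi / s * std_normal_density (2 * pi * u / s) = (1 / s) * (sqrt (2 * pi) * exp (- (- 2 * pi * u / s)\<^sup>2 / 2))"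
    by simp
  moreover have "(1 / s) *\<^sub>R (sqrt (2 * pi) *\<^sub>R complex_of_real (exp (- (- 2 * pi * u / s)\<^sup>2 / 2)))
      = of_real ((1 / s) * (sqrt (2 * pi) * exp (- (- 2 * pi * u / s)\<^sup>2 / 2)))"
    by (simp add: scaleR_conv_of_real)
  ultimately show ?thesis using * by (simp only:)
qed

text \<open>Integrating \<open>|F|\<^sup>2\<close> against \<open>exp (-(s t)\<^sup>2/2)\<close> gives the mean of the autocorrelation at the
  points \<open>s v / (2 \<pi>)\<close>, where \<open>v\<close> is normally distributed. As \<open>s\<close> decreases to \<open>0\<close>, the weights
  increase to \<open>1\<close>, while these points tend to \<open>0\<close>, where the autocorrelation is \<open>\<integral>|h|\<^sup>2\<close>.\<close>

lemma Plancherel_borel: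
  assumes [measurable]: "h \<in> borel_measurable borel" and h: "integrable lborel h"
    and h2: "integrable lborel (\<lambda>x. (cmod (h x))\<^sup>2)"
  defines "F \<equiv> \<lambda>t. LINT x|lborel. cis (- 2 * pi * t * x) * h x"
  shows "F \<in> borel_measurable borel" "integrable lborel (\<lambda>t. (cmod (F t))\<^sup>2)"
    "(LINT t|lborel. (cmod (F t))\<^sup>2) = (LINT x|lborel. (cmod (h x))\<^sup>2)"
proof -
  show Fm [measurable]: "F \<in> borel_measurable borel"
    unfolding F_def by measurable
  define A where "A = autocorrelation h"
  define N where "N = (LINT x|lborel. (cmod (h x))\<^sup>2)"
  have A: "integrable lborel A"
    and FA: "(LINT u|lborel. cis (- 2 * pi * t * u) * A u) = of_real ((cmod (F t))\<^sup>2)" for t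
    using fourier_autocorrelation[OF assms(1) h] by (auto simp: A_def F_def)
  have [measurable]: "A \<in> borel_measurable borel" using A by auto
  define w where "w s t = exp (- (s * t)\<^sup>2 / 2)" for s t :: real
  have [measurable]: "w s \<in> borel_measurable borel" for s unfolding w_def by measurable
  have w_abs: "\<bar>w s t\<bar> = w s t" for s t by (simp add: w_def)
  have w: "integrable lborel (w s)" if "s > 0" for s
  proof -
    have "integrable lborel (\<lambda>t. sqrt (2 * pi * (1/s)\<^sup>2) * normal_density 0 (1/s) t)"
      using that by (intro integrable_mult_right integrable_normal_density) auto
    also have "(\<lambda>t. sqrt (2 * pi * (1/s)\<^sup>2) * normal_density 0 (1/s) t) = w s"
      using that by (auto simp: normal_density_def w_def field_simps)
    finally show ?thesis .
  qed
  have prod: "integrable (lborel \<Otimes>\<^sub>M lborel) (\<lambda>(t, u). of_real (w s t) * (cis (- 2 * pi * t * u) * A u))"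
    if "s > 0" for s
  proof (rule lborel_pair.Fubini_integrable)
    show "integrable lborel (\<lambda>t. LINT u|lborel. norm (case (t, u) of (t, u) \<Rightarrow> of_real (w s t) * (cis (- 2 * pi * t * u) * A u)))"
      using w[OF that] by (simp add: norm_mult w_abs)
    show "AE t in lborel. integrable lborel (\<lambda>u. case (t, u) of (t, u) \<Rightarrow> of_real (w s t) * (cis (- 2 * pi * t * u) * A u))"
    proof (rule AE_I2)
      fix t
      have "integrable lborel (\<lambda>u. of_real (w s t) * A u)" using A by simp
      then have "integrable lborel (\<lambda>u. of_real (w s t) * (cis (- 2 * pi * t * u) * A u))"
        by (rule Bochner_Integration.integrable_bound) (auto simp: norm_mult)
      then show "integrable lborel (\<lambda>u. case (t, u) of (t, u) \<Rightarrow> of_real (w s t) * (cis (- 2 * pi * t * u) * A u))"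
        by simp
    qed
  qed measurable
  have inner_t: "(LINT u|lborel. of_real (w s t) * (cis (- 2 * pi * t * u) * A u)) = of_real (w s t * (cmod (F t))\<^sup>2)" for s t
    using FA[of t] by simp
  have wF: "integrable lborel (\<lambda>t. w s t * (cmod (F t))\<^sup>2)" if "s > 0" for s
    using integrable_norm[OF lborel_pair.integrable_fst[OF prod[OF that]]]
    unfolding inner_t by (simp add: norm_mult norm_power w_abs)
  have J: "complex_of_real (LINT t|lborel. w s t * (cmod (F t))\<^sup>2)
      = (LINT v|lborel. of_real (std_normal_density v) * A (s / (2 * pi) * v))" if "s > 0" for s
  proof -
    have "complex_of_real (LINT t|lborel. w s t * (cmod (F t))\<^sup>2)
        = (LINT t|lborel. LINT u|lborel. of_real (w s t) * (cis (- 2 * pi * t * u) * A u))"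
      unfolding inner_t by (rule integral_complex_of_real[symmetric])
    also have "\<dots> = (LINT u|lborel. LINT t|lborel. of_real (w s t) * (cis (- 2 * pi * t * u) * A u))"
      by (rule lborel_pair.Fubini_integral[OF prod[OF that], symmetric])
    also have "\<dots> = (LINT u|lborel. of_real (2 * pi / s * std_normal_density (2 * pi * u / s)) * A u)"
    proof (rule Bochner_Integration.integral_cong[OF refl])
      fix u
      have "(LINT t|lborel. of_real (w s t) * (cis (- 2 * pi * t * u) * A u))
         = (LINT t|lborel. of_real (w s t) * cis (- 2 * pi * u * t)) * A u"
        by (subst integral_mult_left_zero[symmetric]) (simp add: mult_ac)
      then show "(LINT t|lborel. of_real (w s t) * (cis (- 2 * pi * t * u) * A u))
         = of_real (2 * pi / s * std_normal_density (2 * pi * u / s)) * A u"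
        using fourier_gaussian[OF that, of u] by (simp add: w_def)
    qed
    also have "\<dots> = (s / (2 * pi)) *\<^sub>R (LINT v|lborel. of_real (2 * pi / s * std_normal_density (2 * pi * (0 + s / (2 * pi) * v) / s)) * A (0 + s / (2 * pi) * v))"
      using that by (subst lborel_integral_real_affine[of "s / (2 * pi)" _ 0]) auto
    also have "\<dots> = (LINT v|lborel. (s / (2 * pi)) *\<^sub>R (of_real (2 * pi / s * std_normal_density (2 * pi * (0 + s / (2 * pi) * v) / s)) * A (0 + s / (2 * pi) * v)))"
      by (rule integral_scaleR_right[symmetric])
    also have "\<dots> = (LINT v|lborel. of_real (std_normal_density v) * A (s / (2 * pi) * v))"
      using that by (intro Bochner_Integration.integral_cong[OF refl]) (simp add: scaleR_conv_of_real)
    finally show ?thesis .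
  qed
  define s where "s n = 1 / real (Suc n)" for n
  have s: "s n > 0" "s (Suc n) \<le> s n" for n by (auto simp: s_def field_simps)
  have s0: "s \<longlonglongrightarrow> 0" unfolding s_def using LIMSEQ_inverse_real_of_nat by (simp add: inverse_eq_divide)
  have sd: "decseq s" using s(2) by (rule decseq_SucI)
  have "(\<lambda>n. LINT v|lborel. of_real (std_normal_density v) * A (s n / (2 * pi) * v))
      \<longlonglongrightarrow> (LINT v|lborel. of_real (std_normal_density v) * of_real N)"
  proof (rule integral_dominated_convergence[where w = "\<lambda>v. std_normal_density v * N"])
    show "integrable lborel (\<lambda>v. std_normal_density v * N)" by simp
    show "AE v in lborel. (\<lambda>n. of_real (std_normal_density v) * A (s n / (2 * pi) * v))
        \<longlonglongrightarrow> of_real (std_normal_density v) * of_real N"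
    proof (rule AE_I2)
      fix v
      have "(\<lambda>n. s n / (2 * pi) * v) \<longlonglongrightarrow> 0 / (2 * pi) * v" by (intro tendsto_intros s0) auto
      then show "(\<lambda>n. of_real (std_normal_density v) * A (s n / (2 * pi) * v))
        \<longlonglongrightarrow> of_real (std_normal_density v) * of_real N"
        unfolding A_def N_def
        by (intro tendsto_mult tendsto_const autocorrelation_continuous_0[OF assms(1) h2]) simp
    qed
    show "AE v in lborel. norm (of_real (std_normal_density v) * A (s n / (2 * pi) * v)) \<le> std_normal_density v * N" for n
      unfolding A_def N_def using autocorrelation_bound[OF assms(1) h2]
      by (intro AE_I2) (simp add: norm_mult mult_left_mono)
  qed auto
  also have "(LINT v|lborel. of_real (std_normal_density v) * of_real N) = complex_of_real (LINT v|lborel. std_normal_density v * N)"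
    unfolding of_real_mult[symmetric] by (rule integral_complex_of_real)
  also have "(LINT v|lborel. std_normal_density v * N) = N" by simp
  finally have "(\<lambda>n. complex_of_real (LINT t|lborel. w (s n) t * (cmod (F t))\<^sup>2)) \<longlonglongrightarrow> of_real N"
    by (simp only: J[OF s(1)])
  then have lim: "(\<lambda>n. LINT t|lborel. w (s n) t * (cmod (F t))\<^sup>2) \<longlonglongrightarrow> N"
    by (simp only: tendsto_of_real_iff)
  have mono: "AE t in lborel. mono (\<lambda>n. w (s n) t * (cmod (F t))\<^sup>2)"
  proof (rule AE_I2, rule monoI)
    fix t :: real and m n :: nat assume "m \<le> n"
    have "s n \<le> s m" using sd \<open>m \<le> n\<close> by (simp add: decseq_def)
    then have "(s n * t)\<^sup>2 \<le> (s m * t)\<^sup>2"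
      using s(1)[of n] unfolding power_mult_distrib by (intro mult_right_mono power_mono) auto
    then show "w (s m) t * (cmod (F t))\<^sup>2 \<le> w (s n) t * (cmod (F t))\<^sup>2"
      unfolding w_def by (intro mult_right_mono) auto
  qed
  have ptw: "AE t in lborel. (\<lambda>n. w (s n) t * (cmod (F t))\<^sup>2) \<longlonglongrightarrow> (cmod (F t))\<^sup>2"
  proof (rule AE_I2)
    fix t
    have "(\<lambda>n. w (s n) t * (cmod (F t))\<^sup>2) \<longlonglongrightarrow> exp (- (0 * t)\<^sup>2 / 2) * (cmod (F t))\<^sup>2"
      unfolding w_def by (intro tendsto_intros s0) auto
    then show "(\<lambda>n. w (s n) t * (cmod (F t))\<^sup>2) \<longlonglongrightarrow> (cmod (F t))\<^sup>2" by simp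
  qed
  have m: "(\<lambda>t. (cmod (F t))\<^sup>2) \<in> borel_measurable lborel" by measurable
  show "integrable lborel (\<lambda>t. (cmod (F t))\<^sup>2)"
    by (rule integrable_monotone_convergence[OF wF[OF s(1)] mono ptw lim m])
  show "(LINT t|lborel. (cmod (F t))\<^sup>2) = (LINT x|lborel. (cmod (h x))\<^sup>2)"
    unfolding N_def[symmetric]
    by (rule integral_monotone_convergence[OF wF[OF s(1)] mono ptw lim m])
qed

section \<open>The Fourier transform on square integrable functions\<close>

text \<open>Fubini's theorem is applied to products of \<open>lborel\<close>, for which a Lebesgue measurable function
  need not be measurable.\<close>

lemma borel_representative:
  fixes f :: "real \<Rightarrow> complex"
  assumes "f \<in> borel_measurable lebesgue"
  obtains h where "h \<in> borel_measurable borel" "AE x in lebesgue. f x = h x"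
proof -
  have "(\<lambda>x. Re (f x)) \<in> borel_measurable (completion lborel)" "(\<lambda>x. Im (f x)) \<in> borel_measurable (completion lborel)"
    using assms by (auto intro: measurable_compose[OF assms])
  from this[THEN completion_ex_borel_measurable_real]
  obtain a b where ab: "a \<in> borel_measurable lborel" "AE x in lborel. Re (f x) = a x"
    "b \<in> borel_measurable lborel" "AE x in lborel. Im (f x) = b x"
    by blast
  show ?thesis
  proof (rule that)
    show "(\<lambda>x. Complex (a x) (b x)) \<in> borel_measurable borel"
      using ab unfolding Complex_eq by simp
    have "AE x in lborel. f x = Complex (a x) (b x)"
      using ab(2,4) by eventually_elim (simp add: complex_eq_iff)
    then show "AE x in lebesgue. f x = Complex (a x) (b x)" by (rule AE_completion)
  qed
qed

lemma fourier_L1_cis: "fourier_L1 f x = (LINT t|lebesgue. cis (- 2 * pi * x * t) * f t)"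
  by (simp add: fourier_L1_def cis_conv_exp mult_ac)

lemma L1_add: "f \<in> L1 \<Longrightarrow> g \<in> L1 \<Longrightarrow> (\<lambda>x. f x + g x) \<in> L1"
  by (simp add: L1_def)

lemma L1_cmult: "f \<in> L1 \<Longrightarrow> (\<lambda>x. c * f x) \<in> L1"
  by (simp add: L1_def)

lemma lebesgue_cis_measurable: "(\<lambda>t. cis (a * t)) \<in> borel_measurable lebesgue"
proof -
  have "(\<lambda>t. cis (a * t)) \<in> borel_measurable lborel" by measurable
  then show ?thesis by (rule measurable_completion)
qed

lemma L1_cis_mult: "f \<in> L1 \<Longrightarrow> integrable lebesgue (\<lambda>t. cis (a * t) * f t)"
proof -
  assume f: "f \<in> L1"
  then have i: "integrable lebesgue f" by (simp add: L1_def)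
  show ?thesis
    by (rule Bochner_Integration.integrable_bound[OF i])
      (use i in \<open>auto simp: norm_mult intro!: borel_measurable_times lebesgue_cis_measurable\<close>)
qed

lemma fourier_L1_add: "f \<in> L1 \<Longrightarrow> g \<in> L1 \<Longrightarrow> fourier_L1 (\<lambda>x. f x + g x) t = fourier_L1 f t + fourier_L1 g t"
  using L1_cis_mult[of f "- 2 * pi * t"] L1_cis_mult[of g "- 2 * pi * t"]
  by (simp add: fourier_L1_cis distrib_left)

lemma fourier_L1_cmult: "fourier_L1 (\<lambda>x. c * f x) t = c * fourier_L1 f t"
  unfolding fourier_L1_cis by (subst integral_mult_right_zero[symmetric]) (simp add: mult_ac)

lemma lebesgue_integral_shift:
  fixes f :: "real \<Rightarrow> 'a::euclidean_space"
  shows "(LINT x|lebesgue. f (x - u)) = (LINT x|lebesgue. f x)"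
  using lebesgue_integral_real_affine[of 1 f "-u"] by simp

lemma lebesgue_integrable_shift:
  fixes f :: "real \<Rightarrow> 'a::euclidean_space"
  shows "integrable lebesgue (\<lambda>x. f (x - u)) \<longleftrightarrow> integrable lebesgue f"
  using lebesgue_integrable_real_affine_iff[of 1 f "-u"] by simp

lemma lebesgue_measurable_shift:
  fixes f :: "real \<Rightarrow> 'a::topological_space"
  assumes "f \<in> borel_measurable lebesgue"
  shows "(\<lambda>x. f (x - u)) \<in> borel_measurable lebesgue"
proof -
  have "(\<lambda>x. - u + 1 * x) \<in> lebesgue \<rightarrow>\<^sub>M lebesgue"
    using lebesgue_affine_measurable[where c = "\<lambda>x::real. 1" and t = "-u"] by simp
  then show ?thesis using measurable_compose[OF _ assms, of "\<lambda>x. - u + 1 * x" lebesgue] by simp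
qed

lemma L1_shift: "f \<in> L1 \<Longrightarrow> (\<lambda>x. f (x - u)) \<in> L1"
  by (simp add: L1_def lebesgue_integrable_shift)

lemma L2_shift: "f \<in> L2 \<Longrightarrow> (\<lambda>x. f (x - u)) \<in> L2"
  by (simp add: L2_def lebesgue_measurable_shift lebesgue_integrable_shift[of "\<lambda>x. (cmod (f x))\<^sup>2"])

lemma L2_norm_shift: "L2_norm (\<lambda>x. f (x - u)) = L2_norm f"
  using lebesgue_integral_shift[of "\<lambda>x. (cmod (f x))\<^sup>2" u] by (simp add: L2_norm_def)

lemma fourier_L1_shift: "fourier_L1 (\<lambda>x. f (x - u)) t = cis (- 2 * pi * u * t) * fourier_L1 f t"
proof -
  have "fourier_L1 (\<lambda>x. f (x - u)) t
      = (LINT x|lebesgue. cis (- 2 * pi * u * t) * (cis (- 2 * pi * t * (x - u)) * f (x - u)))"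
    unfolding fourier_L1_cis
  proof (rule Bochner_Integration.integral_cong[OF refl])
    fix x
    have "cis (- 2 * pi * u * t) * cis (- 2 * pi * t * (x - u)) = cis (- 2 * pi * t * x)"
      by (simp add: cis_mult algebra_simps)
    then show "cis (- 2 * pi * t * x) * f (x - u) = cis (- 2 * pi * u * t) * (cis (- 2 * pi * t * (x - u)) * f (x - u))"
      by (metis mult.assoc)
  qed
  also have "\<dots> = cis (- 2 * pi * u * t) * (LINT x|lebesgue. cis (- 2 * pi * t * (x - u)) * f (x - u))"
    by (rule integral_mult_right_zero)
  also have "(LINT x|lebesgue. cis (- 2 * pi * t * (x - u)) * f (x - u)) = fourier_L1 f t"
    unfolding fourier_L1_cis by (rule lebesgue_integral_shift)
  finally show ?thesis .
qed

lemma fourier_L1_continuous: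
  assumes "f \<in> L1" shows "continuous_on UNIV (fourier_L1 f)"
  unfolding continuous_on_sequentially
proof (intro allI ballI impI, unfold o_def, elim conjE)
  fix X :: "nat \<Rightarrow> real" and a assume X: "X \<longlonglongrightarrow> a"
  have i: "integrable lebesgue f" using assms by (simp add: L1_def)
  show "(\<lambda>n. fourier_L1 f (X n)) \<longlonglongrightarrow> fourier_L1 f a"
    unfolding fourier_L1_cis
  proof (rule integral_dominated_convergence[where w = "\<lambda>x. cmod (f x)"])
    show "AE x in lebesgue. (\<lambda>n. cis (- 2 * pi * X n * x) * f x) \<longlonglongrightarrow> cis (- 2 * pi * a * x) * f x"
      unfolding cis_conv_exp by (intro AE_I2 tendsto_intros X)
    show "(\<lambda>x. cis (- 2 * pi * a * x) * f x) \<in> borel_measurable lebesgue"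
      "\<And>n. (\<lambda>x. cis (- 2 * pi * X n * x) * f x) \<in> borel_measurable lebesgue"
      by (rule borel_measurable_integrable, rule L1_cis_mult[OF assms])+
  qed (use i in \<open>auto simp: norm_mult\<close>)
qed

lemma Plancherel:
  assumes "f \<in> L1" "f \<in> L2"
  shows "fourier_L1 f \<in> L2" "L2_norm (fourier_L1 f) = L2_norm f"
proof -
  have f: "integrable lebesgue f" using assms by (simp add: L1_def)
  then have fm: "f \<in> borel_measurable lebesgue" by simp
  obtain h where hm [measurable]: "h \<in> borel_measurable borel" and ae: "AE x in lebesgue. f x = h x"
    using borel_representative[OF fm] .
  have hl: "h \<in> borel_measurable lebesgue" using hm by (simp add: measurable_completion)
  have "integrable lebesgue h" using integrable_cong_AE[OF fm hl ae] f by simp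
  then have h1: "integrable lborel h" by (simp add: integrable_completion)
  have "h \<in> L2" by (rule L2_cong_AE[OF assms(2) hl ae])
  then have h2: "integrable lborel (\<lambda>x. (cmod (h x))\<^sup>2)" by (simp add: L2_borel)
  have F: "fourier_L1 f = (\<lambda>t. LINT x|lborel. cis (- 2 * pi * t * x) * h x)"
  proof
    fix t
    have "fourier_L1 f t = (LINT x|lebesgue. cis (- 2 * pi * t * x) * h x)"
      unfolding fourier_L1_cis
    proof (rule integral_cong_AE)
      show "AE x in lebesgue. cis (- 2 * pi * t * x) * f x = cis (- 2 * pi * t * x) * h x"
        using ae by eventually_elim simp
    qed (intro borel_measurable_times lebesgue_cis_measurable fm hl)+
    also have "\<dots> = (LINT x|lborel. cis (- 2 * pi * t * x) * h x)"
      by (rule integral_completion) measurable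
    finally show "fourier_L1 f t = (LINT x|lborel. cis (- 2 * pi * t * x) * h x)" .
  qed
  note P = Plancherel_borel[OF hm h1 h2]
  show "fourier_L1 f \<in> L2" unfolding F using P(1,2) by (simp add: L2_borel)
  have "L2_norm (fourier_L1 f) = L2_norm h"
    unfolding F using P(1,3) by (simp add: L2_borel(2))
  also have "\<dots> = L2_norm f" using L2_norm_cong_AE[OF fm hl ae] by simp
  finally show "L2_norm (fourier_L1 f) = L2_norm f" .
qed

lemma L2_tendsto_unique:
  assumes "L2_tendsto h f F" "L2_tendsto h g F" "F \<noteq> bot"
  shows "AE x in lebesgue. f x = g x"
proof -
  have "L2_tendsto (\<lambda>i x. h i x + (-1) * h i x) (\<lambda>x. f x + (-1) * g x) F"
    by (intro L2_tendsto_add L2_tendsto_mult_bounded[where C = 1] assms) auto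
  from L2_tendsto_norm[OF this]
  have "((\<lambda>i. 0) \<longlongrightarrow> L2_norm (\<lambda>x. f x - g x)) F" by simp
  then have "L2_norm (\<lambda>x. f x - g x) = 0"
    using tendsto_unique[OF assms(3) _ tendsto_const] by metis
  moreover have "(\<lambda>x. f x - g x) \<in> L2" using assms by (auto simp: L2_tendsto_def intro: L2_diff)
  ultimately show ?thesis using L2_norm_eq_0_imp_AE by fastforce
qed

lemma has_fourier_L2_mem: "has_fourier_L2 f g \<Longrightarrow> f \<in> L2" "has_fourier_L2 f g \<Longrightarrow> g \<in> L2"
  by (auto simp: has_fourier_L2_def L2_tendsto_def)

lemma has_fourier_L2_norm:
  assumes "has_fourier_L2 f g" shows "L2_norm g = L2_norm f"
proof -
  obtain h where h: "\<And>n. h n \<in> L1 \<inter> L2" "L2_tendsto h f sequentially"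
    "L2_tendsto (\<lambda>n. fourier_L1 (h n)) g sequentially"
    using assms by (auto simp: has_fourier_L2_def)
  have "(\<lambda>n. L2_norm (h n)) \<longlonglongrightarrow> L2_norm g"
    using L2_tendsto_norm[OF h(3)] h(1) by (simp add: Plancherel(2))
  then show ?thesis using L2_tendsto_norm[OF h(2)] by (rule LIMSEQ_unique)
qed

lemma has_fourier_L2_L1:
  assumes "f \<in> L1" "f \<in> L2" shows "has_fourier_L2 f (fourier_L1 f)"
  unfolding has_fourier_L2_def
  using assms Plancherel[OF assms] by (intro exI[of _ "\<lambda>n. f"]) (auto simp: L2_tendsto_def)

text \<open>On \<open>L\<^sup>1 \<inter> L\<^sup>2\<close> the extension by continuity agrees with the integral, because Plancherel's identity
  applies to the differences \<open>h\<^sub>n - f\<close>.\<close>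

lemma has_fourier_L2_L1_unique:
  assumes "f \<in> L1" "has_fourier_L2 f g"
  shows "AE x in lebesgue. g x = fourier_L1 f x"
proof -
  have fL2: "f \<in> L2" using assms(2) by (rule has_fourier_L2_mem)
  obtain h where h: "\<And>n. h n \<in> L1 \<inter> L2" "L2_tendsto h f sequentially"
    "L2_tendsto (\<lambda>n. fourier_L1 (h n)) g sequentially"
    using assms(2) by (auto simp: has_fourier_L2_def)
  have "L2_norm (\<lambda>t. fourier_L1 (h n) t - fourier_L1 f t) = L2_norm (\<lambda>x. h n x - f x)" for n
  proof -
    have "(\<lambda>t. fourier_L1 (h n) t - fourier_L1 f t) = fourier_L1 (\<lambda>x. h n x - f x)"
      using fourier_L1_add[of "h n" "\<lambda>x. - 1 * f x"] fourier_L1_cmult[of "-1" f] h(1)[of n] assms(1)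
      by (auto simp: L1_def)
    moreover have "(\<lambda>x. h n x - f x) \<in> L1" "(\<lambda>x. h n x - f x) \<in> L2"
      using h(1)[of n] assms(1) fL2 by (auto simp: L1_def intro: L2_diff)
    ultimately show ?thesis by (simp add: Plancherel(2))
  qed
  then have "L2_tendsto (\<lambda>n. fourier_L1 (h n)) (fourier_L1 f) sequentially"
    using h(1,2) Plancherel[OF assms(1) fL2] by (auto simp: L2_tendsto_def Plancherel(1))
  then show ?thesis using L2_tendsto_unique[OF h(3)] by simp
qed

lemma has_fourier_L2_add:
  assumes "has_fourier_L2 f F" "has_fourier_L2 g G"
  shows "has_fourier_L2 (\<lambda>x. f x + g x) (\<lambda>t. F t + G t)"
proof -
  obtain h where h: "\<And>n. h n \<in> L1 \<inter> L2" "L2_tendsto h f sequentially"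
    "L2_tendsto (\<lambda>n. fourier_L1 (h n)) F sequentially"
    using assms(1) by (auto simp: has_fourier_L2_def)
  obtain k where k: "\<And>n. k n \<in> L1 \<inter> L2" "L2_tendsto k g sequentially"
    "L2_tendsto (\<lambda>n. fourier_L1 (k n)) G sequentially"
    using assms(2) by (auto simp: has_fourier_L2_def)
  have "fourier_L1 (\<lambda>x. h n x + k n x) = (\<lambda>t. fourier_L1 (h n) t + fourier_L1 (k n) t)" for n
    using h(1)[of n] k(1)[of n] by (auto simp: fourier_L1_add)
  then show ?thesis
    unfolding has_fourier_L2_def
    using L2_tendsto_add[OF h(2) k(2)] L2_tendsto_add[OF h(3) k(3)] h(1) k(1)
    by (intro exI[of _ "\<lambda>n x. h n x + k n x"]) (auto intro: L1_add L2_add)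
qed

lemma has_fourier_L2_cmult:
  assumes "has_fourier_L2 f F"
  shows "has_fourier_L2 (\<lambda>x. c * f x) (\<lambda>t. c * F t)"
proof -
  obtain h where h: "\<And>n. h n \<in> L1 \<inter> L2" "L2_tendsto h f sequentially"
    "L2_tendsto (\<lambda>n. fourier_L1 (h n)) F sequentially"
    using assms(1) by (auto simp: has_fourier_L2_def)
  have "fourier_L1 (\<lambda>x. c * h n x) = (\<lambda>t. c * fourier_L1 (h n) t)" for n
    by (auto simp: fourier_L1_cmult)
  then show ?thesis
    unfolding has_fourier_L2_def
    using L2_tendsto_mult_bounded[OF h(2), of "\<lambda>x. c" "cmod c"] L2_tendsto_mult_bounded[OF h(3), of "\<lambda>x. c" "cmod c"] h(1)
    by (intro exI[of _ "\<lambda>n x. c * h n x"]) (auto intro: L1_cmult L2_cmult)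
qed

lemma has_fourier_L2_shift:
  assumes "has_fourier_L2 f F"
  shows "has_fourier_L2 (\<lambda>x. f (x - u)) (\<lambda>t. cis (- 2 * pi * u * t) * F t)"
proof -
  obtain h where h: "\<And>n. h n \<in> L1 \<inter> L2" "L2_tendsto h f sequentially"
    "L2_tendsto (\<lambda>n. fourier_L1 (h n)) F sequentially"
    using assms(1) by (auto simp: has_fourier_L2_def)
  have e: "fourier_L1 (\<lambda>x. h n (x - u)) = (\<lambda>t. cis (- 2 * pi * u * t) * fourier_L1 (h n) t)" for n
    by (rule ext) (rule fourier_L1_shift)
  have "L2_tendsto (\<lambda>n x. h n (x - u)) (\<lambda>x. f (x - u)) sequentially"
    using h(2) L2_norm_shift[of "\<lambda>x. h _ x - f x" u]
    unfolding L2_tendsto_def by (auto intro: L2_shift elim!: eventually_mono)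
  moreover have "L2_tendsto (\<lambda>n t. cis (- 2 * pi * u * t) * fourier_L1 (h n) t) (\<lambda>t. cis (- 2 * pi * u * t) * F t) sequentially"
    by (rule L2_tendsto_mult_bounded[OF h(3) lebesgue_cis_measurable, where C = 1]) simp
  ultimately show ?thesis
    unfolding has_fourier_L2_def using h(1)
    by (intro exI[of _ "\<lambda>n x. h n (x - u)"]) (auto intro: L1_shift L2_shift simp: e)
qed

text \<open>The Fourier multiplier of the operation \<open>f \<mapsto> \<Sum>\<gamma>. c\<^sub>\<gamma> f(\<cdot> - \<gamma>)\<close>.\<close>

definition expsum :: "real set \<Rightarrow> (real \<Rightarrow> complex) \<Rightarrow> real \<Rightarrow> complex" where
  "expsum A c t = (\<Sum>\<gamma>\<in>A. c \<gamma> * cis (- 2 * pi * \<gamma> * t))"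

lemma has_fourier_L2_shifts:
  assumes "has_fourier_L2 G Ghat" "finite A"
  shows "has_fourier_L2 (\<lambda>x. \<Sum>\<gamma>\<in>A. c \<gamma> * G (x - \<gamma>)) (\<lambda>t. expsum A c t * Ghat t)"
  using assms(2)
proof (induction A rule: finite_induct)
  case empty
  have "has_fourier_L2 (\<lambda>x. 0) (\<lambda>t. 0)" using has_fourier_L2_cmult[OF assms(1), of 0] by simp
  then show ?case by (simp add: expsum_def)
next
  case (insert a A)
  then show ?case
    using has_fourier_L2_add[OF has_fourier_L2_cmult[OF has_fourier_L2_shift[OF assms(1), of a], of "c a"] insert.IH]
    by (simp add: expsum_def algebra_simps)
qed

lemma L2_norm_shifts:
  assumes "has_fourier_L2 G Ghat" "finite A"
  shows "(\<lambda>x. \<Sum>\<gamma>\<in>A. c \<gamma> * G (x - \<gamma>)) \<in> L2" "(\<lambda>t. expsum A c t * Ghat t) \<in> L2"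
    "L2_norm (\<lambda>x. \<Sum>\<gamma>\<in>A. c \<gamma> * G (x - \<gamma>)) = L2_norm (\<lambda>t. expsum A c t * Ghat t)"
  using has_fourier_L2_shifts[OF assms, of c] has_fourier_L2_mem has_fourier_L2_norm by fastforce+

section \<open>Exponential sums with separated frequencies\<close>

lemma expsum_measurable [measurable]: "expsum A c \<in> borel_measurable borel"
  unfolding expsum_def[abs_def] by measurable

lemma expsum_measurable_lebesgue: "expsum A c \<in> borel_measurable lebesgue"
  using expsum_measurable by (simp add: measurable_completion)

lemma expsum_shift: "expsum A c (t + k) = expsum A (\<lambda>\<gamma>. c \<gamma> * cis (- 2 * pi * \<gamma> * k)) t"
  unfolding expsum_def by (rule sum.cong) (simp_all add: algebra_simps cis_mult)

definition Bessel_const :: "real \<Rightarrow> real" where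
  "Bessel_const \<delta> = 4 / min \<delta> (1/6)"

lemma Bessel_const_pos: "\<delta> > 0 \<Longrightarrow> Bessel_const \<delta> > 0"
  by (simp add: Bessel_const_def)

lemma integrable_indicator_interval:
  fixes a b :: real
  shows "integrable lebesgue (indicat_real {a..<b})"
proof -
  have "bounded {a..<b}" by (rule bounded_subset[of "{a..b}"]) auto
  then have "{a..<b} \<in> lmeasurable" by (rule bounded_set_imp_lmeasurable) auto
  then show ?thesis by (simp add: lmeasurable_iff_integrable)
qed

lemma indicator_interval_mem:
  "(indicator {a..<b} :: real \<Rightarrow> complex) \<in> L1" "(indicator {a..<b} :: real \<Rightarrow> complex) \<in> L2"
proof -
  have e: "(indicator {a..<b} :: real \<Rightarrow> complex) = (\<lambda>x. of_real (indicat_real {a..<b} x))"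
    by (auto simp: indicator_def)
  show L1: "(indicator {a..<b} :: real \<Rightarrow> complex) \<in> L1"
    unfolding L1_def e using integrable_indicator_interval by simp
  have "(cmod (indicator {a..<b} x))\<^sup>2 = indicat_real {a..<b} x" for x by (auto simp: indicator_def)
  then show "(indicator {a..<b} :: real \<Rightarrow> complex) \<in> L2" using L1 integrable_indicator_interval by (auto simp: L2_def L1_def)
qed

text \<open>For \<open>x \<in> [0, \<eta>)\<close> and \<open>t \<in> [0, 1]\<close> the phase \<open>2 \<pi> t x\<close> is at most \<open>\<pi>/3\<close>, so the real part of the
  integrand is at least \<open>1/2\<close>. This is what the bound \<open>1/6\<close> is for.\<close>

lemma fourier_interval_ge:
  assumes \<eta>: "0 < \<eta>" "\<eta> \<le> 1/6" and t: "0 \<le> t" "t \<le> 1"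
  shows "\<eta> / 2 \<le> cmod (fourier_L1 (indicator {0..<\<eta>}) t)"
proof -
  have i: "integrable lebesgue (\<lambda>x. cis (- 2 * pi * t * x) * indicator {0..<\<eta>} x)"
    by (rule L1_cis_mult[OF indicator_interval_mem(1)])
  have "\<eta> / 2 = (LINT x|lebesgue. 1/2 * indicat_real {0..<\<eta>} x)"
    using \<eta> by simp
  also have "\<dots> \<le> (LINT x|lebesgue. Re (cis (- 2 * pi * t * x) * indicator {0..<\<eta>} x))"
  proof (rule integral_mono)
    show "integrable lebesgue (\<lambda>x. 1/2 * indicat_real {0..<\<eta>} x)"
      using integrable_indicator_interval by simp
    show "integrable lebesgue (\<lambda>x. Re (cis (- 2 * pi * t * x) * indicator {0..<\<eta>} x))"
      using i by (rule integrable_Re)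
    fix x
    show "1/2 * indicat_real {0..<\<eta>} x \<le> Re (cis (- 2 * pi * t * x) * indicator {0..<\<eta>} x)"
    proof (cases "x \<in> {0..<\<eta>}")
      case True
      have "t * x \<le> 1 * (1/6)" using True \<eta> t by (intro mult_mono) auto
      then have "2 * pi * t * x \<le> pi / 3" using pi_gt_zero by (simp add: field_simps)
      then have "cos (pi / 3) \<le> cos (2 * pi * t * x)"
        using True t by (intro cos_monotone_0_pi_le) auto
      then show ?thesis using True by (simp add: cos_60)
    qed simp
  qed
  also have "\<dots> = Re (fourier_L1 (indicator {0..<\<eta>}) t)"
    unfolding fourier_L1_cis by (rule integral_Re[OF i])
  also have "\<dots> \<le> cmod (fourier_L1 (indicator {0..<\<eta>}) t)" by (rule complex_Re_le_cmod)
  finally show ?thesis .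
qed

lemma L2_norm_disjoint_steps:
  assumes A: "finite A" and sep: "\<And>\<gamma> \<gamma>'. \<gamma> \<in> A \<Longrightarrow> \<gamma>' \<in> A \<Longrightarrow> \<gamma> \<noteq> \<gamma>' \<Longrightarrow> \<eta> \<le> \<bar>\<gamma> - \<gamma>'\<bar>" and \<eta>: "\<eta> > 0"
  shows "(L2_norm (\<lambda>x. \<Sum>\<gamma>\<in>A. c \<gamma> * indicator {0..<\<eta>} (x - \<gamma>)))\<^sup>2 = \<eta> * (\<Sum>\<gamma>\<in>A. (cmod (c \<gamma>))\<^sup>2)"
proof -
  have eq: "(cmod (\<Sum>\<gamma>\<in>A. c \<gamma> * indicator {0..<\<eta>} (x - \<gamma>)))\<^sup>2 = (\<Sum>\<gamma>\<in>A. (cmod (c \<gamma>))\<^sup>2 * indicat_real {\<gamma>..<\<gamma> + \<eta>} x)" for x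
  proof (cases "\<exists>a\<in>A. x \<in> {a..<a + \<eta>}")
    case True
    then obtain a where a: "a \<in> A" "x \<in> {a..<a + \<eta>}" by blast
    have o: "x \<notin> {b..<b + \<eta>}" if "b \<in> A - {a}" for b
      using sep[of a b] that a by auto
    have "(\<Sum>\<gamma>\<in>A. c \<gamma> * indicator {0..<\<eta>} (x - \<gamma>)) = c a * indicator {0..<\<eta>} (x - a) + (\<Sum>\<gamma>\<in>A - {a}. c \<gamma> * indicator {0..<\<eta>} (x - \<gamma>))"
      by (rule sum.remove[OF A a(1)])
    also have "(\<Sum>\<gamma>\<in>A - {a}. c \<gamma> * indicator {0..<\<eta>} (x - \<gamma>)) = 0"
    proof (intro sum.neutral ballI)
      fix b assume "b \<in> A - {a}"
      then have "x - b \<notin> {0..<\<eta>}" using o[of b] by auto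
      then show "c b * indicator {0..<\<eta>} (x - b) = 0" by simp
    qed
    finally have 1: "(\<Sum>\<gamma>\<in>A. c \<gamma> * indicator {0..<\<eta>} (x - \<gamma>)) = c a" using a by simp
    have "(\<Sum>\<gamma>\<in>A. (cmod (c \<gamma>))\<^sup>2 * indicat_real {\<gamma>..<\<gamma> + \<eta>} x) = (cmod (c a))\<^sup>2 * indicat_real {a..<a + \<eta>} x + (\<Sum>\<gamma>\<in>A - {a}. (cmod (c \<gamma>))\<^sup>2 * indicat_real {\<gamma>..<\<gamma> + \<eta>} x)"
      by (rule sum.remove[OF A a(1)])
    also have "(\<Sum>\<gamma>\<in>A - {a}. (cmod (c \<gamma>))\<^sup>2 * indicat_real {\<gamma>..<\<gamma> + \<eta>} x) = 0"
      using o by (intro sum.neutral) auto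
    finally show ?thesis using 1 a by simp
  next
    case False
    then have "x - \<gamma> \<notin> {0..<\<eta>}" "x \<notin> {\<gamma>..<\<gamma> + \<eta>}" if "\<gamma> \<in> A" for \<gamma>
      using that by auto
    then show ?thesis by (simp add: sum.neutral)
  qed
  show ?thesis
    unfolding L2_norm_sq eq using \<eta> by (simp add: sum_distrib_left mult.commute)
qed

text \<open>Translates of the step \<open>1\<^sub>[\<^sub>0\<^sub>,\<^sub>\<eta>\<^sub>)\<close> by the points of \<open>A\<close> are disjoint if \<open>\<eta> \<le> \<delta>\<close>, so the combination of
  them with coefficients \<open>c\<close> has squared norm \<open>\<eta> \<Sum>|c\<^sub>\<gamma>|\<^sup>2\<close>. Its Fourier transform is the exponential
  sum times the transform of one step, whose modulus is at least \<open>\<eta>/2\<close> on \<open>[0, 1]\<close>. Another unit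
  interval is reached by modulating the coefficients.\<close>

lemma Bessel_unit_interval:
  assumes A: "finite A" and sep: "\<And>\<gamma> \<gamma>'. \<gamma> \<in> A \<Longrightarrow> \<gamma>' \<in> A \<Longrightarrow> \<gamma> \<noteq> \<gamma>' \<Longrightarrow> \<delta> \<le> \<bar>\<gamma> - \<gamma>'\<bar>" and \<delta>: "\<delta> > 0"
  shows "(\<integral>\<^sup>+t. indicator {k..<k+1} t * ennreal ((cmod (expsum A c t))\<^sup>2) \<partial>lebesgue)
    \<le> ennreal (Bessel_const \<delta> * (\<Sum>\<gamma>\<in>A. (cmod (c \<gamma>))\<^sup>2))"
proof -
  define \<eta> where "\<eta> = min \<delta> (1/6)"
  have \<eta>: "\<eta> > 0" "\<eta> \<le> 1/6" "\<eta> \<le> \<delta>" using \<delta> by (auto simp: \<eta>_def)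
  define \<phi> where "\<phi> = (indicator {0..<\<eta>} :: real \<Rightarrow> complex)"
  define c' where "c' = (\<lambda>\<gamma>. c \<gamma> * cis (- 2 * pi * \<gamma> * k))"
  define C where "C = (\<Sum>\<gamma>\<in>A. (cmod (c \<gamma>))\<^sup>2)"
  have \<phi>1: "\<phi> \<in> L1" and \<phi>2: "\<phi> \<in> L2" unfolding \<phi>_def by (rule indicator_interval_mem)+
  have W: "has_fourier_L2 \<phi> (fourier_L1 \<phi>)" by (rule has_fourier_L2_L1[OF \<phi>1 \<phi>2])
  have mem: "(\<lambda>t. expsum A c' t * fourier_L1 \<phi> t) \<in> L2" by (rule L2_norm_shifts(2)[OF W A])
  have "(L2_norm (\<lambda>t. expsum A c' t * fourier_L1 \<phi> t))\<^sup>2 = (L2_norm (\<lambda>x. \<Sum>\<gamma>\<in>A. c' \<gamma> * \<phi> (x - \<gamma>)))\<^sup>2"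
    using L2_norm_shifts(3)[OF W A] by simp
  also have "\<dots> = \<eta> * (\<Sum>\<gamma>\<in>A. (cmod (c' \<gamma>))\<^sup>2)"
    unfolding \<phi>_def
  proof (rule L2_norm_disjoint_steps[OF A _ \<eta>(1)])
    fix \<gamma> \<gamma>' assume "\<gamma> \<in> A" "\<gamma>' \<in> A" "\<gamma> \<noteq> \<gamma>'"
    then show "\<eta> \<le> \<bar>\<gamma> - \<gamma>'\<bar>" using sep \<eta>(3) by fastforce
  qed
  also have "\<dots> = \<eta> * C" by (simp add: c'_def C_def norm_mult)
  finally have norm: "(L2_norm (\<lambda>t. expsum A c' t * fourier_L1 \<phi> t))\<^sup>2 = \<eta> * C" .
  have "(\<integral>\<^sup>+t. indicator {k..<k+1} t * ennreal ((cmod (expsum A c t))\<^sup>2) \<partial>lebesgue)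
      = (\<integral>\<^sup>+t. indicator {k..<k+1} t * ennreal ((cmod (expsum A c t))\<^sup>2) \<partial>lborel)"
    by (rule nn_integral_completion)
  also have "\<dots> = (\<integral>\<^sup>+t. indicator {k..<k+1} (k + 1 * t) * ennreal ((cmod (expsum A c (k + 1 * t)))\<^sup>2) \<partial>lborel)"
    by (subst nn_integral_real_affine[where c = 1 and t = k]) auto
  also have "\<dots> = (\<integral>\<^sup>+t. indicator {0..<1} t * ennreal ((cmod (expsum A c' t))\<^sup>2) \<partial>lborel)"
    by (rule nn_integral_cong) (use expsum_shift[of A c _ k] in \<open>auto simp: indicator_def c'_def add.commute\<close>)
  also have "\<dots> = (\<integral>\<^sup>+t. indicator {0..<1} t * ennreal ((cmod (expsum A c' t))\<^sup>2) \<partial>lebesgue)"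
    by (rule nn_integral_completion[symmetric])
  also have "\<dots> \<le> (\<integral>\<^sup>+t. ennreal (4 / \<eta>\<^sup>2 * (cmod (expsum A c' t * fourier_L1 \<phi> t))\<^sup>2) \<partial>lebesgue)"
  proof (rule nn_integral_mono)
    fix t
    show "indicator {0..<1} t * ennreal ((cmod (expsum A c' t))\<^sup>2) \<le> ennreal (4 / \<eta>\<^sup>2 * (cmod (expsum A c' t * fourier_L1 \<phi> t))\<^sup>2)"
    proof (cases "t \<in> {0..<1}")
      case True
      have "(\<eta> / 2)\<^sup>2 \<le> (cmod (fourier_L1 \<phi> t))\<^sup>2"
        using fourier_interval_ge[OF \<eta>(1,2), of t] True \<eta> by (intro power_mono) (auto simp: \<phi>_def)
      then have "4 / \<eta>\<^sup>2 * (cmod (fourier_L1 \<phi> t))\<^sup>2 \<ge> 4 / \<eta>\<^sup>2 * (\<eta> / 2)\<^sup>2"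
        by (intro mult_left_mono) auto
      then have "1 \<le> 4 / \<eta>\<^sup>2 * (cmod (fourier_L1 \<phi> t))\<^sup>2" using \<eta> by (simp add: power_divide)
      then have "1 * (cmod (expsum A c' t))\<^sup>2 \<le> (4 / \<eta>\<^sup>2 * (cmod (fourier_L1 \<phi> t))\<^sup>2) * (cmod (expsum A c' t))\<^sup>2"
        by (intro mult_right_mono) auto
      then have "(cmod (expsum A c' t))\<^sup>2 \<le> 4 / \<eta>\<^sup>2 * (cmod (expsum A c' t * fourier_L1 \<phi> t))\<^sup>2"
        by (simp add: norm_mult power_mult_distrib mult_ac)
      then show ?thesis using True by (simp add: ennreal_leI)
    qed simp
  qed
  also have "\<dots> = ennreal (LINT t|lebesgue. 4 / \<eta>\<^sup>2 * (cmod (expsum A c' t * fourier_L1 \<phi> t))\<^sup>2)"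
    by (rule nn_integral_eq_integral) (use mem in \<open>auto simp: L2_def\<close>)
  also have "(LINT t|lebesgue. 4 / \<eta>\<^sup>2 * (cmod (expsum A c' t * fourier_L1 \<phi> t))\<^sup>2) = 4 / \<eta>\<^sup>2 * (\<eta> * C)"
    unfolding norm[symmetric] L2_norm_sq by (rule integral_mult_right_zero)
  also have "4 / \<eta>\<^sup>2 * (\<eta> * C) = Bessel_const \<delta> * C"
    using \<eta> by (simp add: Bessel_const_def \<eta>_def[symmetric] power2_eq_square)
  finally show ?thesis by (simp add: C_def)
qed

text \<open>The line is split into unit intervals. On each of them the weight is at most its local bound, and the
  Bessel inequality holds with the same constant. The intervals are enumerated by \<open>int_decode\<close>, so
  that the local bounds form a sequence.\<close>

lemma Bessel_weighted:
  assumes A: "finite A" and sep: "\<And>\<gamma> \<gamma>'. \<gamma> \<in> A \<Longrightarrow> \<gamma>' \<in> A \<Longrightarrow> \<gamma> \<noteq> \<gamma>' \<Longrightarrow> \<delta> \<le> \<bar>\<gamma> - \<gamma>'\<bar>" and \<delta>: "\<delta> > 0"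
    and a: "\<And>n. a n \<ge> 0" "summable a" and v: "AE t in lebesgue. v t \<le> a (int_encode \<lfloor>t\<rfloor>)"
  shows "(\<integral>\<^sup>+t. ennreal (v t * (cmod (expsum A c t))\<^sup>2) \<partial>lebesgue)
    \<le> ennreal (Bessel_const \<delta> * (\<Sum>\<gamma>\<in>A. (cmod (c \<gamma>))\<^sup>2) * suminf a)"
proof -
  note [measurable] = expsum_measurable_lebesgue
  define I where "I n = {of_int (int_decode n)..<of_int (int_decode n) + 1 :: real}" for n
  define D where "D = Bessel_const \<delta> * (\<Sum>\<gamma>\<in>A. (cmod (c \<gamma>))\<^sup>2)"
  have D: "D \<ge> 0" using Bessel_const_pos[OF \<delta>] by (simp add: D_def sum_nonneg)
  have [measurable]: "I n \<in> sets lebesgue" for n by (simp add: I_def)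
  have "(\<integral>\<^sup>+t. ennreal (v t * (cmod (expsum A c t))\<^sup>2) \<partial>lebesgue)
     \<le> (\<integral>\<^sup>+t. (\<Sum>n. ennreal (a n) * (indicator (I n) t * ennreal ((cmod (expsum A c t))\<^sup>2))) \<partial>lebesgue)"
  proof (rule nn_integral_mono_AE)
    show "AE t in lebesgue. ennreal (v t * (cmod (expsum A c t))\<^sup>2)
        \<le> (\<Sum>n. ennreal (a n) * (indicator (I n) t * ennreal ((cmod (expsum A c t))\<^sup>2)))"
      using v
    proof eventually_elim
      case (elim t)
      define n where "n = int_encode \<lfloor>t\<rfloor>"
      have t: "t \<in> I n" by (auto simp: I_def n_def)
      have "ennreal (v t * (cmod (expsum A c t))\<^sup>2) \<le> ennreal (a n * (cmod (expsum A c t))\<^sup>2)"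
        using elim by (intro ennreal_leI mult_right_mono) (auto simp: n_def)
      also have "\<dots> = (\<Sum>n\<in>{n}. ennreal (a n) * (indicator (I n) t * ennreal ((cmod (expsum A c t))\<^sup>2)))"
        using t a by (simp add: ennreal_mult)
      also have "\<dots> \<le> (\<Sum>n. ennreal (a n) * (indicator (I n) t * ennreal ((cmod (expsum A c t))\<^sup>2)))"
        by (rule sum_le_suminf) auto
      finally show ?case .
    qed
  qed
  also have "\<dots> = (\<Sum>n. \<integral>\<^sup>+t. ennreal (a n) * (indicator (I n) t * ennreal ((cmod (expsum A c t))\<^sup>2)) \<partial>lebesgue)"
    by (rule nn_integral_suminf) measurable
  also have "\<dots> = (\<Sum>n. ennreal (a n) * (\<integral>\<^sup>+t. indicator (I n) t * ennreal ((cmod (expsum A c t))\<^sup>2) \<partial>lebesgue))"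
    by (intro suminf_cong nn_integral_cmult) measurable
  also have "\<dots> \<le> (\<Sum>n. ennreal (a n) * ennreal D)"
    unfolding I_def D_def
    by (intro suminf_le mult_left_mono summableI Bessel_unit_interval A sep \<delta>) auto
  also have "\<dots> = (\<Sum>n. ennreal (a n * D))" using a D by (simp add: ennreal_mult)
  also have "\<dots> = ennreal (\<Sum>n. a n * D)"
    by (rule suminf_ennreal2) (use a D in \<open>auto intro: summable_mult2\<close>)
  also have "(\<Sum>n. a n * D) = D * suminf a" using a by (simp add: suminf_mult2[symmetric])
  finally show ?thesis by (simp add: D_def)
qed

text \<open>The amalgam norm is seen through the sequence of its local suprema; the integers, which belong to none
  of the open unit intervals, form a null set.\<close>

lemma wiener_amalgam_majorant:
  assumes "f \<in> wiener_amalgam"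
  obtains a where "\<And>n. a n \<ge> 0" "summable a" "AE t in lebesgue. cmod (f t) \<le> a (int_encode \<lfloor>t\<rfloor>)"
proof -
  define e where "e k = esssup (restrict_space lebesgue {of_int k<..<of_int k + 1}) (\<lambda>x. ennreal (cmod (f x)))" for k :: int
  have fin: "(\<Sum>\<^sub>\<infinity>k\<in>UNIV. e k) < \<infinity>"
    using assms by (simp add: wiener_amalgam_def amalgam_norm_def e_def)
  define b where "b n = e (int_decode n)" for n
  have "(\<Sum>\<^sub>\<infinity>n\<in>UNIV. b n) = (\<Sum>\<^sub>\<infinity>k\<in>UNIV. e k)"
    unfolding b_def using infsum_reindex_bij_betw[OF bij_int_decode, of e] by simp
  moreover have "(b has_sum (\<Sum>\<^sub>\<infinity>n\<in>UNIV. b n)) UNIV"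
    by (intro has_sum_infsum nonneg_summable_on_complete) auto
  ultimately have "suminf b = (\<Sum>\<^sub>\<infinity>k\<in>UNIV. e k)"
    using has_sum_imp_sums sums_unique by metis
  then have bfin: "suminf b \<noteq> top" using fin by auto
  have bn: "b n \<noteq> top" for n
  proof -
    have "b n \<le> suminf b" using sum_le_suminf[of b "{n}"] by simp
    then show ?thesis using bfin by (auto simp: top_unique)
  qed
  define a where "a n = enn2real (b n)" for n
  have ab: "ennreal (a n) = b n" for n using bn[of n] by (simp add: a_def less_top)
  have sum: "summable a"
    by (rule summable_suminf_not_top) (use bfin ab in \<open>auto simp: a_def\<close>)
  have k: "AE t in lebesgue. t \<in> {of_int k<..<of_int k + 1} \<longrightarrow> ennreal (cmod (f t)) \<le> e k" for k
    using esssup_AE[of "\<lambda>x. ennreal (cmod (f x))" "restrict_space lebesgue {of_int k<..<of_int k + 1}"]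
    by (subst (asm) AE_restrict_space_iff) (auto simp: e_def)
  then have "AE t in lebesgue. \<forall>k. t \<in> {of_int k<..<of_int k + 1} \<longrightarrow> ennreal (cmod (f t)) \<le> e k"
    by (simp add: AE_all_countable)
  moreover have "AE t in lebesgue. t \<notin> range (of_int :: int \<Rightarrow> real)"
  proof (rule AE_completion, rule AE_not_in)
    show "range (of_int :: int \<Rightarrow> real) \<in> null_sets lborel"
      by (rule countable_imp_null_set_lborel) auto
  qed
  ultimately have "AE t in lebesgue. cmod (f t) \<le> a (int_encode \<lfloor>t\<rfloor>)"
  proof eventually_elim
    case (elim t)
    have "of_int \<lfloor>t\<rfloor> < t"
      using elim(2) of_int_floor_le[of t] by (metis order_le_less rangeI)
    then have "ennreal (cmod (f t)) \<le> e \<lfloor>t\<rfloor>" using elim(1) by auto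
    also have "\<dots> = ennreal (a (int_encode \<lfloor>t\<rfloor>))" unfolding ab by (simp add: b_def)
    finally show ?case by (simp add: a_def)
  qed
  then show ?thesis using that[of a] sum by (auto simp: a_def)
qed

text \<open>A tail of the series is small uniformly in \<open>r\<close>, and the finitely many other terms are at most
  \<open>r\<^sup>2\<close> each.\<close>

lemma suminf_min_small:
  fixes a :: "nat \<Rightarrow> real"
  assumes a: "\<And>n. a n \<ge> 0" "summable a" and "\<epsilon> > 0"
  obtains r where "r > 0" "summable (\<lambda>n. min (a n) (r\<^sup>2))" "(\<Sum>n. min (a n) (r\<^sup>2)) < \<epsilon>"
proof -
  obtain N where N: "(\<Sum>n. a (n + N)) < \<epsilon> / 2"
  proof -
    have "\<exists>N. \<forall>n\<ge>N. norm (\<Sum>i. a (i + n)) < \<epsilon> / 2"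
      using suminf_exist_split[OF _ a(2), of "\<epsilon> / 2"] assms(3) by simp
    then obtain N where "norm (\<Sum>i. a (i + N)) < \<epsilon> / 2" by blast
    then show ?thesis using that[of N] by simp
  qed
  define r where "r = sqrt (\<epsilon> / (2 * (real N + 1)))"
  have r: "r > 0" "r\<^sup>2 = \<epsilon> / (2 * (real N + 1))" using assms(3) by (auto simp: r_def)
  have s: "summable (\<lambda>n. min (a n) (r\<^sup>2))"
    by (rule summable_comparison_test'[OF a(2), of 0]) (use a in auto)
  have "(\<Sum>n. min (a n) (r\<^sup>2)) = (\<Sum>n. min (a (n + N)) (r\<^sup>2)) + (\<Sum>n<N. min (a n) (r\<^sup>2))"
    by (rule suminf_split_initial_segment[OF s])
  also have "\<dots> \<le> (\<Sum>n. a (n + N)) + (\<Sum>n<N. r\<^sup>2)"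
    using s a by (intro add_mono suminf_le sum_mono) (auto simp: summable_iff_shift[of "\<lambda>n. min (a n) (r\<^sup>2)"] summable_iff_shift)
  also have "(\<Sum>n<N. r\<^sup>2) \<le> \<epsilon> / 2" using assms(3) by (simp add: r field_simps)
  finally have "(\<Sum>n. min (a n) (r\<^sup>2)) < \<epsilon>" using N by simp
  then show ?thesis using that r(1) s by blast
qed

section \<open>Moment problems and lower bounds\<close>

lemma L2_norm_add_scaled_sq:
  assumes f: "f \<in> L2" and g: "g \<in> L2"
  shows "(L2_norm (\<lambda>x. f x + k * g x))\<^sup>2
    = (L2_norm f)\<^sup>2 + 2 * Re (cnj k * (LINT x|lebesgue. f x * cnj (g x))) + (cmod k)\<^sup>2 * (L2_norm g)\<^sup>2"
proof -
  have g': "(\<lambda>x. cnj (g x)) \<in> L2"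
    by (rule L2_mono(1)[OF g, where C = 1])
      (use g in \<open>auto simp: L2_def intro: measurable_compose[OF _ borel_measurable_cnj]\<close>)
  have fg: "integrable lebesgue (\<lambda>x. f x * cnj (g x))" by (rule L2_mult_integrable[OF f g'])
  then have kfg: "integrable lebesgue (\<lambda>x. cnj k * (f x * cnj (g x)))" by simp
  have sq: "(cmod (f x + k * g x))\<^sup>2
      = (cmod (f x))\<^sup>2 + 2 * Re (cnj k * (f x * cnj (g x))) + (cmod k)\<^sup>2 * (cmod (g x))\<^sup>2" for x
    unfolding cmod_power2 by (simp add: algebra_simps power2_eq_square)
  define u where "u x = Re (cnj k * (f x * cnj (g x)))" for x
  have i: "integrable lebesgue (\<lambda>x. (cmod (f x))\<^sup>2)" "integrable lebesgue (\<lambda>x. (cmod (g x))\<^sup>2)"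
    "integrable lebesgue u"
    using f g integrable_Re[OF kfg] by (auto simp: L2_def u_def[abs_def])
  have "(L2_norm (\<lambda>x. f x + k * g x))\<^sup>2 = (LINT x|lebesgue. (cmod (f x))\<^sup>2)
      + 2 * (LINT x|lebesgue. u x) + (cmod k)\<^sup>2 * (LINT x|lebesgue. (cmod (g x))\<^sup>2)"
    unfolding L2_norm_sq sq u_def[symmetric] using i by simp
  also have "(LINT x|lebesgue. u x) = Re (cnj k * (LINT x|lebesgue. f x * cnj (g x)))"
    unfolding u_def by (subst integral_Re[OF kfg]) simp
  finally show ?thesis by (simp add: L2_norm_sq)
qed

text \<open>A functional on a subspace of \<open>L\<^sup>2\<close> that is bounded by the norm is represented by a function. The subspace
  is given as the range of a map \<open>T\<close> on an arbitrary index set \<open>V\<close>, with the functional \<open>L\<close>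
  defined on the indices; linearity is the hypothesis that \<open>(T, L)\<close> has an image closed under
  \<open>(x, y) \<mapsto> x + k y\<close>. By the parallelogram law a minimising sequence of
  \<open>J a = \<parallel>T a\<parallel>\<^sup>2 - 2 Re (L a)\<close> has convergent images, and the first variation of \<open>J\<close> vanishes at the
  limit.\<close>

lemma Riesz_representation_on_range:
  fixes T :: "'i \<Rightarrow> real \<Rightarrow> complex" and L :: "'i \<Rightarrow> complex"
  assumes "V \<noteq> {}"
    and T: "\<And>a. a \<in> V \<Longrightarrow> T a \<in> L2"
    and lin: "\<And>a b k. a \<in> V \<Longrightarrow> b \<in> V \<Longrightarrow> \<exists>c\<in>V. T c = (\<lambda>t. T a t + k * T b t) \<and> L c = L a + k * L b"
    and bound: "\<And>a. a \<in> V \<Longrightarrow> cmod (L a) \<le> M * L2_norm (T a)"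
  shows "\<exists>g\<in>L2. \<forall>a\<in>V. (LINT t|lebesgue. T a t * g t) = L a"
proof -
  define J where "J a = (L2_norm (T a))\<^sup>2 - 2 * Re (L a)" for a
  have J_ge: "J a \<ge> - M\<^sup>2" if "a \<in> V" for a
  proof -
    have "Re (L a) \<le> M * L2_norm (T a)" using bound[OF that] complex_Re_le_cmod[of "L a"] by linarith
    moreover have "(L2_norm (T a) - M)\<^sup>2 \<ge> 0" by simp
    ultimately show ?thesis by (simp add: J_def power2_diff mult.commute[of M])
  qed
  define m where "m = Inf (J ` V)"
  have bdd: "bdd_below (J ` V)" using J_ge by (intro bdd_belowI2)
  have m_le: "m \<le> J a" if "a \<in> V" for a
    unfolding m_def using that bdd by (intro cInf_lower) auto
  have "\<exists>a\<in>V. J a < m + 1 / real (Suc n)" for n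
  proof -
    have "Inf (J ` V) < m + 1 / real (Suc n)" by (simp add: m_def)
    then show ?thesis using cInf_lessD[of "J ` V"] \<open>V \<noteq> {}\<close> by blast
  qed
  then obtain a where a: "\<And>n. a n \<in> V" "\<And>n. J (a n) < m + 1 / real (Suc n)" by metis
  have inv0: "(\<lambda>n. 1 / real (Suc n)) \<longlonglongrightarrow> 0"
    using LIMSEQ_inverse_real_of_nat by (simp add: inverse_eq_divide)
  have Jlim: "(\<lambda>n. J (a n)) \<longlonglongrightarrow> m"
  proof (rule real_tendsto_sandwich)
    show "(\<lambda>n. m) \<longlonglongrightarrow> m" by simp
    show "(\<lambda>n. m + 1 / real (Suc n)) \<longlonglongrightarrow> m" using tendsto_add[OF tendsto_const inv0, of m] by simp
  qed (use a m_le in \<open>auto intro!: always_eventually less_imp_le\<close>)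
  have para: "(L2_norm (\<lambda>t. T x t - T y t))\<^sup>2 \<le> 2 * (J x - m) + 2 * (J y - m)" if x: "x \<in> V" and y: "y \<in> V" for x y
  proof -
    (* c is the midpoint of x and y, reached in two steps through d = y - x. *)
    obtain d where d: "d \<in> V" "T d = (\<lambda>t. T y t + (-1) * T x t)" "L d = L y + (-1) * L x"
      using lin[OF y x, of "-1"] by blast
    obtain c where c: "c \<in> V" "T c = (\<lambda>t. T x t + (1/2) * T d t)" "L c = L x + (1/2) * L d"
      using lin[OF x d(1), of "1/2"] by blast
    have cL: "2 * Re (L c) = Re (L x) + Re (L y)" by (simp add: c d field_simps)
    have ex: "2 * T c t = T x t + 1 * T y t" for t by (simp add: c d algebra_simps)
    have "4 * (L2_norm (T c))\<^sup>2 = (L2_norm (\<lambda>t. T x t + 1 * T y t))\<^sup>2"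
      using L2_norm_cmult[of 2 "T c"] unfolding ex by (simp add: power_mult_distrib)
    also have "\<dots> = 2 * (L2_norm (T x))\<^sup>2 + 2 * (L2_norm (T y))\<^sup>2 - (L2_norm (\<lambda>t. T x t + (-1) * T y t))\<^sup>2"
      unfolding L2_norm_add_scaled_sq[OF T[OF x] T[OF y]] by simp
    finally have "(L2_norm (\<lambda>t. T x t - T y t))\<^sup>2 = 2 * J x + 2 * J y - 4 * J c"
      using cL by (simp add: J_def)
    then show ?thesis using m_le[OF c(1)] by simp
  qed
  have "\<exists>f. L2_tendsto (\<lambda>n. T (a n)) f sequentially"
  proof (rule L2_Cauchy_converges[where e = "\<lambda>n. sqrt (4 * (1 / real (Suc n)))"])
    have "(\<lambda>n. sqrt (4 * (1 / real (Suc n)))) \<longlonglongrightarrow> sqrt (4 * 0)" by (intro tendsto_intros inv0)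
    then show "(\<lambda>n. sqrt (4 * (1 / real (Suc n)))) \<longlonglongrightarrow> 0" by simp
    fix p n :: nat assume "n \<le> p"
    have "1 / real (Suc p) \<le> 1 / real (Suc n)" using \<open>n \<le> p\<close> by (simp add: field_simps)
    then have "J (a p) \<le> m + 1 / real (Suc n)" "J (a n) \<le> m + 1 / real (Suc n)"
      using a(2)[of p] a(2)[of n] by linarith+
    then have "2 * (J (a p) - m) + 2 * (J (a n) - m) \<le> 4 * (1 / real (Suc n))" by argo
    then have "(L2_norm (\<lambda>t. T (a p) t - T (a n) t))\<^sup>2 \<le> 4 * (1 / real (Suc n))"
      by (rule order_trans[OF para[OF a(1) a(1)]])
    then show "L2_norm (\<lambda>t. T (a p) t - T (a n) t) \<le> sqrt (4 * (1 / real (Suc n)))"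
      by (rule real_le_rsqrt)
  qed (use T a in auto)
  then obtain f where f: "L2_tendsto (\<lambda>n. T (a n)) f sequentially" by blast
  have fL2: "f \<in> L2" using f by (simp add: L2_tendsto_def)
  have cnjL2: "(\<lambda>x. cnj (h x)) \<in> L2" if "h \<in> L2" for h
    by (rule L2_mono(1)[OF that, where C = 1])
      (use that in \<open>auto simp: L2_def intro: measurable_compose[OF _ borel_measurable_cnj]\<close>)
  have "(LINT t|lebesgue. T b t * cnj (f t)) = L b" if b: "b \<in> V" for b
  proof -
    define B where "B = (L2_norm (T b))\<^sup>2"
    define q where "q = (LINT t|lebesgue. f t * cnj (T b t))"
    have q: "(\<lambda>n. LINT t|lebesgue. T (a n) t * cnj (T b t)) \<longlonglongrightarrow> q"
      unfolding q_def by (rule L2_tendsto_integral[OF f cnjL2[OF T[OF b]]])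
    have key: "0 \<le> 2 * Re (cnj k * q - k * L b) + (cmod k)\<^sup>2 * B" for k
    proof -
      have "m \<le> J (a n) + 2 * Re (cnj k * (LINT t|lebesgue. T (a n) t * cnj (T b t)) - k * L b) + (cmod k)\<^sup>2 * B" for n
      proof -
        obtain c where c: "c \<in> V" "T c = (\<lambda>t. T (a n) t + k * T b t)" "L c = L (a n) + k * L b"
          using lin[OF a(1) b, of n k] by blast
        show ?thesis using m_le[OF c(1)] unfolding J_def c(2,3) L2_norm_add_scaled_sq[OF T[OF a(1)] T[OF b]]
          by (simp add: B_def algebra_simps)
      qed
      moreover have "(\<lambda>n. J (a n) + 2 * Re (cnj k * (LINT t|lebesgue. T (a n) t * cnj (T b t)) - k * L b) + (cmod k)\<^sup>2 * B)
         \<longlonglongrightarrow> m + 2 * Re (cnj k * q - k * L b) + (cmod k)\<^sup>2 * B"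
        by (intro tendsto_intros Jlim q)
      ultimately have "m \<le> m + 2 * Re (cnj k * q - k * L b) + (cmod k)\<^sup>2 * B"
        by (intro LIMSEQ_le_const) auto
      then show ?thesis by simp
    qed
    define w where "w = q - cnj (L b)"
    have B: "B \<ge> 0" by (simp add: B_def)
    (* The direction - s w would lower the infimum of J unless w = 0: it changes J by at most
       s |w|^2 (s B - 2) in the limit, and s B < 1. *)
    define s where "s = 1 / (B + 1)"
    have s: "s > 0" "s * B < 1" using B by (auto simp: s_def field_simps)
    have Rek: "Re (cnj k * q - k * L b) = Re (cnj k * w)" for k
      by (simp add: w_def algebra_simps)
    have "0 \<le> 2 * Re (cnj (- of_real s * w) * w) + (cmod (- of_real s * w))\<^sup>2 * B"
      using key[of "- of_real s * w"] unfolding Rek .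
    also have "Re (cnj (- of_real s * w) * w) = - s * (cmod w)\<^sup>2"
      unfolding cmod_power2 by (simp add: algebra_simps power2_eq_square)
    also have "(cmod (- of_real s * w))\<^sup>2 = s\<^sup>2 * (cmod w)\<^sup>2"
      by (simp add: norm_mult power_mult_distrib)
    finally have "0 \<le> (s * (cmod w)\<^sup>2) * (s * B - 2)"
      by (simp add: algebra_simps power2_eq_square)
    then have "s * (cmod w)\<^sup>2 \<le> 0" using s(2) by (simp add: zero_le_mult_iff)
    then have "w = 0" using s(1) by (simp add: mult_le_0_iff)
    then have "L b = cnj q" by (simp add: w_def)
    also have "\<dots> = (LINT t|lebesgue. T b t * cnj (f t))"
      unfolding q_def by (subst Bochner_Integration.integral_cnj[symmetric]) (simp add: mult.commute)
    finally show ?thesis by simp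
  qed
  then show ?thesis by (intro bexI[OF _ cnjL2[OF fL2]] ballI)
qed

lemma indicator_mult_L2:
  assumes "S \<in> sets lebesgue" "f \<in> L2"
  shows "(\<lambda>t. indicator S t * f t) \<in> L2"
  by (rule L2_mult_bounded(1)[OF assms(2), where C = 1]) (use assms(1) in \<open>auto simp: indicator_def\<close>)

lemma indicator_L2:
  assumes "S \<in> lmeasurable" shows "(indicator S :: real \<Rightarrow> complex) \<in> L2"
proof -
  have "(cmod (indicator S x))\<^sup>2 = indicat_real S x" for x by (auto simp: indicator_def)
  then show ?thesis using assms
    by (auto simp: L2_def lmeasurable_iff_integrable fmeasurableD intro!: borel_measurable_indicator)
qed

lemma expsum_norm_le: "cmod (expsum A c t) \<le> (\<Sum>\<gamma>\<in>A. cmod (c \<gamma>))"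
proof -
  have "cmod (expsum A c t) \<le> (\<Sum>\<gamma>\<in>A. cmod (c \<gamma> * cis (- 2 * pi * \<gamma> * t)))"
    unfolding expsum_def by (rule norm_sum)
  then show ?thesis by (simp add: norm_mult)
qed

lemma indicator_expsum_L2:
  assumes "S \<in> lmeasurable" shows "(\<lambda>t. indicator S t * expsum A c t) \<in> L2"
  using L2_mult_bounded(1)[OF indicator_L2[OF assms] expsum_measurable_lebesgue expsum_norm_le]
  by (simp add: mult.commute)

lemma sum_le_l2_norm_on:
  assumes "c \<in> l2_on \<Gamma>" "finite A" "A \<subseteq> \<Gamma>"
  shows "L2_set (\<lambda>\<gamma>. cmod (c \<gamma>)) A \<le> l2_norm_on \<Gamma> c"
  unfolding L2_set_def l2_norm_on_def
  using assms by (intro real_sqrt_le_mono finite_sum_le_infsum) (auto simp: l2_on_def)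

text \<open>The prescribed values define the functional \<open>E\<^sub>a 1\<^sub>S \<mapsto> \<Sum> a\<^sub>\<gamma> c\<^sub>\<gamma>\<close>, which by the lower bound is controlled by
  the norm of \<open>E\<^sub>a 1\<^sub>S\<close>.\<close>

lemma moments_of_lower_bound:
  assumes S: "S \<in> lmeasurable" and K: "K > 0"
    and lower: "\<And>A a. finite A \<Longrightarrow> A \<subseteq> \<Gamma> \<Longrightarrow>
        K * L2_set (\<lambda>\<gamma>. cmod (a \<gamma>)) A \<le> L2_norm (\<lambda>t. indicator S t * expsum A a t)"
    and c: "c \<in> l2_on \<Gamma>"
  shows "\<exists>g\<in>L2. (\<forall>t. t \<notin> S \<longrightarrow> g t = 0) \<and> (\<forall>\<gamma>\<in>\<Gamma>. (LINT t|lebesgue. cis (- 2 * pi * \<gamma> * t) * g t) = c \<gamma>)"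
proof -
  define V where "V = {(A, a :: real \<Rightarrow> complex). finite A \<and> A \<subseteq> \<Gamma>}"
  define T where "T = (\<lambda>(A, a) t. indicator S t * expsum A a t)"
  define L where "L = (\<lambda>(A, a). \<Sum>\<gamma>\<in>A. a \<gamma> * c \<gamma>)"
  have "\<exists>g\<in>L2. \<forall>x\<in>V. (LINT t|lebesgue. T x t * g t) = L x"
  proof (rule Riesz_representation_on_range[where M = "l2_norm_on \<Gamma> c / K"])
    show "V \<noteq> {}" by (auto simp: V_def)
    show "T x \<in> L2" if "x \<in> V" for x
      using indicator_expsum_L2[OF S] by (auto simp: T_def split: prod.split)
    show "cmod (L x) \<le> l2_norm_on \<Gamma> c / K * L2_norm (T x)" if "x \<in> V" for x
    proof -
      obtain A a where x: "x = (A, a)" "finite A" "A \<subseteq> \<Gamma>" using \<open>x \<in> V\<close> by (auto simp: V_def)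
      have "cmod (L x) \<le> (\<Sum>\<gamma>\<in>A. \<bar>cmod (a \<gamma>)\<bar> * \<bar>cmod (c \<gamma>)\<bar>)"
        unfolding L_def x by (simp add: norm_mult[symmetric] norm_sum)
      also have "\<dots> \<le> L2_set (\<lambda>\<gamma>. cmod (a \<gamma>)) A * L2_set (\<lambda>\<gamma>. cmod (c \<gamma>)) A"
        by (rule L2_set_mult_ineq)
      also have "\<dots> \<le> (L2_norm (T x) / K) * l2_norm_on \<Gamma> c"
        using lower[OF x(2,3), of a] K sum_le_l2_norm_on[OF c x(2,3)]
        by (intro mult_mono) (auto simp: T_def x field_simps)
      finally show ?thesis by (simp add: mult.commute)
    qed
    show "\<exists>z\<in>V. T z = (\<lambda>t. T x t + k * T y t) \<and> L z = L x + k * L y" if xy: "x \<in> V" "y \<in> V" for x y k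
    proof -
      obtain A a where x: "x = (A, a)" "finite A" "A \<subseteq> \<Gamma>" using \<open>x \<in> V\<close> by (auto simp: V_def)
      obtain B b where y: "y = (B, b)" "finite B" "B \<subseteq> \<Gamma>" using \<open>y \<in> V\<close> by (auto simp: V_def)
      define d where "d \<gamma> = (if \<gamma> \<in> A then a \<gamma> else 0) + k * (if \<gamma> \<in> B then b \<gamma> else 0)" for \<gamma>
      have sums: "(\<Sum>\<gamma>\<in>A \<union> B. d \<gamma> * u \<gamma>) = (\<Sum>\<gamma>\<in>A. a \<gamma> * u \<gamma>) + k * (\<Sum>\<gamma>\<in>B. b \<gamma> * u \<gamma>)" for u :: "real \<Rightarrow> complex"
      proof -
        have "(\<Sum>\<gamma>\<in>A \<union> B. d \<gamma> * u \<gamma>) = (\<Sum>\<gamma>\<in>A \<union> B. if \<gamma> \<in> A then a \<gamma> * u \<gamma> else 0) + k * (\<Sum>\<gamma>\<in>A \<union> B. if \<gamma> \<in> B then b \<gamma> * u \<gamma> else 0)"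
          unfolding sum_distrib_left sum.distrib[symmetric] by (rule sum.cong) (auto simp: d_def algebra_simps)
        also have "(\<Sum>\<gamma>\<in>A \<union> B. if \<gamma> \<in> A then a \<gamma> * u \<gamma> else 0) = (\<Sum>\<gamma>\<in>A. a \<gamma> * u \<gamma>)"
          using x y by (subst sum.inter_restrict[symmetric]) (auto intro: sum.cong)
        also have "(\<Sum>\<gamma>\<in>A \<union> B. if \<gamma> \<in> B then b \<gamma> * u \<gamma> else 0) = (\<Sum>\<gamma>\<in>B. b \<gamma> * u \<gamma>)"
          using x y by (subst sum.inter_restrict[symmetric]) (auto intro: sum.cong)
        finally show ?thesis .
      qed
      have ex: "expsum (A \<union> B) d t = expsum A a t + k * expsum B b t" for t
        unfolding expsum_def by (rule sums)
      show ?thesis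
        by (rule bexI[of _ "(A \<union> B, d)"])
          (use x y ex sums in \<open>auto simp: V_def T_def L_def distrib_left mult.left_commute\<close>)
    qed
  qed
  then obtain g where g: "g \<in> L2" "\<And>x. x \<in> V \<Longrightarrow> (LINT t|lebesgue. T x t * g t) = L x" by blast
  show ?thesis
  proof (intro bexI conjI ballI allI impI)
    show "(\<lambda>t. indicator S t * g t) \<in> L2" by (rule indicator_mult_L2) (use S g in auto)
    show "indicator S t * g t = 0" if "t \<notin> S" for t using that by simp
    fix \<gamma> assume "\<gamma> \<in> \<Gamma>"
    then have "({\<gamma>}, \<lambda>_. 1) \<in> V" by (auto simp: V_def)
    from g(2)[OF this] show "(LINT t|lebesgue. cis (- 2 * pi * \<gamma> * t) * (indicator S t * g t)) = c \<gamma>"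
      by (simp add: T_def L_def expsum_def mult_ac)
  qed
qed

text \<open>If there is no lower bound, there are finitely supported unit vectors \<open>u\<^sub>n\<close> with
  \<open>\<parallel>E\<^sub>u\<^sub>n 1\<^sub>S\<parallel> \<le> 4\<^sup>-\<^sup>n\<close>. Every sequence \<open>x\<close> of moments of a function \<open>g\<close> then pairs with \<open>u\<^sub>n\<close> to at most
  \<open>4\<^sup>-\<^sup>n \<parallel>g\<parallel>\<close> in absolute value. However, signs can be chosen one by one so that
  \<open>x = \<Sum>n. \<plusminus> 3\<^sup>-\<^sup>n cnj u\<^sub>n\<close> pairs with each \<open>u\<^sub>n\<close> to at least \<open>3\<^sup>-\<^sup>n/2\<close>: the sign of the \<open>n\<close>-th term makes the
  pairing of the partial sum at least \<open>3\<^sup>-\<^sup>n\<close>, and the later terms change it by at most \<open>3\<^sup>-\<^sup>n/2\<close>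
  altogether. This is the gliding hump proof of uniform boundedness on \<open>l\<^sup>2\<close>.\<close>

lemma lower_bound_of_moments:
  assumes S: "S \<in> lmeasurable"
    and solv: "\<And>c. c \<in> l2_on \<Gamma> \<Longrightarrow> \<exists>g\<in>L2. \<forall>\<gamma>\<in>\<Gamma>. (LINT t|lebesgue. cis (- 2 * pi * \<gamma> * t) * (indicator S t * g t)) = c \<gamma>"
  shows "\<exists>K>0. \<forall>A a. finite A \<longrightarrow> A \<subseteq> \<Gamma> \<longrightarrow>
        K * L2_set (\<lambda>\<gamma>. cmod (a \<gamma>)) A \<le> L2_norm (\<lambda>t. indicator S t * expsum A a t)"
proof (rule ccontr)
  assume no: "\<not> ?thesis"
  have "\<exists>A a. finite A \<and> A \<subseteq> \<Gamma> \<and> L2_set (\<lambda>\<gamma>. cmod (a \<gamma>)) A = 1 \<and> (\<forall>\<gamma>. \<gamma> \<notin> A \<longrightarrow> a \<gamma> = 0) \<and>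
      L2_norm (\<lambda>t. indicator S t * expsum A a t) \<le> (1/4) ^ n" for n
  proof -
    obtain A b where A: "finite A" "A \<subseteq> \<Gamma>"
      and lt: "L2_norm (\<lambda>t. indicator S t * expsum A b t) < (1/4) ^ n * L2_set (\<lambda>\<gamma>. cmod (b \<gamma>)) A"
      using no by (meson not_le zero_less_power zero_less_divide_1_iff zero_less_numeral)
    define N where "N = L2_set (\<lambda>\<gamma>. cmod (b \<gamma>)) A"
    have N: "N > 0" using le_less_trans[OF L2_norm_nonneg lt] by (simp add: N_def zero_less_mult_iff)
    define a where "a \<gamma> = (if \<gamma> \<in> A then of_real (1 / N) * b \<gamma> else 0)" for \<gamma>
    have "L2_set (\<lambda>\<gamma>. cmod (a \<gamma>)) A = L2_set (\<lambda>\<gamma>. 1 / N * cmod (b \<gamma>)) A"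
      using N by (intro L2_set_cong) (auto simp: a_def norm_mult norm_divide)
    also have "\<dots> = 1 / N * L2_set (\<lambda>\<gamma>. cmod (b \<gamma>)) A"
      using N by (intro L2_set_right_distrib[symmetric]) simp
    also have "\<dots> = 1" using N by (simp add: N_def)
    finally have 1: "L2_set (\<lambda>\<gamma>. cmod (a \<gamma>)) A = 1" .
    have "expsum A a t = of_real (1 / N) * expsum A b t" for t
      unfolding expsum_def sum_distrib_left by (rule sum.cong) (auto simp: a_def)
    then have "(\<lambda>t. indicator S t * expsum A a t) = (\<lambda>t. of_real (1 / N) * (indicator S t * expsum A b t))"
      by (auto simp: mult_ac)
    then have "L2_norm (\<lambda>t. indicator S t * expsum A a t) = 1 / N * L2_norm (\<lambda>t. indicator S t * expsum A b t)"
      using N by (simp only: L2_norm_cmult norm_of_real) simp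
    also have "\<dots> \<le> 1 / N * ((1/4) ^ n * N)"
      using lt N by (intro mult_left_mono) (auto simp: N_def)
    also have "\<dots> = (1/4) ^ n" using N by simp
    finally show ?thesis using A 1 by (intro exI[of _ A] exI[of _ a]) (auto simp: a_def)
  qed
  then obtain A u where A: "\<And>n. finite (A n)" "\<And>n. A n \<subseteq> \<Gamma>"
    and u1: "\<And>n. L2_set (\<lambda>\<gamma>. cmod (u n \<gamma>)) (A n) = 1" and u0: "\<And>n \<gamma>. \<gamma> \<notin> A n \<Longrightarrow> u n \<gamma> = 0"
    and small: "\<And>n. L2_norm (\<lambda>t. indicator S t * expsum (A n) (u n) t) \<le> (1/4) ^ n"
    by metis
  have uB: "L2_set (\<lambda>\<gamma>. cmod (u n \<gamma>)) B \<le> 1" if "finite B" for n B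
  proof -
    have "L2_set (\<lambda>\<gamma>. cmod (u n \<gamma>)) B \<le> L2_set (\<lambda>\<gamma>. cmod (u n \<gamma>)) (A n)"
      unfolding L2_set_def
      using that A(1)[of n] u0[of _ n]
      by (intro real_sqrt_le_mono order_trans[OF sum_mono2[of "B \<union> A n" B] eq_refl[OF sum.mono_neutral_right]]) auto
    then show ?thesis by (simp add: u1)
  qed
  define P where "P n y = (\<Sum>\<gamma>\<in>A n. u n \<gamma> * y \<gamma>)" for n and y :: "real \<Rightarrow> complex"
  have Padd: "P n (\<lambda>\<gamma>. y \<gamma> + k * z \<gamma>) = P n y + k * P n z" for n y z k
    unfolding P_def sum_distrib_left sum.distrib[symmetric] by (rule sum.cong) (auto simp: algebra_simps)
  have Pdiag: "P n (\<lambda>\<gamma>. cnj (u n \<gamma>)) = 1" for n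
  proof -
    have "P n (\<lambda>\<gamma>. cnj (u n \<gamma>)) = of_real ((L2_set (\<lambda>\<gamma>. cmod (u n \<gamma>)) (A n))\<^sup>2)"
      by (simp add: P_def complex_norm_square[symmetric] L2_set_def sum_nonneg)
    then show ?thesis by (simp add: u1)
  qed
  have Pbound: "cmod (P n (\<lambda>\<gamma>. cnj (u m \<gamma>))) \<le> 1" for n m
  proof -
    have "cmod (P n (\<lambda>\<gamma>. cnj (u m \<gamma>))) \<le> (\<Sum>\<gamma>\<in>A n. \<bar>cmod (u n \<gamma>)\<bar> * \<bar>cmod (u m \<gamma>)\<bar>)"
      unfolding P_def by (rule order_trans[OF norm_sum]) (simp add: norm_mult)
    also have "\<dots> \<le> L2_set (\<lambda>\<gamma>. cmod (u n \<gamma>)) (A n) * L2_set (\<lambda>\<gamma>. cmod (u m \<gamma>)) (A n)"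
      by (rule L2_set_mult_ineq)
    also have "\<dots> \<le> 1 * 1" using u1[of n] uB[OF A(1)] by (intro mult_mono) auto
    finally show ?thesis by simp
  qed
  define \<sigma> :: "nat \<Rightarrow> (real \<Rightarrow> complex) \<Rightarrow> real" where
    "\<sigma> n y = (if cmod (P n y + of_real ((1/3) ^ n)) \<ge> (1/3) ^ n then (1/3) ^ n else - ((1/3) ^ n))" for n y
  have \<sigma>: "\<bar>\<sigma> n y\<bar> = (1/3) ^ n" "cmod (P n y + of_real (\<sigma> n y)) \<ge> (1/3) ^ n" for n y
  proof -
    show "\<bar>\<sigma> n y\<bar> = (1/3) ^ n" by (simp add: \<sigma>_def)
    have "2 * (1/3) ^ n = cmod ((P n y + of_real ((1/3) ^ n)) - (P n y + of_real (- ((1/3) ^ n))))"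
      by (simp add: norm_mult norm_power norm_divide flip: mult_2)
    also have "\<dots> \<le> cmod (P n y + of_real ((1/3) ^ n)) + cmod (P n y + of_real (- ((1/3) ^ n)))"
      by (rule norm_triangle_ineq4)
    finally show "cmod (P n y + of_real (\<sigma> n y)) \<ge> (1/3) ^ n" unfolding \<sigma>_def by (auto split: if_splits)
  qed
  define X where "X = rec_nat (\<lambda>\<gamma>::real. 0::complex) (\<lambda>n y \<gamma>. y \<gamma> + of_real (\<sigma> n y) * cnj (u n \<gamma>))"
  have X: "X 0 = (\<lambda>\<gamma>. 0)" "X (Suc n) = (\<lambda>\<gamma>. X n \<gamma> + of_real (\<sigma> n (X n)) * cnj (u n \<gamma>))" for n
    by (simp_all add: X_def)
  (* The term 3/2 (1/3)^m is the sum of (1/3)^j over j >= m, what the terms from m on can still cancel. *)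
  have PX: "cmod (P n (X m)) \<ge> (1/3) ^ n / 2 + 3/2 * (1/3) ^ m" if "m \<ge> Suc n" for n m
    using that
  proof (induction m rule: dec_induct)
    case base
    have "P n (X (Suc n)) = P n (X n) + of_real (\<sigma> n (X n))" by (simp only: X(2) Padd Pdiag) simp
    then show ?case using \<sigma>(2)[of n "X n"] by simp
  next
    case (step m)
    have "P n (X (Suc m)) = P n (X m) + of_real (\<sigma> m (X m)) * P n (\<lambda>\<gamma>. cnj (u m \<gamma>))" by (simp only: X(2) Padd)
    then have "cmod (P n (X m)) \<le> cmod (P n (X (Suc m))) + cmod (of_real (\<sigma> m (X m)) * P n (\<lambda>\<gamma>. cnj (u m \<gamma>)))"
      using norm_triangle_ineq4[of "P n (X (Suc m))" "of_real (\<sigma> m (X m)) * P n (\<lambda>\<gamma>. cnj (u m \<gamma>))"] by simp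
    also have "cmod (of_real (\<sigma> m (X m)) * P n (\<lambda>\<gamma>. cnj (u m \<gamma>))) \<le> (1/3) ^ m * 1"
      unfolding norm_mult norm_of_real \<sigma>(1) by (intro mult_left_mono Pbound) auto
    finally show ?case using step.IH by simp
  qed
  have XB: "L2_set (\<lambda>\<gamma>. cmod (X m \<gamma>)) B \<le> 3/2 - 3/2 * (1/3) ^ m" if "finite B" for B m
  proof (induction m)
    case (Suc m)
    have "L2_set (\<lambda>\<gamma>. cmod (X (Suc m) \<gamma>)) B \<le> L2_set (\<lambda>\<gamma>. cmod (X m \<gamma>) + (1/3) ^ m * cmod (u m \<gamma>)) B"
    proof (rule L2_set_mono)
      fix \<gamma>
      show "cmod (X (Suc m) \<gamma>) \<le> cmod (X m \<gamma>) + (1/3) ^ m * cmod (u m \<gamma>)"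
        using norm_triangle_ineq[of "X m \<gamma>" "of_real (\<sigma> m (X m)) * cnj (u m \<gamma>)"]
        by (simp add: X norm_mult \<sigma>(1))
    qed auto
    also have "\<dots> \<le> L2_set (\<lambda>\<gamma>. cmod (X m \<gamma>)) B + L2_set (\<lambda>\<gamma>. (1/3) ^ m * cmod (u m \<gamma>)) B"
      by (rule L2_set_triangle_ineq)
    also have "L2_set (\<lambda>\<gamma>. (1/3) ^ m * cmod (u m \<gamma>)) B = (1/3) ^ m * L2_set (\<lambda>\<gamma>. cmod (u m \<gamma>)) B"
      by (simp add: L2_set_right_distrib)
    also have "\<dots> \<le> (1/3) ^ m * 1" using uB[OF that] by (intro mult_left_mono) auto
    finally show ?case using Suc by simp
  qed (simp add: X L2_set_def)
  have "convergent (\<lambda>m. X m \<gamma>)" for \<gamma>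
  proof -
    have "summable (\<lambda>n. of_real (\<sigma> n (X n)) * cnj (u n \<gamma>))"
    proof (rule summable_comparison_test'[where N = 0])
      show "summable (\<lambda>n. (1/3 :: real) ^ n)" by simp
      fix n
      have "cmod (u n \<gamma>) \<le> 1" using uB[of "{\<gamma>}" n] by simp
      then show "norm (of_real (\<sigma> n (X n)) * cnj (u n \<gamma>)) \<le> (1/3) ^ n"
        by (simp add: norm_mult \<sigma>(1))
    qed
    moreover have "X m \<gamma> = (\<Sum>n<m. of_real (\<sigma> n (X n)) * cnj (u n \<gamma>))" for m
      by (induction m) (simp_all add: X)
    ultimately show ?thesis by (simp add: summable_iff_convergent)
  qed
  define x where "x \<gamma> = lim (\<lambda>m. X m \<gamma>)" for \<gamma>
  have xlim: "(\<lambda>m. X m \<gamma>) \<longlonglongrightarrow> x \<gamma>" for \<gamma>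
    unfolding x_def using \<open>convergent (\<lambda>m. X m \<gamma>)\<close> by (simp add: convergent_LIMSEQ_iff)
  have "(\<Sum>\<gamma>\<in>B. (cmod (x \<gamma>))\<^sup>2) \<le> (3/2)\<^sup>2" if "finite B" for B
  proof (rule LIMSEQ_le_const2)
    show "(\<lambda>m. \<Sum>\<gamma>\<in>B. (cmod (X m \<gamma>))\<^sup>2) \<longlonglongrightarrow> (\<Sum>\<gamma>\<in>B. (cmod (x \<gamma>))\<^sup>2)"
      by (intro tendsto_intros xlim)
    have "(\<Sum>\<gamma>\<in>B. (cmod (X m \<gamma>))\<^sup>2) \<le> (3/2)\<^sup>2" for m
    proof -
      have "sqrt (\<Sum>\<gamma>\<in>B. (cmod (X m \<gamma>))\<^sup>2) \<le> 3/2"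
        using XB[OF that, of m] zero_le_power[of "1/3::real" m] unfolding L2_set_def by linarith
      then show ?thesis by (rule sqrt_le_D)
    qed
    then show "\<exists>N. \<forall>m\<ge>N. (\<Sum>\<gamma>\<in>B. (cmod (X m \<gamma>))\<^sup>2) \<le> (3/2)\<^sup>2" by blast
  qed
  then have "x \<in> l2_on \<Gamma>"
    unfolding l2_on_def mem_Collect_eq
    by (intro nonneg_bdd_above_summable_on bdd_aboveI2[where M = "(3/2)\<^sup>2"]) auto
  from solv[OF this] obtain g where g: "g \<in> L2"
    and mom: "\<And>\<gamma>. \<gamma> \<in> \<Gamma> \<Longrightarrow> (LINT t|lebesgue. cis (- 2 * pi * \<gamma> * t) * (indicator S t * g t)) = x \<gamma>" by blast
  have Px: "P n x = (LINT t|lebesgue. (indicator S t * expsum (A n) (u n) t) * g t)" for n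
  proof -
    have i: "integrable lebesgue (\<lambda>t. u n \<gamma> * (cis (- 2 * pi * \<gamma> * t) * (indicator S t * g t)))" for \<gamma>
    proof -
      have "integrable lebesgue (\<lambda>t. indicator S t * g t)"
        by (rule L2_mult_integrable[OF indicator_L2[OF S] g])
      then show ?thesis using L1_cis_mult[of "\<lambda>t. indicator S t * g t" "- 2 * pi * \<gamma>"] by (simp add: L1_def)
    qed
    have "P n x = (\<Sum>\<gamma>\<in>A n. u n \<gamma> * (LINT t|lebesgue. cis (- 2 * pi * \<gamma> * t) * (indicator S t * g t)))"
      unfolding P_def using A(2)[of n] mom by (intro sum.cong) auto
    also have "\<dots> = (\<Sum>\<gamma>\<in>A n. LINT t|lebesgue. u n \<gamma> * (cis (- 2 * pi * \<gamma> * t) * (indicator S t * g t)))"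
      by (simp only: integral_mult_right_zero)
    also have "\<dots> = (LINT t|lebesgue. (\<Sum>\<gamma>\<in>A n. u n \<gamma> * (cis (- 2 * pi * \<gamma> * t) * (indicator S t * g t))))"
      by (rule Bochner_Integration.integral_sum[symmetric]) (rule i)
    also have "\<dots> = (LINT t|lebesgue. (indicator S t * expsum (A n) (u n) t) * g t)"
      by (simp add: expsum_def sum_distrib_left sum_distrib_right mult_ac)
    finally show ?thesis .
  qed
  have le: "(1/3) ^ n / 2 \<le> (1/4) ^ n * L2_norm g" for n
  proof -
    have "(\<lambda>m. cmod (P n (X m))) \<longlonglongrightarrow> cmod (P n x)"
      unfolding P_def by (intro tendsto_intros xlim)
    moreover have "(1/3) ^ n / 2 \<le> cmod (P n (X m))" if "m \<ge> Suc n" for m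
      using PX[OF that] zero_le_power[of "1/3::real" m] by linarith
    ultimately have "(1/3) ^ n / 2 \<le> cmod (P n x)"
      by (intro LIMSEQ_le_const) auto
    also have "\<dots> \<le> L2_norm (\<lambda>t. indicator S t * expsum (A n) (u n) t) * L2_norm g"
      unfolding Px by (rule L2_Cauchy_Schwarz[OF indicator_expsum_L2[OF S] g])
    also have "\<dots> \<le> (1/4) ^ n * L2_norm g" by (intro mult_right_mono small) auto
    finally show ?thesis .
  qed
  have "(\<lambda>n. (3/4 :: real) ^ n * L2_norm g) \<longlonglongrightarrow> 0 * L2_norm g"
    by (intro tendsto_intros LIMSEQ_realpow_zero) auto
  then obtain n where "(3/4 :: real) ^ n * L2_norm g < 1/2"
    using order_tendstoD(2)[of "\<lambda>n. (3/4 :: real) ^ n * L2_norm g" 0 sequentially "1/2"]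
    by (auto simp: eventually_sequentially)
  moreover have "3 ^ n * ((1/3) ^ n / 2) \<le> 3 ^ n * ((1/4) ^ n * L2_norm g)"
    by (intro mult_left_mono le) auto
  then have "1 / 2 \<le> (3/4 :: real) ^ n * L2_norm g"
    by (simp add: power_divide)
  ultimately show False by linarith
qed

section \<open>Stability of shifts and interpolation\<close>

lemma AE_eq_continuous_imp_eq:
  fixes f g :: "real \<Rightarrow> complex"
  assumes "continuous_on UNIV f" "continuous_on UNIV g" "AE x in lebesgue. f x = g x"
  shows "f = g"
proof -
  have "open {x. f x \<noteq> g x}" using assms(1,2) by (rule open_Collect_neq)
  moreover have "negligible {x. f x \<noteq> g x}"
    using assms(3) by (simp add: negligible_iff_null_sets AE_iff_null_sets[symmetric] eventually_ae_filter)
      (metis (mono_tags, lifting) null_sets_completion_subset space_completion)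
  ultimately have "{x. f x \<noteq> g x} = {}" using open_not_negligible by blast
  then show ?thesis by auto
qed

lemma L1_of_L2_supported:
  assumes S: "S \<in> lmeasurable" and g: "g \<in> L2" and ae: "AE t in lebesgue. t \<notin> S \<longrightarrow> g t = 0"
  shows "g \<in> L1"
proof -
  have gm: "g \<in> borel_measurable lebesgue" using g by (simp add: L2_def)
  have i: "integrable lebesgue (\<lambda>t. indicator S t * g t)"
    by (rule L2_mult_integrable[OF indicator_L2[OF S] g])
  have "integrable lebesgue g \<longleftrightarrow> integrable lebesgue (\<lambda>t. indicator S t * g t)"
    using ae by (intro integrable_cong_AE gm borel_measurable_integrable[OF i]) (auto elim!: eventually_mono)
  then show ?thesis using i by (simp add: L1_def)
qed

text \<open>A function of the Paley-Wiener space of \<open>S\<close> is the Fourier transform of an integrable function supported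
  on \<open>S\<close>, so its values on \<open>\<Gamma>\<close> are the moments of that function with respect to the exponentials.\<close>

lemma interpolation_set_iff_lower_bound:
  assumes sep: "separated \<Gamma>" and S: "S \<in> lmeasurable"
  shows "interpolation_set \<Gamma> S \<longleftrightarrow>
    (\<exists>K>0. \<forall>A a. finite A \<longrightarrow> A \<subseteq> \<Gamma> \<longrightarrow>
        K * L2_set (\<lambda>\<gamma>. cmod (a \<gamma>)) A \<le> L2_norm (\<lambda>t. indicator S t * expsum A a t))"
proof
  assume I: "interpolation_set \<Gamma> S"
  show "\<exists>K>0. \<forall>A a. finite A \<longrightarrow> A \<subseteq> \<Gamma> \<longrightarrow>
        K * L2_set (\<lambda>\<gamma>. cmod (a \<gamma>)) A \<le> L2_norm (\<lambda>t. indicator S t * expsum A a t)"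
  proof (rule lower_bound_of_moments[OF S])
    fix c assume "c \<in> l2_on \<Gamma>"
    then obtain f where f: "f \<in> paley_wiener S" "\<And>\<gamma>. \<gamma> \<in> \<Gamma> \<Longrightarrow> f \<gamma> = c \<gamma>"
      using I by (auto simp: interpolation_set_def)
    then obtain g where g: "has_fourier_L2 g f" and ae: "AE t in lebesgue. t \<notin> S \<longrightarrow> g t = 0"
      by (auto simp: paley_wiener_def has_inverse_fourier_L2_def)
    have gL2: "g \<in> L2" using g by (rule has_fourier_L2_mem)
    have gL1: "g \<in> L1" by (rule L1_of_L2_supported[OF S gL2 ae])
    have "f = fourier_L1 g"
      using f(1) fourier_L1_continuous[OF gL1] has_fourier_L2_L1_unique[OF gL1 g]
      by (intro AE_eq_continuous_imp_eq) (auto simp: paley_wiener_def)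
    moreover have "(LINT t|lebesgue. cis (- 2 * pi * \<gamma> * t) * (indicator S t * g t)) = fourier_L1 g \<gamma>" for \<gamma>
      unfolding fourier_L1_cis
    proof (rule integral_cong_AE)
      show "AE t in lebesgue. cis (- 2 * pi * \<gamma> * t) * (indicator S t * g t) = cis (- 2 * pi * \<gamma> * t) * g t"
        using ae by eventually_elim auto
      have "indicator S \<in> borel_measurable lebesgue" using S by (intro borel_measurable_indicator) auto
      then show "(\<lambda>t. cis (- 2 * pi * \<gamma> * t) * (indicator S t * g t)) \<in> borel_measurable lebesgue"
        using gL2 by (intro borel_measurable_times lebesgue_cis_measurable) (auto simp: L2_def)
      show "(\<lambda>t. cis (- 2 * pi * \<gamma> * t) * g t) \<in> borel_measurable lebesgue"
        using gL2 by (intro borel_measurable_times lebesgue_cis_measurable) (auto simp: L2_def)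
    qed
    ultimately show "\<exists>g\<in>L2. \<forall>\<gamma>\<in>\<Gamma>. (LINT t|lebesgue. cis (- 2 * pi * \<gamma> * t) * (indicator S t * g t)) = c \<gamma>"
      using gL2 f(2) by (intro bexI[of _ g]) auto
  qed
next
  assume "\<exists>K>0. \<forall>A a. finite A \<longrightarrow> A \<subseteq> \<Gamma> \<longrightarrow>
        K * L2_set (\<lambda>\<gamma>. cmod (a \<gamma>)) A \<le> L2_norm (\<lambda>t. indicator S t * expsum A a t)"
  then obtain K where K: "K > 0" "\<And>A a. finite A \<Longrightarrow> A \<subseteq> \<Gamma> \<Longrightarrow>
        K * L2_set (\<lambda>\<gamma>. cmod (a \<gamma>)) A \<le> L2_norm (\<lambda>t. indicator S t * expsum A a t)" by blast
  show "interpolation_set \<Gamma> S"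
    unfolding interpolation_set_def
  proof (intro conjI sep ballI)
    fix c assume "c \<in> l2_on \<Gamma>"
    from moments_of_lower_bound[OF S K this] obtain g where g: "g \<in> L2" "\<And>t. t \<notin> S \<Longrightarrow> g t = 0"
      "\<And>\<gamma>. \<gamma> \<in> \<Gamma> \<Longrightarrow> (LINT t|lebesgue. cis (- 2 * pi * \<gamma> * t) * g t) = c \<gamma>" by blast
    have gL1: "g \<in> L1" by (rule L1_of_L2_supported[OF S g(1)]) (use g in auto)
    have "fourier_L1 g \<in> paley_wiener S"
      unfolding paley_wiener_def has_inverse_fourier_L2_def
      using fourier_L1_continuous[OF gL1] Plancherel(1)[OF gL1 g(1)] has_fourier_L2_L1[OF gL1 g(1)] g(2) by auto
    then show "\<exists>f\<in>paley_wiener S. \<forall>\<gamma>\<in>\<Gamma>. f \<gamma> = c \<gamma>"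
      using g(3) by (intro bexI[of _ "fourier_L1 g"]) (auto simp: fourier_L1_cis)
  qed
qed

text \<open>The upper bound makes the net of finite partial sums Cauchy. Its limit is found along the
  sequence \<open>D\<close> of finite sets that leave out tails of norm at most \<open>(1/2)\<^sup>n\<close>, and the two bounds
  pass to the limit.\<close>

lemma l2_stable_shifts_of_finite_bounds:
  assumes G: "G \<in> L2" and C: "C1 > 0" "C2 > 0"
    and lower: "\<And>A c. finite A \<Longrightarrow> A \<subseteq> \<Gamma> \<Longrightarrow>
      C1 * L2_set (\<lambda>\<gamma>. cmod (c \<gamma>)) A \<le> L2_norm (\<lambda>x. \<Sum>\<gamma>\<in>A. c \<gamma> * G (x - \<gamma>))"
    and upper: "\<And>A c. finite A \<Longrightarrow> A \<subseteq> \<Gamma> \<Longrightarrow>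
      L2_norm (\<lambda>x. \<Sum>\<gamma>\<in>A. c \<gamma> * G (x - \<gamma>)) \<le> C2 * L2_set (\<lambda>\<gamma>. cmod (c \<gamma>)) A"
  shows "l2_stable_shifts \<Gamma> G"
  unfolding l2_stable_shifts_def
proof (rule exI[of _ C1], rule conjI[OF C(1)], rule exI[of _ C2], rule conjI[OF C(2)], rule ballI)
  fix c assume c: "c \<in> l2_on \<Gamma>"
  define P where "P A x = (\<Sum>\<gamma>\<in>A. c \<gamma> * G (x - \<gamma>))" for A x
  have P: "P A \<in> L2" for A unfolding P_def by (intro L2_sum L2_cmult L2_shift G)
  have hs: "((\<lambda>\<gamma>. (cmod (c \<gamma>))\<^sup>2) has_sum (\<Sum>\<^sub>\<infinity>\<gamma>\<in>\<Gamma>. (cmod (c \<gamma>))\<^sup>2)) \<Gamma>"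
    using c by (simp add: l2_on_def)
  define \<Sigma> where "\<Sigma> = (\<Sum>\<^sub>\<infinity>\<gamma>\<in>\<Gamma>. (cmod (c \<gamma>))\<^sup>2)"
  have l2lim: "((\<lambda>A. L2_set (\<lambda>\<gamma>. cmod (c \<gamma>)) A) \<longlongrightarrow> l2_norm_on \<Gamma> c) (finite_subsets_at_top \<Gamma>)"
    unfolding L2_set_def l2_norm_on_def using hs unfolding has_sum_def by (intro tendsto_intros) auto
  have "\<exists>A. finite A \<and> A \<subseteq> \<Gamma> \<and> (\<forall>B. finite B \<longrightarrow> B \<subseteq> \<Gamma> \<longrightarrow> A \<inter> B = {} \<longrightarrow> L2_set (\<lambda>\<gamma>. cmod (c \<gamma>)) B \<le> (1/2) ^ n)" for n
  proof -
    have "\<forall>\<^sub>F A in finite_subsets_at_top \<Gamma>. (\<Sum>\<gamma>\<in>A. (cmod (c \<gamma>))\<^sup>2) > \<Sigma> - ((1/2) ^ n)\<^sup>2"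
      using hs unfolding has_sum_def \<Sigma>_def by (rule order_tendstoD) simp
    then obtain A where A: "finite A" "A \<subseteq> \<Gamma>" "(\<Sum>\<gamma>\<in>A. (cmod (c \<gamma>))\<^sup>2) > \<Sigma> - ((1/2) ^ n)\<^sup>2"
      unfolding eventually_finite_subsets_at_top by blast
    have "L2_set (\<lambda>\<gamma>. cmod (c \<gamma>)) B \<le> (1/2) ^ n" if B: "finite B" "B \<subseteq> \<Gamma>" "A \<inter> B = {}" for B
    proof -
      have "(\<Sum>\<gamma>\<in>A. (cmod (c \<gamma>))\<^sup>2) + (\<Sum>\<gamma>\<in>B. (cmod (c \<gamma>))\<^sup>2) = (\<Sum>\<gamma>\<in>A \<union> B. (cmod (c \<gamma>))\<^sup>2)"
        using A B by (simp add: sum.union_disjoint)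
      also have "\<dots> \<le> \<Sigma>" unfolding \<Sigma>_def
        using c A B by (intro finite_sum_le_infsum) (auto simp: l2_on_def)
      finally have "(\<Sum>\<gamma>\<in>B. (cmod (c \<gamma>))\<^sup>2) \<le> ((1/2) ^ n)\<^sup>2" using A(3) by simp
      then show ?thesis unfolding L2_set_def by (intro real_le_lsqrt) auto
    qed
    then show ?thesis using A by blast
  qed
  then obtain A where A: "\<And>n. finite (A n)" "\<And>n. A n \<subseteq> \<Gamma>"
    and tail: "\<And>n B. finite B \<Longrightarrow> B \<subseteq> \<Gamma> \<Longrightarrow> A n \<inter> B = {} \<Longrightarrow> L2_set (\<lambda>\<gamma>. cmod (c \<gamma>)) B \<le> (1/2) ^ n"
    by metis
  define D where "D n = (\<Union>i\<le>n. A i)" for n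
  have D: "finite (D n)" "D n \<subseteq> \<Gamma>" for n using A by (auto simp: D_def)
  have AD: "A n \<subseteq> D n" for n by (auto simp: D_def)
  have Dmono: "D n \<subseteq> D m" if "n \<le> m" for m n
    unfolding D_def using that by (intro UN_mono) auto
  have step: "L2_norm (\<lambda>x. P F x - P (D n) x) \<le> C2 * (1/2) ^ n" if F: "finite F" "F \<subseteq> \<Gamma>" "D n \<subseteq> F" for F n
  proof -
    have "(\<lambda>x. P F x - P (D n) x) = (\<lambda>x. \<Sum>\<gamma>\<in>F - D n. c \<gamma> * G (x - \<gamma>))"
      unfolding P_def using F by (auto simp: sum_diff)
    then have "L2_norm (\<lambda>x. P F x - P (D n) x) \<le> C2 * L2_set (\<lambda>\<gamma>. cmod (c \<gamma>)) (F - D n)"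
      using upper[of "F - D n" c] F by auto
    also have "\<dots> \<le> C2 * (1/2) ^ n"
      using F AD[of n] C by (intro mult_left_mono tail) auto
    finally show ?thesis .
  qed
  have e0: "(\<lambda>n. C2 * (1/2) ^ n) \<longlonglongrightarrow> 0"
    using tendsto_mult_right_zero[OF LIMSEQ_realpow_zero[of "1/2"], of C2] by simp
  have "\<exists>s. L2_tendsto (\<lambda>n. P (D n)) s sequentially"
    by (rule L2_Cauchy_converges[OF P e0]) (use D Dmono step in auto)
  then obtain s where s: "L2_tendsto (\<lambda>n. P (D n)) s sequentially" by blast
  then have sL2: "s \<in> L2" by (simp add: L2_tendsto_def)
  have conv: "L2_tendsto P s (finite_subsets_at_top \<Gamma>)"
    unfolding L2_tendsto_def
  proof (intro conjI sL2)
    show "\<forall>\<^sub>F A in finite_subsets_at_top \<Gamma>. P A \<in> L2" using P by simp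
    show "((\<lambda>A. L2_norm (\<lambda>x. P A x - s x)) \<longlongrightarrow> 0) (finite_subsets_at_top \<Gamma>)"
    proof (rule tendstoI)
      fix e :: real assume "e > 0"
      have "(\<lambda>n. C2 * (1/2) ^ n + L2_norm (\<lambda>x. P (D n) x - s x)) \<longlonglongrightarrow> 0"
        using s by (intro tendsto_add_zero e0) (simp add: L2_tendsto_def)
      then obtain n where n: "C2 * (1/2) ^ n + L2_norm (\<lambda>x. P (D n) x - s x) < e"
        using order_tendstoD(2)[of _ 0 sequentially e] \<open>e > 0\<close> by (fastforce simp: eventually_sequentially)
      have "dist (L2_norm (\<lambda>x. P F x - s x)) 0 < e" if "finite F" "F \<subseteq> \<Gamma>" "D n \<subseteq> F" for F
        using L2_norm_triangle_diff[OF P[of F] P[of "D n"] sL2] step[OF that] n by simp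
      then show "\<forall>\<^sub>F F in finite_subsets_at_top \<Gamma>. dist (L2_norm (\<lambda>x. P F x - s x)) 0 < e"
        unfolding eventually_finite_subsets_at_top using D[of n] by (intro exI[of _ "D n"]) auto
    qed
  qed
  have fin: "\<forall>\<^sub>F F in finite_subsets_at_top \<Gamma>. finite F \<and> F \<subseteq> \<Gamma>"
    by (auto simp: eventually_finite_subsets_at_top)
  have nlim: "((\<lambda>A. L2_norm (P A)) \<longlongrightarrow> L2_norm s) (finite_subsets_at_top \<Gamma>)"
    by (rule L2_tendsto_norm[OF conv])
  show "\<exists>s. shifts_has_sum \<Gamma> G c s \<and> C1 * l2_norm_on \<Gamma> c \<le> L2_norm s \<and> L2_norm s \<le> C2 * l2_norm_on \<Gamma> c"
  proof (intro exI conjI)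
    show "shifts_has_sum \<Gamma> G c s" using conv unfolding shifts_has_sum_def P_def .
    show "C1 * l2_norm_on \<Gamma> c \<le> L2_norm s"
      by (rule tendsto_le[OF _ nlim tendsto_mult_left[OF l2lim]])
        (use fin lower in \<open>auto simp: P_def[abs_def] elim!: eventually_mono\<close>)
    show "L2_norm s \<le> C2 * l2_norm_on \<Gamma> c"
      by (rule tendsto_le[OF _ tendsto_mult_left[OF l2lim] nlim])
        (use fin upper in \<open>auto simp: P_def[abs_def] elim!: eventually_mono\<close>)
  qed
qed

text \<open>For coefficients that vanish outside a finite set the partial sums are eventually constant, so that their
  limit is known.\<close>

lemma l2_stable_shifts_finite_lower:
  assumes "l2_stable_shifts \<Gamma> G" and G: "G \<in> L2"
  obtains C1 where "C1 > 0" "\<And>A c. finite A \<Longrightarrow> A \<subseteq> \<Gamma> \<Longrightarrow>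
      C1 * L2_set (\<lambda>\<gamma>. cmod (c \<gamma>)) A \<le> L2_norm (\<lambda>x. \<Sum>\<gamma>\<in>A. c \<gamma> * G (x - \<gamma>))"
proof -
  obtain C1 where C1: "C1 > 0"
    and st: "\<And>c. c \<in> l2_on \<Gamma> \<Longrightarrow> \<exists>s. shifts_has_sum \<Gamma> G c s \<and> C1 * l2_norm_on \<Gamma> c \<le> L2_norm s"
    using assms(1) unfolding l2_stable_shifts_def by blast
  have "C1 * L2_set (\<lambda>\<gamma>. cmod (a \<gamma>)) A \<le> L2_norm (\<lambda>x. \<Sum>\<gamma>\<in>A. a \<gamma> * G (x - \<gamma>))" if A: "finite A" "A \<subseteq> \<Gamma>" for A a
  proof -
    define c where "c \<gamma> = (if \<gamma> \<in> A then a \<gamma> else 0)" for \<gamma>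
    have hs: "((\<lambda>\<gamma>. (cmod (c \<gamma>))\<^sup>2) has_sum (\<Sum>\<gamma>\<in>A. (cmod (c \<gamma>))\<^sup>2)) \<Gamma>"
      by (intro has_sum_finite_neutralI[OF A]) (auto simp: c_def)
    then have cl2: "c \<in> l2_on \<Gamma>" by (auto simp: l2_on_def has_sum_imp_summable)
    have "l2_norm_on \<Gamma> c = L2_set (\<lambda>\<gamma>. cmod (c \<gamma>)) A"
      unfolding l2_norm_on_def L2_set_def using infsumI[OF hs] by simp
    also have "\<dots> = L2_set (\<lambda>\<gamma>. cmod (a \<gamma>)) A" by (rule L2_set_cong) (auto simp: c_def)
    finally have nc: "l2_norm_on \<Gamma> c = L2_set (\<lambda>\<gamma>. cmod (a \<gamma>)) A" .
    obtain s where s: "shifts_has_sum \<Gamma> G c s" "C1 * l2_norm_on \<Gamma> c \<le> L2_norm s"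
      using st[OF cl2] by blast
    have part: "(\<lambda>x. \<Sum>\<gamma>\<in>F. c \<gamma> * G (x - \<gamma>)) = (\<lambda>x. \<Sum>\<gamma>\<in>A. a \<gamma> * G (x - \<gamma>))" if "finite F" "A \<subseteq> F" for F
    proof
      fix x
      have "(\<Sum>\<gamma>\<in>F. c \<gamma> * G (x - \<gamma>)) = (\<Sum>\<gamma>\<in>A. c \<gamma> * G (x - \<gamma>))"
        using that by (intro sum.mono_neutral_right) (auto simp: c_def)
      then show "(\<Sum>\<gamma>\<in>F. c \<gamma> * G (x - \<gamma>)) = (\<Sum>\<gamma>\<in>A. a \<gamma> * G (x - \<gamma>))" by (simp add: c_def)
    qed
    have "((\<lambda>F. L2_norm (\<lambda>x. \<Sum>\<gamma>\<in>F. c \<gamma> * G (x - \<gamma>))) \<longlongrightarrow> L2_norm s) (finite_subsets_at_top \<Gamma>)"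
      using s(1) unfolding shifts_has_sum_def by (rule L2_tendsto_norm)
    moreover have "((\<lambda>F. L2_norm (\<lambda>x. \<Sum>\<gamma>\<in>F. c \<gamma> * G (x - \<gamma>))) \<longlongrightarrow> L2_norm (\<lambda>x. \<Sum>\<gamma>\<in>A. a \<gamma> * G (x - \<gamma>))) (finite_subsets_at_top \<Gamma>)"
      by (rule tendsto_eventually) (use A part in \<open>auto simp: eventually_finite_subsets_at_top intro!: exI[of _ A]\<close>)
    ultimately have "L2_norm s = L2_norm (\<lambda>x. \<Sum>\<gamma>\<in>A. a \<gamma> * G (x - \<gamma>))"
      by (intro tendsto_unique[of "finite_subsets_at_top \<Gamma>"]) auto
    then show ?thesis using s(2) nc by simp
  qed
  then show ?thesis using that C1 by blast
qed

lemma separated_real: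
  assumes "separated \<Gamma>"
  obtains \<delta> :: real where "\<delta> > 0" "\<And>\<gamma> \<gamma>'. \<gamma> \<in> \<Gamma> \<Longrightarrow> \<gamma>' \<in> \<Gamma> \<Longrightarrow> \<gamma> \<noteq> \<gamma>' \<Longrightarrow> \<delta> \<le> \<bar>\<gamma> - \<gamma>'\<bar>"
proof -
  obtain d where d: "0 < ereal d" "ereal d < separation \<Gamma>"
    using ereal_dense2[of 0 "separation \<Gamma>"] assms by (auto simp: separated_def)
  have "d \<le> \<bar>\<gamma> - \<gamma>'\<bar>" if "\<gamma> \<in> \<Gamma>" "\<gamma>' \<in> \<Gamma>" "\<gamma> \<noteq> \<gamma>'" for \<gamma> \<gamma>'
  proof -
    have "separation \<Gamma> \<le> ereal \<bar>\<gamma> - \<gamma>'\<bar>"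
      unfolding separation_def using that by (intro INF_lower2[of "(\<gamma>, \<gamma>')"]) auto
    then have "ereal d \<le> ereal \<bar>\<gamma> - \<gamma>'\<bar>" by (rule order_trans[OF less_imp_le[OF d(2)]])
    then show ?thesis by simp
  qed
  then show ?thesis using that[of d] d by auto
qed

text \<open>Chebyshev's inequality.\<close>

lemma superlevel_lmeasurable:
  assumes "f \<in> L2" "r > 0"
  shows "{t. cmod (f t) > r} \<in> lmeasurable"
proof -
  have [measurable]: "f \<in> borel_measurable lebesgue" using assms by (simp add: L2_def)
  have "{t \<in> space lebesgue. cmod (f t) > r} \<in> sets lebesgue" by measurable
  then have s: "{t. cmod (f t) > r} \<in> sets lebesgue" by simp
  have i: "integrable lebesgue (\<lambda>t. (1 / r\<^sup>2) * (cmod (f t))\<^sup>2)" using assms by (simp add: L2_def)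
  have "integrable lebesgue (indicat_real {t. cmod (f t) > r})"
  proof (rule Bochner_Integration.integrable_bound[OF i])
    show "AE t in lebesgue. norm (indicat_real {t. cmod (f t) > r} t) \<le> norm ((1 / r\<^sup>2) * (cmod (f t))\<^sup>2)"
    proof (rule AE_I2)
      fix t
      have "r\<^sup>2 \<le> (cmod (f t))\<^sup>2" if "cmod (f t) > r" using that assms(2) by (intro power_mono) auto
      then show "norm (indicat_real {t. cmod (f t) > r} t) \<le> norm ((1 / r\<^sup>2) * (cmod (f t))\<^sup>2)"
        using assms(2) by (auto simp: indicator_def)
    qed
  qed (use s in auto)
  then show ?thesis by (simp add: lmeasurable_iff_integrable)
qed

theorem theorem2p5:
  fixes \<Gamma> :: "real set" and G Ghat :: "real \<Rightarrow> complex"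
  assumes "separated \<Gamma>"
    and "G \<in> L2"
    and "\<not> (AE x in lebesgue. G x = 0)"
    and "has_fourier_L2 G Ghat"
    and "(\<lambda>t. complex_of_real ((cmod (Ghat t))\<^sup>2)) \<in> wiener_amalgam"
  shows "l2_stable_shifts \<Gamma> G \<longleftrightarrow>
    (\<exists>r>0. interpolation_set \<Gamma> {t. cmod (Ghat t) > r})"
proof -
  obtain \<delta> where \<delta>: "\<delta> > 0" and sep: "\<And>\<gamma> \<gamma>'. \<gamma> \<in> \<Gamma> \<Longrightarrow> \<gamma>' \<in> \<Gamma> \<Longrightarrow> \<gamma> \<noteq> \<gamma>' \<Longrightarrow> \<delta> \<le> \<bar>\<gamma> - \<gamma>'\<bar>"
    using separated_real[OF assms(1)] by blast
  define B where "B = Bessel_const \<delta>"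
  have B: "B > 0" using Bessel_const_pos[OF \<delta>] by (simp add: B_def)
  obtain a where a: "\<And>n. a n \<ge> 0" "summable a"
    and maj: "AE t in lebesgue. (cmod (Ghat t))\<^sup>2 \<le> a (int_encode \<lfloor>t\<rfloor>)"
    using wiener_amalgam_majorant[OF assms(5)] by (auto simp: norm_power)
  have Ghat: "Ghat \<in> L2" using assms(4) by (rule has_fourier_L2_mem)
  have Gm: "Ghat \<in> borel_measurable lebesgue" using Ghat by (simp add: L2_def)
  note [measurable] = Gm expsum_measurable_lebesgue
  define E where "E A c = L2_norm (\<lambda>t. expsum A c t * Ghat t)" for A c
  have shifts: "L2_norm (\<lambda>x. \<Sum>\<gamma>\<in>A. c \<gamma> * G (x - \<gamma>)) = E A c" if "finite A" for A c
    unfolding E_def by (rule L2_norm_shifts(3)[OF assms(4) that])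
  have EL2: "(\<lambda>t. expsum A c t * Ghat t) \<in> L2" if "finite A" for A c
    by (rule L2_norm_shifts(2)[OF assms(4) that])
  have nnE: "(\<integral>\<^sup>+t. ennreal ((cmod (Ghat t))\<^sup>2 * (cmod (expsum A c t))\<^sup>2) \<partial>lebesgue) = ennreal ((E A c)\<^sup>2)"
    if "finite A" for A c
  proof -
    have "(\<integral>\<^sup>+t. ennreal ((cmod (expsum A c t * Ghat t))\<^sup>2) \<partial>lebesgue) = ennreal ((E A c)\<^sup>2)"
      unfolding E_def L2_norm_sq by (rule nn_integral_eq_integral) (use EL2[OF that] in \<open>auto simp: L2_def\<close>)
    then show ?thesis by (simp add: norm_mult power_mult_distrib mult.commute)
  qed
  have weighted: "(\<integral>\<^sup>+t. ennreal (v t * (cmod (expsum A c t))\<^sup>2) \<partial>lebesgue)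
      \<le> ennreal (B * (L2_set (\<lambda>\<gamma>. cmod (c \<gamma>)) A)\<^sup>2 * suminf b)"
    if "finite A" "A \<subseteq> \<Gamma>" "\<And>n. b n \<ge> 0" "summable b" "AE t in lebesgue. v t \<le> b (int_encode \<lfloor>t\<rfloor>)" for A c b v
  proof -
    have "(L2_set (\<lambda>\<gamma>. cmod (c \<gamma>)) A)\<^sup>2 = (\<Sum>\<gamma>\<in>A. (cmod (c \<gamma>))\<^sup>2)" by (simp add: L2_set_def sum_nonneg)
    moreover have "\<delta> \<le> \<bar>\<gamma> - \<gamma>'\<bar>" if "\<gamma> \<in> A" "\<gamma>' \<in> A" "\<gamma> \<noteq> \<gamma>'" for \<gamma> \<gamma>' using that \<open>A \<subseteq> \<Gamma>\<close> sep by blast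
    ultimately show ?thesis unfolding B_def using Bessel_weighted[OF that(1) _ \<delta> that(3-5)] by simp
  qed
  define M where "M = suminf a"
  have M: "M \<ge> 0" unfolding M_def using a by (intro suminf_nonneg) auto
  have a_le_M: "a n \<le> M" for n
    using sum_le_suminf[OF a(2), of "{n}"] a(1) by (simp add: M_def)
  show ?thesis
  proof
    assume "l2_stable_shifts \<Gamma> G"
    then obtain C where C: "C > 0" and low: "\<And>A c. finite A \<Longrightarrow> A \<subseteq> \<Gamma> \<Longrightarrow> C * L2_set (\<lambda>\<gamma>. cmod (c \<gamma>)) A \<le> E A c"
      using l2_stable_shifts_finite_lower[OF _ assms(2), of \<Gamma>] shifts by metis
    obtain r where r: "r > 0" "summable (\<lambda>n. min (a n) (r\<^sup>2))" "(\<Sum>n. min (a n) (r\<^sup>2)) < C\<^sup>2 / (2 * B)"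
    proof (rule suminf_min_small[OF a])
      show "C\<^sup>2 / (2 * B) > 0" using B C by simp
    qed
    define S where "S = {t. cmod (Ghat t) > r}"
    have S: "S \<in> lmeasurable" unfolding S_def by (rule superlevel_lmeasurable[OF Ghat r(1)])
    then have [measurable]: "S \<in> sets lebesgue" by auto
    (* |Ghat|^2 <= M + 1 on S, and outside S it contributes at most half of C^2; M itself may be 0. *)
    have "C / sqrt (2 * (M + 1)) * L2_set (\<lambda>\<gamma>. cmod (c \<gamma>)) A \<le> L2_norm (\<lambda>t. indicator S t * expsum A c t)"
      if A: "finite A" "A \<subseteq> \<Gamma>" for A c
    proof -
      define N where "N = (L2_set (\<lambda>\<gamma>. cmod (c \<gamma>)) A)\<^sup>2"
      define X where "X = (L2_norm (\<lambda>t. indicator S t * expsum A c t))\<^sup>2"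
      define v where "v t = (if t \<in> S then 0 else (cmod (Ghat t))\<^sup>2)" for t
      have [measurable]: "v \<in> borel_measurable lebesgue" unfolding v_def[abs_def] by measurable
      have N: "N \<ge> 0" and X: "X \<ge> 0" by (auto simp: N_def X_def)
      have nnX: "(\<integral>\<^sup>+t. ennreal ((M + 1) * (cmod (indicator S t * expsum A c t))\<^sup>2) \<partial>lebesgue) = ennreal ((M + 1) * X)"
      proof -
        have "integrable lebesgue (\<lambda>t. (cmod (indicator S t * expsum A c t))\<^sup>2)"
          using indicator_expsum_L2[OF S, of A c] by (simp add: L2_def)
        then show ?thesis
          unfolding X_def L2_norm_sq using M
          by (subst nn_integral_eq_integral) auto
      qed
      have "ennreal (C\<^sup>2 * N) \<le> ennreal ((E A c)\<^sup>2)"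
        using power_mono[OF low[OF A, of c], of 2] C by (simp add: N_def power_mult_distrib L2_set_nonneg)
      also have "\<dots> = (\<integral>\<^sup>+t. ennreal ((cmod (Ghat t))\<^sup>2 * (cmod (expsum A c t))\<^sup>2) \<partial>lebesgue)"
        using nnE[OF A(1)] by simp
      also have "\<dots> \<le> (\<integral>\<^sup>+t. ennreal ((M + 1) * (cmod (indicator S t * expsum A c t))\<^sup>2) + ennreal (v t * (cmod (expsum A c t))\<^sup>2) \<partial>lebesgue)"
      proof (rule nn_integral_mono_AE)
        show "AE t in lebesgue. ennreal ((cmod (Ghat t))\<^sup>2 * (cmod (expsum A c t))\<^sup>2)
            \<le> ennreal ((M + 1) * (cmod (indicator S t * expsum A c t))\<^sup>2) + ennreal (v t * (cmod (expsum A c t))\<^sup>2)"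
          using maj
        proof eventually_elim
          case (elim t)
          have "(cmod (Ghat t))\<^sup>2 \<le> M + 1" using elim a_le_M[of "int_encode \<lfloor>t\<rfloor>"] by linarith
          then have "(cmod (Ghat t))\<^sup>2 * (cmod (expsum A c t))\<^sup>2 \<le> (M + 1) * (cmod (expsum A c t))\<^sup>2"
            by (intro mult_right_mono) auto
          then show ?case by (cases "t \<in> S") (auto simp: v_def intro: ennreal_leI)
        qed
      qed
      also have "\<dots> = (\<integral>\<^sup>+t. ennreal ((M + 1) * (cmod (indicator S t * expsum A c t))\<^sup>2) \<partial>lebesgue)
          + (\<integral>\<^sup>+t. ennreal (v t * (cmod (expsum A c t))\<^sup>2) \<partial>lebesgue)"
        by (rule nn_integral_add) measurable
      also have "\<dots> \<le> ennreal ((M + 1) * X) + ennreal (B * N * (\<Sum>n. min (a n) (r\<^sup>2)))"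
      proof (rule add_mono)
        have "AE t in lebesgue. v t \<le> min (a (int_encode \<lfloor>t\<rfloor>)) (r\<^sup>2)"
          using maj
        proof eventually_elim
          case (elim t)
          have "(cmod (Ghat t))\<^sup>2 \<le> r\<^sup>2" if "t \<notin> S" using that by (intro power_mono) (auto simp: S_def)
          then show ?case using elim a(1)[of "int_encode \<lfloor>t\<rfloor>"] by (auto simp: v_def)
        qed
        then show "(\<integral>\<^sup>+t. ennreal (v t * (cmod (expsum A c t))\<^sup>2) \<partial>lebesgue) \<le> ennreal (B * N * (\<Sum>n. min (a n) (r\<^sup>2)))"
          unfolding N_def using a(1) r(2) by (intro weighted A) auto
      qed (simp only: nnX order_refl)
      also have "\<dots> \<le> ennreal ((M + 1) * X) + ennreal (C\<^sup>2 / 2 * N)"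
      proof (intro add_left_mono ennreal_leI)
        have "B * N * (\<Sum>n. min (a n) (r\<^sup>2)) \<le> B * N * (C\<^sup>2 / (2 * B))"
          using r(3) B N by (intro mult_left_mono) auto
        then show "B * N * (\<Sum>n. min (a n) (r\<^sup>2)) \<le> C\<^sup>2 / 2 * N" using B by (simp add: field_simps)
      qed
      also have "\<dots> = ennreal ((M + 1) * X + C\<^sup>2 / 2 * N)"
        using M X N by (intro ennreal_plus[symmetric]) auto
      finally have "C\<^sup>2 * N \<le> (M + 1) * X + C\<^sup>2 / 2 * N"
        using M X N by (subst (asm) ennreal_le_iff) auto
      then have "(C / sqrt (2 * (M + 1)))\<^sup>2 * N \<le> X"
        using M by (simp add: power_divide field_simps)
      then have "(C / sqrt (2 * (M + 1)) * L2_set (\<lambda>\<gamma>. cmod (c \<gamma>)) A)\<^sup>2 \<le> (L2_norm (\<lambda>t. indicator S t * expsum A c t))\<^sup>2"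
        unfolding N_def X_def power_mult_distrib .
      then show ?thesis by (rule power2_le_imp_le) simp
    qed
    moreover have "C / sqrt (2 * (M + 1)) > 0" using C M by simp
    ultimately have "interpolation_set \<Gamma> S"
      unfolding interpolation_set_iff_lower_bound[OF assms(1) S] by blast
    then show "\<exists>r>0. interpolation_set \<Gamma> {t. cmod (Ghat t) > r}"
      using r(1) unfolding S_def by blast
  next
    assume "\<exists>r>0. interpolation_set \<Gamma> {t. cmod (Ghat t) > r}"
    then obtain r where r: "r > 0" "interpolation_set \<Gamma> {t. cmod (Ghat t) > r}" by blast
    define S where "S = {t. cmod (Ghat t) > r}"
    have S: "S \<in> lmeasurable" unfolding S_def by (rule superlevel_lmeasurable[OF Ghat r(1)])
    obtain K where K: "K > 0" and low: "\<And>A c. finite A \<Longrightarrow> A \<subseteq> \<Gamma> \<Longrightarrow>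
        K * L2_set (\<lambda>\<gamma>. cmod (c \<gamma>)) A \<le> L2_norm (\<lambda>t. indicator S t * expsum A c t)"
      using r(2) interpolation_set_iff_lower_bound[OF assms(1) S] unfolding S_def by blast
    (* The summand 1 keeps the upper constant positive. *)
    show "l2_stable_shifts \<Gamma> G"
    proof (rule l2_stable_shifts_of_finite_bounds[OF assms(2)])
      show "r * K > 0" using r K by simp
      show "sqrt (B * M + 1) > 0" using B M by (simp add: add_nonneg_pos)
      fix A c assume A: "finite A" "A \<subseteq> \<Gamma>"
      have "L2_norm (\<lambda>t. indicator S t * expsum A c t) \<le> 1 / r * E A c"
        unfolding E_def
      proof (rule L2_mono(2)[OF EL2[OF A(1)]])
        show "(\<lambda>t. indicator S t * expsum A c t) \<in> borel_measurable lebesgue"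
          using indicator_expsum_L2[OF S] by (simp add: L2_def)
        show "AE t in lebesgue. cmod (indicator S t * expsum A c t) \<le> 1 / r * cmod (expsum A c t * Ghat t)"
        proof (rule AE_I2)
          fix t
          have "r * cmod (expsum A c t) \<le> cmod (Ghat t) * cmod (expsum A c t)" if "t \<in> S"
            using that by (intro mult_right_mono) (auto simp: S_def)
          then show "cmod (indicator S t * expsum A c t) \<le> 1 / r * cmod (expsum A c t * Ghat t)"
            using r(1) by (cases "t \<in> S") (auto simp: norm_mult field_simps)
        qed
      qed (use r in auto)
      then have "r * L2_norm (\<lambda>t. indicator S t * expsum A c t) \<le> E A c"
        using r(1) by (simp add: field_simps)
      moreover have "r * (K * L2_set (\<lambda>\<gamma>. cmod (c \<gamma>)) A) \<le> r * L2_norm (\<lambda>t. indicator S t * expsum A c t)"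
        using low[OF A] r(1) by (intro mult_left_mono) auto
      ultimately show "r * K * L2_set (\<lambda>\<gamma>. cmod (c \<gamma>)) A \<le> L2_norm (\<lambda>x. \<Sum>\<gamma>\<in>A. c \<gamma> * G (x - \<gamma>))"
        unfolding shifts[OF A(1)] by simp
      define N where "N = (L2_set (\<lambda>\<gamma>. cmod (c \<gamma>)) A)\<^sup>2"
      have "ennreal ((E A c)\<^sup>2) \<le> ennreal (B * N * M)"
        unfolding nnE[OF A(1), symmetric] N_def M_def by (rule weighted[OF A a maj])
      then have "(E A c)\<^sup>2 \<le> B * N * M"
        using B M by (subst (asm) ennreal_le_iff) (auto simp: N_def)
      also have "\<dots> \<le> (B * M + 1) * N" by (simp add: N_def algebra_simps)
      also have "\<dots> = (sqrt (B * M + 1) * L2_set (\<lambda>\<gamma>. cmod (c \<gamma>)) A)\<^sup>2"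
        using B M by (simp add: N_def power_mult_distrib)
      finally have "E A c \<le> sqrt (B * M + 1) * L2_set (\<lambda>\<gamma>. cmod (c \<gamma>)) A"
        by (rule power2_le_imp_le) (use B M in \<open>auto simp: L2_set_nonneg\<close>)
      then show "L2_norm (\<lambda>x. \<Sum>\<gamma>\<in>A. c \<gamma> * G (x - \<gamma>)) \<le> sqrt (B * M + 1) * L2_set (\<lambda>\<gamma>. cmod (c \<gamma>)) A"
        unfolding shifts[OF A(1)] .
    qed
  qed
qed

end
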